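(* There is an algorithm that, given an $n$-vertex graph $G$ together with a path decomposition of width $\mathrm{pw}(G)$, computes the number of forests in $G$ (i.e. the number of edge sets $A\subseteq E(G)$ such that $(V(G),A)$ is acyclic) in time $4^{\mathrm{pw}(G)}n^{O(1)}$. *)

theory Defs
  imports "HOL-Library.Log_Nat"
begin

definition simple_graph :: "'a set \<Rightarrow> 'a set set \<Rightarrow> bool" where
  "simple_graph V E \<longleftrightarrow> finite V \<and> (\<forall>e\<in>E. e \<subseteq> V \<and> card e = 2)"

definition is_cycle :: "'a set set \<Rightarrow> 'a list \<Rightarrow> bool" where
  "is_cycle A vs \<longleftrightarrow> length vs \<ge> 3 \<and> distinct vs \<and>
     (\<forall>i<length vs. {vs ! i, vs ! (Suc i mod length vs)} \<in> A)"

definition acyclic_graph :: "'a set set \<Rightarrow> bool" where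
  "acyclic_graph A \<longleftrightarrow> (\<nexists>vs. is_cycle A vs)"

definition num_forests :: "'a set set \<Rightarrow> nat" where
  "num_forests E = card {A. A \<subseteq> E \<and> acyclic_graph A}"

definition path_decomposition :: "'a set \<Rightarrow> 'a set set \<Rightarrow> 'a set list \<Rightarrow> bool" where
  "path_decomposition V E P \<longleftrightarrow>
     \<Union>(set P) = V \<and>
     (\<forall>e\<in>E. \<exists>X\<in>set P. e \<subseteq> X) \<and>
     (\<forall>i j k. i \<le> j \<and> j \<le> k \<and> k < length P \<longrightarrow> P ! i \<inter> P ! k \<subseteq> P ! j)"

text \<open>The truncated subtraction is harmless for graphs with at least one vertex: some bag is
  then nonempty.\<close>

definition pd_width :: "'a set list \<Rightarrow> nat" where
  "pd_width P = Max (card ` set P) - 1"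

definition pathwidth :: "'a set \<Rightarrow> 'a set set \<Rightarrow> nat" where
  "pathwidth V E = (LEAST w. \<exists>P. path_decomposition V E P \<and> pd_width P = w)"

text \<open>
  Time is measured on a random access machine under the logarithmic cost criterion (Cook and
  Reckhow; Aho, Hopcroft and Ullman): every instruction is charged the bit lengths of the integers
  and memory addresses it handles. Control flow is structured, which translates to jumps with only
  constant overhead. A program mentions finitely many registers, whose indices are therefore not
  charged; the memory is unbounded and accessed indirectly through registers.
\<close>

datatype arith_op = Add | Sub | Mult | Div

fun apply_op :: "arith_op \<Rightarrow> int \<Rightarrow> int \<Rightarrow> int" where
  "apply_op Add x y = x + y"
| "apply_op Sub x y = x - y"
| "apply_op Mult x y = x * y"
| "apply_op Div x y = x div y"

datatype program =
    Skip
  | SetConst nat int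
  | Arith arith_op nat nat nat
  | Load nat nat
  | Store nat nat
  | Seq program program
  | IfPos nat program program
  | WhilePos nat program

text \<open>Register contents and memory contents.\<close>

type_synonym state = "(nat \<Rightarrow> int) \<times> (nat \<Rightarrow> int)"

definition int_len :: "int \<Rightarrow> nat" where
  "int_len x = max 1 (floorlog 2 (nat \<bar>x\<bar>))"

text \<open>\<open>exec p s t s'\<close>: started in \<open>s\<close>, the program \<open>p\<close> halts in \<open>s'\<close> after total cost \<open>t\<close>.
  Accessing a negative address gets stuck.\<close>

inductive exec :: "program \<Rightarrow> state \<Rightarrow> nat \<Rightarrow> state \<Rightarrow> bool" where
  Skip: "exec Skip s 1 s"
| SetConst: "exec (SetConst r x) (R, M) (1 + int_len x) (R(r := x), M)"
| Arith: "exec (Arith f r a b) (R, M)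
    (1 + int_len (R a) + int_len (R b)) (R(r := apply_op f (R a) (R b)), M)"
| Load: "R a \<ge> 0 \<Longrightarrow> exec (Load r a) (R, M)
    (1 + int_len (R a) + int_len (M (nat (R a)))) (R(r := M (nat (R a))), M)"
| Store: "R a \<ge> 0 \<Longrightarrow> exec (Store a b) (R, M)
    (1 + int_len (R a) + int_len (R b)) (R, M(nat (R a) := R b))"
| Seq: "exec p s t s' \<Longrightarrow> exec q s' t' s'' \<Longrightarrow> exec (Seq p q) s (t + t') s''"
| IfTrue: "R r > 0 \<Longrightarrow> exec p (R, M) t s' \<Longrightarrow>
    exec (IfPos r p q) (R, M) (1 + int_len (R r) + t) s'"
| IfFalse: "R r \<le> 0 \<Longrightarrow> exec q (R, M) t s' \<Longrightarrow>
    exec (IfPos r p q) (R, M) (1 + int_len (R r) + t) s'"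
| WhileFalse: "R r \<le> 0 \<Longrightarrow> exec (WhilePos r p) (R, M) (1 + int_len (R r)) (R, M)"
| WhileTrue: "R r > 0 \<Longrightarrow> exec p (R, M) t s' \<Longrightarrow> exec (WhilePos r p) s' t' s'' \<Longrightarrow>
    exec (WhilePos r p) (R, M) (1 + int_len (R r) + t + t') s''"

inductive_cases SkipE: "exec Skip s t s'"
inductive_cases SetConstE: "exec (SetConst r x) s t s'"
inductive_cases ArithE: "exec (Arith f r a b) s t s'"
inductive_cases LoadE: "exec (Load r a) s t s'"
inductive_cases StoreE: "exec (Store a b) s t s'"
inductive_cases SeqE: "exec (Seq p q) s t s'"
inductive_cases IfPosE: "exec (IfPos r p q) s t s'"
inductive_cases WhilePosE: "exec (WhilePos r p) s t s'"

lemma exec_deterministic: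
  "exec p s t s' \<Longrightarrow> exec p s u s'' \<Longrightarrow> u = t \<and> s'' = s'"
proof (induction arbitrary: u s'' rule: exec.induct)
  case (Skip s)
  then show ?case by (rule SkipE) simp
next
  case (SetConst r x R M)
  then show ?case by (rule SetConstE) simp
next
  case (Arith f r a b R M)
  then show ?case by (rule ArithE) simp
next
  case (Load R a r M)
  from Load.prems show ?case by (rule LoadE) simp
next
  case (Store R a b M)
  from Store.prems show ?case by (rule StoreE) simp
next
  case (Seq p s t s1 q t' s2)
  from Seq.prems obtain v s3 v' where
    "u = v + v'" "exec p s v s3" "exec q s3 v' s''" by (rule SeqE)
  with Seq.IH(1)[of v s3] Seq.IH(2)[of v' s''] show ?case by simp
next
  case (IfTrue R r p M t s1 q)
  from IfTrue.prems obtain v where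
    "u = 1 + int_len (R r) + v" "exec p (R, M) v s''"
    by (rule IfPosE) (use IfTrue.hyps(1) in simp_all)
  with IfTrue.IH[of v s''] show ?case by simp
next
  case (IfFalse R r q M t s1 p)
  from IfFalse.prems obtain v where
    "u = 1 + int_len (R r) + v" "exec q (R, M) v s''"
    by (rule IfPosE) (use IfFalse.hyps(1) in simp_all)
  with IfFalse.IH[of v s''] show ?case by simp
next
  case (WhileFalse R r p M)
  from WhileFalse.prems show ?case
    by (rule WhilePosE) (use WhileFalse.hyps in simp_all)
next
  case (WhileTrue R r p M t s1 t' s2)
  from WhileTrue.prems obtain v s3 v' where
    "u = 1 + int_len (R r) + v + v'" "exec p (R, M) v s3" "exec (WhilePos r p) s3 v' s''"
    by (rule WhilePosE) (use WhileTrue.hyps(1) in simp_all)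
  with WhileTrue.IH(1)[of v s3] WhileTrue.IH(2)[of v' s''] show ?case by simp
qed

definition init_state :: "int list \<Rightarrow> state" where
  "init_state xs = ((\<lambda>_. 0), (\<lambda>a. if a < length xs then xs ! a else 0))"

definition outputs_within :: "program \<Rightarrow> int list \<Rightarrow> int \<Rightarrow> nat \<Rightarrow> bool" where
  "outputs_within p xs y b \<longleftrightarrow>
     (\<exists>t R M. exec p (init_state xs) t (R, M) \<and> R 0 = y \<and> t \<le> b)"

text \<open>
  A graph on the vertices \<open>0, \<dots>, n - 1\<close> with a list of bags is presented to a program as the number
  of vertices, the number of bags, the adjacency matrix row by row, and the characteristic vectors
  of the bags.
\<close>

definition encode_input :: "nat \<Rightarrow> nat set set \<Rightarrow> nat set list \<Rightarrow> int list" where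
  "encode_input n E P =
     [int n, int (length P)]
     @ [of_bool ({i, j} \<in> E). i \<leftarrow> [0..<n], j \<leftarrow> [0..<n]]
     @ [of_bool (v \<in> X). X \<leftarrow> P, v \<leftarrow> [0..<n]]"

text \<open>
  A path decomposition may repeat bags arbitrarily often, and no algorithm that reads it can run in
  time depending on the graph alone. The polynomial factor \<open>n\<^bsup>O(1)\<^esup>\<close> therefore presupposes that the
  number \<open>r\<close> of bags is polynomial in \<open>n\<close>. Taking this factor to be polynomial in \<open>n + r\<close> covers all
  decompositions and gives \<open>n\<^bsup>O(1)\<^esup>\<close> whenever \<open>r\<close> is polynomial in \<open>n\<close>, in particular (with
  \<open>r \<le> n\<close>) when no bag is contained in a neighbouring one.
\<close>

definition runtime_bound :: "nat \<Rightarrow> nat \<Rightarrow> nat \<Rightarrow> nat \<Rightarrow> nat" where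
  "runtime_bound c w n r = c * 4 ^ w * (n + r) ^ c"

end

theory Submission
  imports Defs "HOL-Library.Transitive_Closure_Table"
begin

text \<open>
  For a forest \<open>A\<close> let \<open>M\<^sub>A\<close> be the 0/1 matrix of the relation ``connected in \<open>A\<close>'' on the current bag.
  The dynamic program stores, for all sets \<open>I\<close>, \<open>J\<close> of bag vertices, the sum over the forests \<open>A\<close> of the
  edges seen so far of the minor of \<open>M\<^sub>A\<close> with rows \<open>I\<close> and columns \<open>J\<close>. Adding an edge \<open>ij\<close> between two
  components updates \<open>M\<^sub>A\<close> by a matrix of rank two, and the new minors are a fixed linear combination of
  old ones with \<open>i\<close> and \<open>j\<close> adjoined to \<open>I\<close> and \<open>J\<close>. If \<open>i\<close> and \<open>j\<close> are already connected, the rows of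
  \<open>i\<close> and \<open>j\<close> agree and the same combination vanishes, so that edge sets with a cycle cancel without
  being recognised. A new vertex adjoins a row and a column of the identity matrix, forgetting a vertex
  restricts \<open>I\<close> and \<open>J\<close>, and the entry at \<open>I = J = {}\<close> is the number of forests. A bag of \<open>k\<close> vertices
  has \<open>4\<^sup>k\<close> pairs \<open>(I, J)\<close>. (In the language of Grassmann algebra this is the fermionic representation
  of spanning forests, with two generators per vertex.)
\<close>


section \<open>Minors of the link matrix under bordering\<close>

text \<open>Indexing the table by the partitions of a bag into components would take
  superexponentially many entries. Minors avoid this because an edge acts on them linearly, so that
  the sum over forests can be formed before the update and no entry has to know which partition a
  forest induces. This linearity is not obvious, as a minor of a rank-two perturbation has a term of
  second order. Let \<open>A\<close> be the submatrix and \<open>c_i\<close>, \<open>r_i\<close> the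
  column and row of \<open>i\<close>. The second-order parts of
  \<open>det (A + c_i r_j + c_j r_i)\<close> and \<open>det (A - c_i r_i - c_j r_j)\<close> are
  opposite, and the second determinant is the minor bordered by both \<open>i\<close> and
  \<open>j\<close>, provided that the link matrix is the identity on \<open>i\<close> and
  \<open>j\<close>, that is, that they are not linked. Keeping the base at 4 requires a table of
  \<open>2 ^ k\<close> rows and columns for bags of at most \<open>k\<close> vertices, so slots are
  recycled. Vertices enter one at a time together with their edges to active vertices; each edge is
  thus handled once, when the later of its ends appears. Each edge multiplies the bound on the
  entries by 6, so their bit length stays polynomial.\<close>

text \<open>\<open>row_exp r g\<close> is Laplace expansion along a top row \<open>r\<close>, where \<open>g\<close> gives the minors of the remaining
  rows. Rows and columns are lists so that the signs of reordering stay visible.\<close>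

fun row_exp :: "('a \<Rightarrow> int) \<Rightarrow> ('a list \<Rightarrow> int) \<Rightarrow> 'a list \<Rightarrow> int" where
  "row_exp r g [] = 0"
| "row_exp r g (y # ys) = r y * g ys - row_exp r (\<lambda>zs. g (y # zs)) ys"

fun minor :: "('a \<Rightarrow> 'b \<Rightarrow> int) \<Rightarrow> 'a list \<Rightarrow> 'b list \<Rightarrow> int" where
  "minor f [] = (\<lambda>ys. of_bool (ys = []))"
| "minor f (x # xs) = row_exp (f x) (minor f xs)"

section \<open>Linearity of Laplace expansion\<close>

lemma row_exp_add: "row_exp r (\<lambda>zs. g zs + h zs) ys = row_exp r g ys + row_exp r h ys"
  by (induction ys arbitrary: g h) (simp_all add: algebra_simps)

lemma row_exp_scale: "row_exp r (\<lambda>zs. c * g zs) ys = c * row_exp r g ys"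
  by (induction ys arbitrary: g) (simp_all add: algebra_simps)

lemma row_exp_uminus: "row_exp r (\<lambda>zs. - g zs) ys = - row_exp r g ys"
  using row_exp_scale[of r "-1"] by simp

lemma row_exp_diff: "row_exp r (\<lambda>zs. g zs - h zs) ys = row_exp r g ys - row_exp r h ys"
  using row_exp_add[of r g "\<lambda>zs. - h zs"] by (simp add: row_exp_uminus)

lemma row_exp_zero: "row_exp r (\<lambda>zs. 0) ys = 0"
  using row_exp_scale[of r 0] by simp

lemma row_exp_row_add: "row_exp (\<lambda>y. r y + s y) g ys = row_exp r g ys + row_exp s g ys"
  by (induction ys arbitrary: g) (simp_all add: algebra_simps)

lemma row_exp_row_scale: "row_exp (\<lambda>y. c * r y) g ys = c * row_exp r g ys"
  by (induction ys arbitrary: g) (simp_all add: algebra_simps)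

lemma row_exp_cong: "(\<And>y. y \<in> set ys \<Longrightarrow> r y = s y) \<Longrightarrow> row_exp r g ys = row_exp s g ys"
  by (induction ys arbitrary: g) simp_all

lemma row_exp_fun_cong:
  "(\<And>zs. set zs \<subseteq> set ys \<Longrightarrow> g zs = h zs) \<Longrightarrow> row_exp r g ys = row_exp r h ys"
proof (induction ys arbitrary: g h)
  case (Cons y ys)
  have "row_exp r (\<lambda>zs. g (y # zs)) ys = row_exp r (\<lambda>zs. h (y # zs)) ys"
    by (rule Cons.IH, rule Cons.prems) auto
  moreover have "g ys = h ys" by (rule Cons.prems) auto
  ultimately show ?case by simp
qed simp

text \<open>\<open>row_exp r\<close> is exterior multiplication by the covector \<open>r\<close>.
  Two of them remove an ordered pair of positions, and the two orders of a pair carry opposite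
  signs, whatever \<open>g\<close> is.\<close>

lemma row_exp_anticommute: "row_exp r (row_exp s g) ys = - row_exp s (row_exp r g) ys"
  by (induction ys arbitrary: g) (simp_all add: row_exp_diff row_exp_scale)

lemma row_exp_snoc:
  "row_exp r g (ys @ [y]) = row_exp r (\<lambda>zs. g (zs @ [y])) ys + (-1) ^ length ys * r y * g ys"
  by (induction ys arbitrary: g) (simp_all add: algebra_simps)

lemma row_exp_length:
  "(\<And>zs. length zs \<noteq> k \<Longrightarrow> g zs = 0) \<Longrightarrow> length ys \<noteq> Suc k \<Longrightarrow> row_exp r g ys = 0"
proof (induction ys arbitrary: g k)
  case (Cons y ys)
  have "row_exp r (\<lambda>zs. g (y # zs)) ys = 0"
  proof (cases k)
    case 0
    then have "(\<lambda>zs. g (y # zs)) = (\<lambda>zs. 0)" using Cons.prems(1) by auto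
    then show ?thesis by (simp add: row_exp_zero)
  next
    case (Suc k')
    show ?thesis by (rule Cons.IH[of k']) (use Suc Cons.prems in auto)
  qed
  with Cons.prems show ?case by simp
qed simp

lemma minor_length: "length xs \<noteq> length ys \<Longrightarrow> minor f xs ys = 0"
proof (induction xs arbitrary: ys)
  case (Cons x xs)
  have "row_exp (f x) (minor f xs) ys = 0"
    by (rule row_exp_length[of "length xs"]) (use Cons in auto)
  then show ?case by simp
qed simp

lemma minor_cong:
  "(\<And>x y. x \<in> set xs \<Longrightarrow> y \<in> set ys \<Longrightarrow> f x y = h x y) \<Longrightarrow> minor f xs ys = minor h xs ys"
proof (induction xs arbitrary: ys)
  case (Cons x xs)
  have "row_exp (f x) (minor f xs) ys = row_exp (f x) (minor h xs) ys"
    by (rule row_exp_fun_cong, rule Cons.IH, rule Cons.prems) auto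
  also have "\<dots> = row_exp (h x) (minor h xs) ys"
    by (rule row_exp_cong) (use Cons.prems in auto)
  finally show ?case by simp
qed simp

section \<open>Antisymmetry in rows and columns\<close>

definition alternating :: "('a list \<Rightarrow> int) \<Rightarrow> bool" where
  "alternating g \<longleftrightarrow> (\<forall>ps x y zs. g (ps @ x # y # zs) = - g (ps @ y # x # zs))"

lemma alternatingD: "alternating g \<Longrightarrow> g (ps @ x # y # zs) = - g (ps @ y # x # zs)"
  unfolding alternating_def by blast

lemma alternating_rows: "alternating (\<lambda>xs. minor f xs ys)"
proof -
  have "minor f (ps @ x # y # zs) ys = - minor f (ps @ y # x # zs) ys" for ps x y zs ys
  proof (induction ps arbitrary: ys)
    case Nil
    then show ?case by (simp add: row_exp_anticommute[of "f x"])
  next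
    case (Cons p ps)
    have "minor f (ps @ x # y # zs) = (\<lambda>ys. - minor f (ps @ y # x # zs) ys)"
      using Cons.IH by blast
    then show ?case by (simp add: row_exp_uminus)
  qed
  then show ?thesis unfolding alternating_def by blast
qed

lemma alternating_row_exp: "alternating g \<Longrightarrow> alternating (row_exp r g)"
proof -
  have "row_exp r g (ps @ x # y # zs) = - row_exp r g (ps @ y # x # zs)"
    if "alternating g" for g ps x y zs
    using that
  proof (induction ps arbitrary: g)
    case Nil
    have "(\<lambda>us. g (x # y # us)) = (\<lambda>us. - g (y # x # us))"
      by (intro ext, rule alternatingD[OF Nil, of "[]", unfolded append_Nil])
    then show ?case by (simp add: row_exp_uminus)
  next
    case (Cons p ps)
    have "alternating (\<lambda>us. g (p # us))"
      using Cons.prems unfolding alternating_def by (metis append_Cons)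
    from Cons.IH[OF this] have "row_exp r (\<lambda>us. g (p # us)) (ps @ x # y # zs) = - row_exp r (\<lambda>us. g (p # us)) (ps @ y # x # zs)"
      by blast
    moreover have "g (ps @ x # y # zs) = - g (ps @ y # x # zs)"
      by (rule alternatingD[OF Cons.prems])
    ultimately show ?case by simp
  qed
  then show "alternating g \<Longrightarrow> alternating (row_exp r g)" unfolding alternating_def[of "row_exp r g"] by blast
qed

lemma alternating_cols: "alternating (minor f xs)"
  by (induction xs) (simp_all add: alternating_row_exp, simp add: alternating_def)

lemma alternating_move:
  assumes "alternating g"
  shows "g (ps @ us @ x # zs) = (-1) ^ length us * g (ps @ x # us @ zs)"
proof (induction us arbitrary: ps)
  case (Cons u us)
  have "g (ps @ (u # us) @ x # zs) = (-1) ^ length us * g (ps @ u # x # us @ zs)"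
    using Cons.IH[of "ps @ [u]"] by simp
  also have "g (ps @ u # x # us @ zs) = - g (ps @ x # u # us @ zs)"
    by (rule alternatingD[OF assms])
  finally show ?case by simp
qed simp

text \<open>An integer equal to its own negative is 0, so it suffices to bring the two copies
  together.\<close>

lemma alternating_dup:
  assumes "alternating g"
  shows "g (ps @ x # us @ x # zs) = 0"
proof -
  have "g (ps @ x # x # us @ zs) = - g (ps @ x # x # us @ zs)"
    by (rule alternatingD[OF assms])
  then show ?thesis using alternating_move[OF assms, of "ps @ [x]" us x zs] by simp
qed

lemma minor_zero_row: "x \<in> set xs \<Longrightarrow> (\<And>y. y \<in> set ys \<Longrightarrow> f x y = 0) \<Longrightarrow> minor f xs ys = 0"
proof (induction xs arbitrary: ys)
  case (Cons a xs)
  show ?case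
  proof (cases "a = x")
    case True
    then have "row_exp (f a) (minor f xs) ys = row_exp (\<lambda>y. 0 * f a y) (minor f xs) ys"
      by (intro row_exp_cong) (use Cons.prems in auto)
    then show ?thesis by (simp add: row_exp_row_scale del: mult_zero_left)
  next
    case False
    have "row_exp (f a) (minor f xs) ys = row_exp (f a) (\<lambda>zs. 0) ys"
      by (rule row_exp_fun_cong) (use Cons False in auto)
    then show ?thesis by (simp add: row_exp_zero)
  qed
qed simp

lemma row_exp_zero_col:
  "y \<in> set ys \<Longrightarrow> r y = 0 \<Longrightarrow> (\<And>zs. y \<in> set zs \<Longrightarrow> g zs = 0) \<Longrightarrow> row_exp r g ys = 0"
proof (induction ys arbitrary: g)
  case (Cons a ys)
  show ?case
  proof (cases "a = y")
    case True
    then have "(\<lambda>zs. g (a # zs)) = (\<lambda>zs. 0)" using Cons.prems by auto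
    then show ?thesis using True Cons.prems by (simp add: row_exp_zero)
  next
    case False
    then have "row_exp r (\<lambda>zs. g (a # zs)) ys = 0" "g ys = 0"
      using Cons.prems by (auto intro!: Cons.IH)
    then show ?thesis by simp
  qed
qed simp

lemma minor_zero_col: "y \<in> set ys \<Longrightarrow> (\<And>x. x \<in> set xs \<Longrightarrow> f x y = 0) \<Longrightarrow> minor f xs ys = 0"
proof (induction xs arbitrary: ys)
  case (Cons x xs)
  have "row_exp (f x) (minor f xs) ys = 0"
    by (rule row_exp_zero_col) (use Cons in auto)
  then show ?case by simp
qed auto

text \<open>Row \<open>i\<close> is a unit vector on the columns \<open>ys @ [i]\<close>. Moving it
  to the top costs \<open>(-1) ^ length xs\<close> and expanding along it costs
  \<open>(-1) ^ length ys\<close>; for square minors the two signs cancel.\<close>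

lemma minor_isolated:
  assumes "f i i = 1" "\<And>y. y \<in> set ys \<Longrightarrow> f i y = 0"
  shows "minor f (xs @ [i]) (ys @ [i]) = minor f xs ys"
proof (cases "length xs = length ys")
  case True
  have "minor f (xs @ [i]) (ys @ [i]) = (-1) ^ length xs * minor f (i # xs) (ys @ [i])"
    using alternating_move[OF alternating_rows, of f "[]" xs i "[]" "ys @ [i]"] by simp
  also have "minor f (i # xs) (ys @ [i]) = (-1) ^ length ys * minor f xs ys"
  proof -
    have "row_exp (f i) (\<lambda>zs. minor f xs (zs @ [i])) ys
        = row_exp (\<lambda>y. 0 * f i y) (\<lambda>zs. minor f xs (zs @ [i])) ys"
      by (intro row_exp_cong) (use assms in auto)
    then show ?thesis using assms(1) by (simp add: row_exp_snoc row_exp_row_scale del: mult_zero_left)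
  qed
  finally show ?thesis using True by (cases "even (length xs)") simp_all
qed (simp add: minor_length)

declare minor.simps(2) [simp del]

text \<open>With \<open>M\<^sub>x\<^sub>y\<close> the minor bordered by row \<open>x\<close> and column \<open>y\<close>, this is
  \<open>M\<^sub>i\<^sub>i + M\<^sub>j\<^sub>j - M\<^sub>i\<^sub>j - M\<^sub>j\<^sub>i - M\<^sub>i\<^sub>j\<^sub>,\<^sub>i\<^sub>j\<close>, the action of the edge \<open>ij\<close>. Bordering at the end of
  the lists leaves the first row free for the induction in \<open>minor_merge\<close>.\<close>

definition border :: "('a \<Rightarrow> 'a \<Rightarrow> int) \<Rightarrow> 'a \<Rightarrow> 'a \<Rightarrow> 'a list \<Rightarrow> 'a list \<Rightarrow> int" where
  "border f i j xs ys =
     minor f (xs @ [i]) (ys @ [i]) + minor f (xs @ [j]) (ys @ [j])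
     - minor f (xs @ [i]) (ys @ [j]) - minor f (xs @ [j]) (ys @ [i])
     - minor f (xs @ [i, j]) (ys @ [i, j])"

text \<open>When rows \<open>i\<close> and \<open>j\<close> agree, the four singly bordered minors
  cancel in pairs and the doubly bordered one has a repeated row.\<close>

lemma border_eq_0:
  assumes "f i = f j"
  shows "border f i j xs ys = 0"
proof -
  have 1: "minor f (xs @ [i]) = minor f (xs @ [j])"
    by (induction xs) (use assms in \<open>auto simp: minor.simps(2)\<close>)
  have 2: "minor f (xs @ [i, j]) = minor f (xs @ [i, i])"
    by (induction xs) (use assms in \<open>auto simp: minor.simps(2)\<close>)
  have "minor f (xs @ [i, i]) zs = 0" for zs
    using alternating_dup[OF alternating_rows, of f xs i "[]" "[]" zs] by simp
  then show ?thesis by (simp add: border_def 1 2)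
qed

text \<open>These are the two cross terms in the induction step of \<open>minor_merge\<close>. The
  expansion runs over \<open>ys\<close> only, so it equals a minor with the new row on top less the
  terms of the bordering columns, which the unit entries evaluate. Minors in which the new row
  already borders vanish; in the others it is moved to the end.\<close>

lemma row_exp_border:
  assumes unit: "f i i = 1" "f j j = 1" "f i j = 0" "f j i = 0" and len: "length ys = Suc (length xs)"
  shows "row_exp (f j) (border f i j xs) ys = (-1) ^ length ys *
     (minor f (xs @ [i]) ys - minor f (xs @ [j]) ys - minor f (xs @ [i, j]) (ys @ [j]))"
    (is ?A)
    and "row_exp (f i) (border f i j xs) ys = (-1) ^ length ys *
     (minor f (xs @ [j]) ys - minor f (xs @ [i]) ys - minor f (xs @ [j, i]) (ys @ [i]))"
    (is ?B)
proof -
  have *: "row_exp (f k) (\<lambda>zs. minor f us (zs @ [l])) ys =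
      minor f (k # us) (ys @ [l]) - (-1) ^ length ys * f k l * minor f us ys" for k l us
    by (simp add: row_exp_snoc minor.simps(2))
  have **: "row_exp (f k) (\<lambda>zs. minor f us (zs @ [l, m])) ys =
      minor f (k # us) (ys @ [l, m]) - (-1) ^ length ys * f k l * minor f us (ys @ [m])
      + (-1) ^ length ys * f k m * minor f us (ys @ [l])" for k l m us
    using row_exp_snoc[of "f k" "minor f us" "ys @ [l]" m]
      row_exp_snoc[of "f k" "\<lambda>zs. minor f us (zs @ [m])" ys l] by (simp add: minor.simps(2))
  have dup: "minor f (k # xs @ [k]) zs = 0" "minor f (j # xs @ [i, j]) zs = 0"
    "minor f (i # xs @ [i, j]) zs = 0" for k zs
    using alternating_dup[OF alternating_rows, of f "[]" k xs "[]" zs]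
      alternating_dup[OF alternating_rows, of f "[]" j "xs @ [i]" "[]" zs]
      alternating_dup[OF alternating_rows, of f "[]" i "xs" "[j]" zs] by simp_all
  have mv: "minor f (k # xs @ [l]) zs = (-1) ^ length ys * minor f (xs @ [l, k]) zs" for k l zs
    using alternating_move[OF alternating_rows, of f "[]" "xs @ [l]" k "[]" zs] len
    by (cases "even (length xs)") simp_all
  have sw: "minor f (xs @ [i, j]) zs = - minor f (xs @ [j, i]) zs" for zs
    by (rule alternatingD[OF alternating_rows, of f xs _ _ "[]"])
  note simps = border_def[abs_def] row_exp_add row_exp_diff * ** dup unit
  show ?A by (simp add: simps) (simp add: mv algebra_simps)
  show ?B by (simp add: simps) (simp add: mv sw algebra_simps)
qed

text \<open>A Schur complement would require an invertible submatrix; induction on the rows does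
  not. The merged first row combines three rows of \<open>f\<close>, the remaining rows are
  \<open>border\<close> by induction, and the bordering-column terms of the expansion along
  \<open>f x\<close> cancel against the cross terms of \<open>row_exp_border\<close>.\<close>

lemma minor_merge:
  assumes unit: "f i i = 1" "f j j = 1" "f i j = 0" "f j i = 0"
  shows "minor (\<lambda>x y. f x y + f x i * f j y + f x j * f i y) xs ys = border f i j xs ys"
proof (induction xs arbitrary: ys)
  case Nil
  show ?case
  proof (cases "ys = []")
    case True
    then show ?thesis by (simp add: border_def unit minor.simps(2))
  next
    case False
    then show ?thesis by (simp add: border_def minor_length)
  qed
next
  case (Cons x xs)
  let ?f' = "\<lambda>x y. f x y + f x i * f j y + f x j * f i y"
  show ?case
  proof (cases "length ys = Suc (length xs)")
    case False
    then show ?thesis by (simp add: border_def minor_length)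
  next
    case True
    have *: "row_exp (f x) (\<lambda>zs. minor f us (zs @ [l])) ys =
        minor f (x # us) (ys @ [l]) - (-1) ^ length ys * f x l * minor f us ys" for l us
      by (simp add: row_exp_snoc minor.simps(2))
    have **: "row_exp (f x) (\<lambda>zs. minor f us (zs @ [l, m])) ys =
        minor f (x # us) (ys @ [l, m]) - (-1) ^ length ys * f x l * minor f us (ys @ [m])
        + (-1) ^ length ys * f x m * minor f us (ys @ [l])" for l m us
      using row_exp_snoc[of "f x" "minor f us" "ys @ [l]" m]
        row_exp_snoc[of "f x" "\<lambda>zs. minor f us (zs @ [m])" ys l] by (simp add: minor.simps(2))
    have sw: "minor f (xs @ [j, i]) zs = - minor f (xs @ [i, j]) zs" for zs
      by (rule alternatingD[OF alternating_rows, of f xs _ _ "[]"])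
    have "minor ?f' (x # xs) ys = row_exp (?f' x) (border f i j xs) ys"
      using Cons.IH by (simp add: minor.simps(2) ext[of "minor ?f' xs" "border f i j xs"])
    also have "\<dots> = row_exp (f x) (border f i j xs) ys + f x i * row_exp (f j) (border f i j xs) ys
        + f x j * row_exp (f i) (border f i j xs) ys"
      by (simp add: row_exp_row_add row_exp_row_scale)
    also have "\<dots> = border f i j (x # xs) ys"
      unfolding row_exp_border[OF unit True]
      by (simp add: border_def[abs_def] row_exp_add row_exp_diff * ** sw)
        (simp add: algebra_simps)
    finally show ?thesis .
  qed
qed


section \<open>Forests\<close>

definition linked :: "'a set set \<Rightarrow> 'a \<Rightarrow> 'a \<Rightarrow> bool" where
  "linked A = (\<lambda>x y. {x, y} \<in> A)\<^sup>*\<^sup>*"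

lemma linked_refl [simp]: "linked A x x"
  by (simp add: linked_def)

lemma linked_trans: "linked A x y \<Longrightarrow> linked A y z \<Longrightarrow> linked A x z"
  by (simp add: linked_def)

lemma linked_edge: "{x, y} \<in> A \<Longrightarrow> linked A x y"
  by (auto simp: linked_def)

lemma linked_commute: "linked A x y \<longleftrightarrow> linked A y x"
proof -
  have "symp (\<lambda>x y. {x, y} \<in> A)" by (auto simp: symp_def insert_commute)
  then have "symp (linked A)" unfolding linked_def by (rule symp_rtranclp)
  then show ?thesis by (auto simp: symp_def)
qed

lemma linked_mono: "A \<subseteq> B \<Longrightarrow> linked A x y \<Longrightarrow> linked B x y"
  unfolding linked_def by (erule rtranclp_mono[THEN predicate2D, rotated]) auto

text \<open>A walk can be shortened until it uses the new edge at most once, in one of two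
  directions. These are the three summands of the merged matrix in
  \<open>minor_merge\<close>.\<close>

lemma linked_insert:
  "linked (insert {u, v} A) x y \<longleftrightarrow>
     linked A x y \<or> linked A x u \<and> linked A v y \<or> linked A x v \<and> linked A u y"
    (is "?l \<longleftrightarrow> ?r y")
proof
  assume ?l
  then show "?r y" unfolding linked_def[of "insert {u, v} A"]
  proof (induction rule: rtranclp_induct)
    case (step y z)
    show ?case
    proof (cases "{y, z} = {u, v}")
      case True
      then have "y = u \<and> z = v \<or> y = v \<and> z = u" by (auto simp: doubleton_eq_iff)
      with step.IH show ?thesis by (meson linked_commute linked_refl linked_trans)
    next
      case False
      with step have "linked A y z" by (auto intro: linked_edge)
      with step.IH show ?thesis by (meson linked_trans)
    qed
  qed simp
next
  assume r: "?r y"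
  have "linked (insert {u, v} A) u v" by (simp add: linked_edge)
  with r show ?l
    by (meson linked_commute linked_mono linked_trans subset_insertI)
qed

lemma linked_isolated:
  assumes "\<And>e. e \<in> A \<Longrightarrow> x \<notin> e" and "linked A x y"
  shows "x = y"
  using assms(2) unfolding linked_def
  by (induction rule: rtranclp_induct) (use assms(1) in auto)

lemma acyclic_graph_mono: "acyclic_graph B \<Longrightarrow> A \<subseteq> B \<Longrightarrow> acyclic_graph A"
  unfolding acyclic_graph_def is_cycle_def by blast

lemma linked_path:
  assumes "i \<le> j" "\<And>k. i \<le> k \<Longrightarrow> k < j \<Longrightarrow> {vs ! k, vs ! Suc k} \<in> A"
  shows "linked A (vs ! i) (vs ! j)"
  using assms by (induction j rule: dec_induct) (auto intro: linked_trans linked_edge)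

text \<open>A distinct path from \<open>u\<close> to \<open>v\<close> in \<open>A\<close> closes up
  with the new edge to a cycle. Conversely, a cycle through the new edge becomes such a path once it
  is rotated to start just behind that edge.\<close>

lemma acyclic_graph_insert:
  assumes "u \<noteq> v" "{u, v} \<notin> A"
  shows "acyclic_graph (insert {u, v} A) \<longleftrightarrow> acyclic_graph A \<and> \<not> linked A u v"
proof (intro iffI conjI)
  assume acyc: "acyclic_graph (insert {u, v} A)"
  then show "acyclic_graph A" by (rule acyclic_graph_mono) auto
  show "\<not> linked A u v"
  proof
    assume "linked A u v"
    then obtain ys where "rtrancl_path (\<lambda>x y. {x, y} \<in> A) u ys v"
      by (auto simp: linked_def rtranclp_eq_rtrancl_path)
    then obtain xs where xs: "rtrancl_path (\<lambda>x y. {x, y} \<in> A) u xs v" "distinct (u # xs)"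
      by (rule rtrancl_path_distinct)
    have ne: "xs \<noteq> []" using xs(1) \<open>u \<noteq> v\<close> by (auto elim: rtrancl_path.cases)
    note last = rtrancl_path_last[OF xs(1) ne]
    note nth = rtrancl_path_nth[OF xs(1)]
    \<comment> \<open>A path of one step would be the edge \<open>{u, v}\<close> itself. Excluding
      it gives the three vertices that \<open>is_cycle\<close> demands.\<close>
    have "length xs \<noteq> 1"
    proof
      assume "length xs = 1"
      then have "xs = [v]" using last by (cases xs) auto
      then show False using nth[of 0] assms(2) by simp
    qed
    with ne have len: "length (u # xs) \<ge> 3" by (cases xs; cases "tl xs") auto
    have "{(u # xs) ! i, (u # xs) ! (Suc i mod length (u # xs))} \<in> insert {u, v} A"
      if "i < length (u # xs)" for i
    proof (cases "i = length xs")
      case True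
      then have "(u # xs) ! i = v" using last ne by (simp add: last_conv_nth nth_Cons')
      then show ?thesis using True by (simp add: insert_commute)
    next
      case False
      with that have "i < length xs" by simp
      then show ?thesis using nth by simp
    qed
    with len xs(2) have "is_cycle (insert {u, v} A) (u # xs)" unfolding is_cycle_def by blast
    with acyc show False by (auto simp: acyclic_graph_def)
  qed
next
  assume *: "acyclic_graph A \<and> \<not> linked A u v"
  show "acyclic_graph (insert {u, v} A)"
    unfolding acyclic_graph_def
  proof
    assume "\<exists>vs. is_cycle (insert {u, v} A) vs"
    then obtain vs where vs: "is_cycle (insert {u, v} A) vs" ..
    define l where "l = length vs"
    have l: "l \<ge> 3" and dist: "distinct vs"
      and edge: "\<And>i. i < l \<Longrightarrow> {vs ! i, vs ! (Suc i mod l)} \<in> insert {u, v} A"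
      using vs by (auto simp: is_cycle_def l_def)
    have "\<not> is_cycle A vs" using * by (auto simp: acyclic_graph_def)
    then obtain i where i: "i < l" "{vs ! i, vs ! (Suc i mod l)} = {u, v}"
      using l dist edge unfolding is_cycle_def l_def[symmetric] by blast
    define ws where "ws = rotate (Suc i) vs"
    have ws: "length ws = l" "distinct ws" using dist by (simp_all add: ws_def l_def)
    have nth: "ws ! k = vs ! ((Suc i + k) mod l)" if "k < l" for k
      using that nth_rotate[of k vs "Suc i"] unfolding ws_def l_def by simp
    have "(Suc i + (l - 1)) mod l = i" using i l by simp
    then have ends: "{ws ! (l - 1), ws ! 0} = {u, v}"
      using nth[of "l - 1"] nth[of 0] l i(2) by simp
    have "{ws ! k, ws ! Suc k} \<in> A" if "k < l - 1" for k
    proof -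
      have "{ws ! k, ws ! Suc k} \<in> insert {u, v} A"
        using edge[of "(Suc i + k) mod l"] nth[of k] nth[of "Suc k"] that l
        by (simp add: mod_Suc_eq)
      \<comment> \<open>Distinctness together with \<open>l \<ge> 3\<close> separates the other
        edges of the cycle from the closing one, so they all lie in \<open>A\<close>.\<close>
      moreover have "{ws ! k, ws ! Suc k} \<noteq> {ws ! (l - 1), ws ! 0}"
        using ws that l by (auto simp: doubleton_eq_iff nth_eq_iff_index_eq)
      ultimately show ?thesis using ends by auto
    qed
    then have "linked A (ws ! 0) (ws ! (l - 1))" by (intro linked_path) auto
    then have "linked A u v" using ends linked_commute[of A u v] by (auto simp: doubleton_eq_iff)
    with * show False by blast
  qed
qed

definition forests :: "'a set set \<Rightarrow> 'a set set set" where
  "forests E = {A. A \<subseteq> E \<and> acyclic_graph A}"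

lemma finite_forests: "finite E \<Longrightarrow> finite (forests E)"
  unfolding forests_def by (rule finite_subset[of _ "Pow E"]) auto

lemma forests_empty: "forests {} = {{}}"
  by (auto simp: forests_def acyclic_graph_def is_cycle_def intro!: exI[of _ 0])

text \<open>Forests containing the new edge correspond bijectively to the forests of
  \<open>E\<close> that do not link \<open>u\<close> and \<open>v\<close>. The summand 0 in the
  linked case is the value that \<open>border\<close> takes there.\<close>

lemma sum_forests_insert:
  fixes g :: "'a set set \<Rightarrow> int"
  assumes "finite E" "u \<noteq> v" "{u, v} \<notin> E"
  shows "(\<Sum>A\<in>forests (insert {u, v} E). g A) =
    (\<Sum>A\<in>forests E. g A + (if linked A u v then 0 else g (insert {u, v} A)))"
proof -
  let ?e = "{u, v}" and ?N = "{A \<in> forests E. \<not> linked A u v}"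
  have "forests (insert ?e E) = forests E \<union> insert ?e ` ?N"
  proof (intro equalityI subsetI)
    fix A assume A: "A \<in> forests (insert ?e E)"
    show "A \<in> forests E \<union> insert ?e ` ?N"
    proof (cases "?e \<in> A")
      case True
      then have eq: "A = insert ?e (A - {?e})" by auto
      have "acyclic_graph (A - {?e}) \<and> \<not> linked (A - {?e}) u v"
        using A acyclic_graph_insert[OF assms(2), of "A - {?e}"] eq by (simp add: forests_def)
      then have "A - {?e} \<in> ?N" using A by (auto simp: forests_def)
      then show ?thesis using eq by blast
    next
      case False
      then show ?thesis using A by (auto simp: forests_def)
    qed
  next
    fix A assume "A \<in> forests E \<union> insert ?e ` ?N"
    then show "A \<in> forests (insert ?e E)"
    proof
      assume "A \<in> insert ?e ` ?N"
      then obtain B where B: "A = insert ?e B" "B \<subseteq> E" "acyclic_graph B" "\<not> linked B u v"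
        by (auto simp: forests_def)
      with acyclic_graph_insert[OF assms(2), of B] assms(3) show ?thesis
        by (auto simp: forests_def)
    qed (auto simp: forests_def)
  qed
  moreover have "inj_on (insert ?e) ?N"
    using assms(3) by (auto simp: inj_on_def forests_def dest: insert_ident[THEN iffD1, rotated 2])
  moreover have "forests E \<inter> insert ?e ` ?N = {}"
    using assms(3) by (auto simp: forests_def)
  ultimately have "(\<Sum>A\<in>forests (insert ?e E). g A) =
      (\<Sum>A\<in>forests E. g A) + (\<Sum>A\<in>?N. g (insert ?e A))"
    using finite_forests[OF assms(1)] by (simp add: sum.union_disjoint sum.reindex)
  also have "(\<Sum>A\<in>?N. g (insert ?e A)) =
      (\<Sum>A\<in>forests E. if linked A u v then 0 else g (insert ?e A))"
    using finite_forests[OF assms(1)] by (intro sum.mono_neutral_cong_left) auto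
  finally show ?thesis by (simp add: sum.distrib)
qed


section \<open>The table of a set of edges\<close>

definition bits_below :: "nat \<Rightarrow> nat \<Rightarrow> nat list" where
  "bits_below K I = filter (bit I) [0..<K]"

definition bits_from :: "nat \<Rightarrow> nat \<Rightarrow> nat \<Rightarrow> nat list" where
  "bits_from i K I = filter (bit I) [i..<K]"

text \<open>Bag vertices occupy slots, and a set of slots is the bit mask of a number. \<open>slot_sign K i I\<close> is the
  sign of sorting a slot \<open>i\<close> appended to the list of slots of \<open>I\<close> into its place.\<close>

definition slot_sign :: "nat \<Rightarrow> nat \<Rightarrow> nat \<Rightarrow> int" where
  "slot_sign K i I = (-1) ^ length (bits_from (Suc i) K I)"

text \<open>The coefficient 0 reflects the repeated row when \<open>i\<close> already belongs to the
  mask. It also neutralizes the carry in \<open>I + 2 ^ i\<close>, which is then not the mask of a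
  union.\<close>

definition slot_coeff :: "nat \<Rightarrow> nat \<Rightarrow> nat \<Rightarrow> int" where
  "slot_coeff K i I = (if bit I i then 0 else slot_sign K i I)"

section \<open>Adding a slot to a mask and removing one\<close>

lemma bit_add_exp: "\<not> bit I i \<Longrightarrow> bit (I + 2 ^ i) b \<longleftrightarrow> bit I b \<or> b = i" for I :: nat
  using set_bit_eq[of i I] bit_set_bit_iff[of i I b] by auto

lemma bit_diff_exp:
  fixes I :: nat
  assumes "bit I i"
  shows "bit (I - 2 ^ i) b \<longleftrightarrow> bit I b \<and> b \<noteq> i" and "I - 2 ^ i + 2 ^ i = I"
proof -
  have "unset_bit i I + 2 ^ i = set_bit i (unset_bit i I)"
    by (simp add: set_bit_eq bit_unset_bit_iff)
  also have "\<dots> = I"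
    using assms by (intro bit_eqI) (auto simp: bit_set_bit_iff bit_unset_bit_iff)
  finally have *: "unset_bit i I + 2 ^ i = I" .
  then have "I - 2 ^ i = unset_bit i I" by (metis add_diff_cancel_right')
  then show "bit (I - 2 ^ i) b \<longleftrightarrow> bit I b \<and> b \<noteq> i" "I - 2 ^ i + 2 ^ i = I"
    using * by (auto simp: bit_unset_bit_iff)
qed

lemma less_exp_bit: "(I::nat) < 2 ^ K \<longleftrightarrow> (\<forall>b. bit I b \<longrightarrow> b < K)"
  unfolding take_bit_nat_eq_self_iff[symmetric] bit_eq_iff bit_take_bit_iff by auto

lemma upt_split: "i \<le> k \<Longrightarrow> k < j \<Longrightarrow> [i..<j] = [i..<k] @ k # [Suc k..<j]"
  using upt_add_eq_append[of i k "j - k"] by (simp add: upt_conv_Cons)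

lemma bits_below_split:
  assumes "i < K"
  shows "bits_below K I = bits_below i I @ (if bit I i then [i] else []) @ bits_from (Suc i) K I"
proof -
  have "[0..<K] = [0..<i] @ i # [Suc i..<K]"
    using assms by (simp add: upt_split)
  then show ?thesis by (simp add: bits_below_def bits_from_def)
qed

lemma bits_below_add_exp:
  assumes "i < K" "\<not> bit I i"
  shows "bits_below K (I + 2 ^ i) = bits_below i I @ i # bits_from (Suc i) K I"
proof -
  have "bits_below i (I + 2 ^ i) = bits_below i I"
    and "bits_from (Suc i) K (I + 2 ^ i) = bits_from (Suc i) K I"
    unfolding bits_below_def bits_from_def using assms by (auto intro!: filter_cong simp: bit_add_exp)
  then show ?thesis using assms by (simp add: bits_below_split bit_add_exp)
qed

lemma alternating_bits_snoc:
  assumes "alternating g" "i < K"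
  shows "g (bits_below K I @ i # zs) = slot_coeff K i I * g (bits_below K (I + 2 ^ i) @ zs)"
proof (cases "bit I i")
  case True
  then show ?thesis
    using alternating_dup[OF assms(1), of "bits_below i I" i "bits_from (Suc i) K I" zs] assms(2)
    by (simp add: bits_below_split slot_coeff_def)
next
  case False
  then show ?thesis
    using alternating_move[OF assms(1), of "bits_below i I" "bits_from (Suc i) K I" i zs] assms(2)
    by (simp add: bits_below_split[of i K I] bits_below_add_exp slot_coeff_def slot_sign_def)
qed

text \<open>Adjoining \<open>i\<close> puts one more slot above \<open>j\<close> exactly if
  \<open>j < i\<close>. For the doubly bordered minor this correction occurs once for the rows and
  once for the columns and cancels, so the four coefficients of \<open>I\<close> and
  \<open>J\<close> suffice there.\<close>

lemma slot_coeff_add_exp: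
  assumes "i \<noteq> j" "i < K" "\<not> bit I i"
  shows "slot_coeff K j (I + 2 ^ i) = (if j < i then - 1 else 1) * slot_coeff K j I"
proof -
  have "bit (I + 2 ^ i) j = bit I j" using assms by (simp add: bit_add_exp)
  moreover have "slot_sign K j (I + 2 ^ i) = (if j < i then - 1 else 1) * slot_sign K j I"
  proof (cases "j < i")
    case False
    then have "bits_from (Suc j) K (I + 2 ^ i) = bits_from (Suc j) K I"
      unfolding bits_from_def using assms by (auto intro!: filter_cong simp: bit_add_exp)
    then show ?thesis using False by (simp add: slot_sign_def)
  next
    case True
    have "[Suc j..<K] = [Suc j..<i] @ i # [Suc i..<K]"
      using assms True by (simp add: upt_split)
    moreover have "filter (bit (I + 2 ^ i)) [Suc j..<i] = filter (bit I) [Suc j..<i]"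
      "filter (bit (I + 2 ^ i)) [Suc i..<K] = filter (bit I) [Suc i..<K]"
      using assms by (auto intro!: filter_cong simp: bit_add_exp)
    ultimately show ?thesis using assms True by (simp add: slot_sign_def bits_from_def bit_add_exp)
  qed
  ultimately show ?thesis by (simp add: slot_coeff_def)
qed

definition bit_minor :: "nat \<Rightarrow> (nat \<Rightarrow> nat \<Rightarrow> int) \<Rightarrow> nat \<Rightarrow> nat \<Rightarrow> int" where
  "bit_minor K f I J = minor f (bits_below K I) (bits_below K J)"

text \<open>This is \<open>border\<close> read off a table indexed by masks. \<open>T\<close> is
  arbitrary so that it can be a sum over forests as well as the contents of memory.\<close>

definition edge_term :: "nat \<Rightarrow> nat \<Rightarrow> nat \<Rightarrow> (nat \<Rightarrow> nat \<Rightarrow> int) \<Rightarrow> nat \<Rightarrow> nat \<Rightarrow> int" where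
  "edge_term K i j T I J =
     (let a = slot_coeff K i I; b = slot_coeff K j I; c = slot_coeff K i J; d = slot_coeff K j J in
      a * c * T (I + 2 ^ i) (J + 2 ^ i) + b * d * T (I + 2 ^ j) (J + 2 ^ j)
      - a * d * T (I + 2 ^ i) (J + 2 ^ j) - b * c * T (I + 2 ^ j) (J + 2 ^ i)
      - a * b * c * d * T (I + 2 ^ i + 2 ^ j) (J + 2 ^ i + 2 ^ j))"

lemma bit_minor_snoc:
  assumes "i < K" "j < K"
  shows "minor f (bits_below K I @ [i]) (bits_below K J @ [j]) =
    slot_coeff K i I * slot_coeff K j J * bit_minor K f (I + 2 ^ i) (J + 2 ^ j)"
  using alternating_bits_snoc[OF alternating_rows assms(1), of f I "[]"]
    alternating_bits_snoc[OF alternating_cols assms(2), of f _ J "[]"]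
  by (simp add: bit_minor_def)

lemma bit_minor_snoc2:
  assumes "i < K" "j < K" "i \<noteq> j"
  shows "minor f (bits_below K I @ [i, j]) (bits_below K J @ [i, j]) =
    slot_coeff K i I * slot_coeff K j I * slot_coeff K i J * slot_coeff K j J *
      bit_minor K f (I + 2 ^ i + 2 ^ j) (J + 2 ^ i + 2 ^ j)"
proof (cases "bit I i \<or> bit J i")
  case True
  then have "slot_coeff K i I = 0 \<or> slot_coeff K i J = 0" by (auto simp: slot_coeff_def)
  then show ?thesis
    using alternating_bits_snoc[OF alternating_rows assms(1), of f I "[j]"]
      alternating_bits_snoc[OF alternating_cols assms(1), of f _ J "[j]"] by auto
next
  case False
  have "minor f (bits_below K I @ [i, j]) (bits_below K J @ [i, j]) =
      slot_coeff K i I * slot_coeff K i J *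
      minor f (bits_below K (I + 2 ^ i) @ [j]) (bits_below K (J + 2 ^ i) @ [j])"
    using alternating_bits_snoc[OF alternating_rows assms(1), of f I "[j]"]
      alternating_bits_snoc[OF alternating_cols assms(1), of f _ J "[j]"] by simp
  also have "\<dots> = slot_coeff K i I * slot_coeff K i J * (slot_coeff K j (I + 2 ^ i) *
      slot_coeff K j (J + 2 ^ i)) * bit_minor K f (I + 2 ^ i + 2 ^ j) (J + 2 ^ i + 2 ^ j)"
    by (simp add: bit_minor_snoc assms)
  also have "slot_coeff K j (I + 2 ^ i) * slot_coeff K j (J + 2 ^ i) =
      slot_coeff K j I * slot_coeff K j J"
    using False assms by (simp add: slot_coeff_add_exp)
  finally show ?thesis by simp
qed

lemma border_eq_edge_term:
  assumes "i < K" "j < K" "i \<noteq> j"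
  shows "border f i j (bits_below K I) (bits_below K J) = edge_term K i j (bit_minor K f) I J"
  using assms by (simp add: border_def bit_minor_snoc bit_minor_snoc2 edge_term_def Let_def)

lemma edge_term_sum:
  "edge_term K i j (\<lambda>I J. \<Sum>x\<in>A. T x I J) I J = (\<Sum>x\<in>A. edge_term K i j (T x) I J)"
  by (simp add: edge_term_def Let_def sum.distrib sum_subtractf sum_distrib_left)

lemma slot_coeff_nonzero: "slot_coeff K i I \<noteq> 0 \<longleftrightarrow> \<not> bit I i"
  by (simp add: slot_coeff_def slot_sign_def)

text \<open>A nonzero coefficient means that the added bits were clear, so each entry read belongs
  to strictly larger masks that stay within the old ones and the two slots. The bit condition allows
  the table to be replaced by its specification, the strict inequalities allow a sweep to work in
  place.\<close>

lemma edge_term_cong: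
  assumes "i \<noteq> j"
    and *: "\<And>I' J'. I < I' \<Longrightarrow> (\<forall>b. bit I' b \<longrightarrow> bit I b \<or> b = i \<or> b = j) \<Longrightarrow>
      J < J' \<Longrightarrow> (\<forall>b. bit J' b \<longrightarrow> bit J b \<or> b = i \<or> b = j) \<Longrightarrow> T I' J' = U I' J'"
  shows "edge_term K i j T I J = edge_term K i j U I J"
proof -
  have eq: "x * y * T I' J' = x * y * U I' J'"
    if "I < I'" "x \<noteq> 0 \<Longrightarrow> \<forall>b. bit I' b \<longrightarrow> bit I b \<or> b = i \<or> b = j"
      "J < J'" "y \<noteq> 0 \<Longrightarrow> \<forall>b. bit J' b \<longrightarrow> bit J b \<or> b = i \<or> b = j" for x y I' J'
    using that *[of I' J'] by (cases "x = 0 \<or> y = 0") auto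
  have 2: "slot_coeff K i X * slot_coeff K j X \<noteq> 0 \<Longrightarrow>
      bit (X + 2 ^ i + 2 ^ j) b \<longrightarrow> bit X b \<or> b = i \<or> b = j" for X b
    using assms(1) by (simp add: slot_coeff_nonzero bit_add_exp)
  note 1 = slot_coeff_nonzero bit_add_exp
  let ?a = "slot_coeff K i I" and ?b = "slot_coeff K j I"
  let ?c = "slot_coeff K i J" and ?d = "slot_coeff K j J"
  have "?a * ?c * T (I + 2 ^ i) (J + 2 ^ i) = ?a * ?c * U (I + 2 ^ i) (J + 2 ^ i)"
    "?b * ?d * T (I + 2 ^ j) (J + 2 ^ j) = ?b * ?d * U (I + 2 ^ j) (J + 2 ^ j)"
    "?a * ?d * T (I + 2 ^ i) (J + 2 ^ j) = ?a * ?d * U (I + 2 ^ i) (J + 2 ^ j)"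
    "?b * ?c * T (I + 2 ^ j) (J + 2 ^ i) = ?b * ?c * U (I + 2 ^ j) (J + 2 ^ i)"
    by (intro eq; simp add: 1)+
  moreover have "?a * ?b * (?c * ?d) * T (I + 2 ^ i + 2 ^ j) (J + 2 ^ i + 2 ^ j) =
      ?a * ?b * (?c * ?d) * U (I + 2 ^ i + 2 ^ j) (J + 2 ^ i + 2 ^ j)"
    by (intro eq allI 2) simp_all
  ultimately show ?thesis by (simp only: edge_term_def Let_def mult.assoc)
qed

text \<open>There are five entries, with coefficients in -1, 0, 1. Together with the old entry this
  is the origin of the factor 6 per edge.\<close>

lemma abs_edge_term_le:
  assumes "\<And>I J. \<bar>T I J\<bar> \<le> X"
  shows "\<bar>edge_term K i j T I J\<bar> \<le> 5 * X"
proof -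
  have c: "\<bar>slot_coeff K i I\<bar> \<le> 1" for i I
    by (simp add: slot_coeff_def slot_sign_def power_abs)
  have m: "\<bar>x * y\<bar> \<le> 1" if "\<bar>x\<bar> \<le> 1" "\<bar>y\<bar> \<le> 1" for x y :: int
    using mult_mono[OF that] by (simp add: abs_mult)
  have b: "\<bar>x * T I' J'\<bar> \<le> X" if "\<bar>x\<bar> \<le> 1" for x I' J'
    using mult_mono[OF that assms[of I' J']] by (simp add: abs_mult)
  let ?a = "slot_coeff K i I" and ?b = "slot_coeff K j I"
  let ?c = "slot_coeff K i J" and ?d = "slot_coeff K j J"
  have "\<bar>?a * ?c * T (I + 2 ^ i) (J + 2 ^ i)\<bar> \<le> X" "\<bar>?b * ?d * T (I + 2 ^ j) (J + 2 ^ j)\<bar> \<le> X"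
    "\<bar>?a * ?d * T (I + 2 ^ i) (J + 2 ^ j)\<bar> \<le> X" "\<bar>?b * ?c * T (I + 2 ^ j) (J + 2 ^ i)\<bar> \<le> X"
    "\<bar>?a * ?b * ?c * ?d * T (I + 2 ^ i + 2 ^ j) (J + 2 ^ i + 2 ^ j)\<bar> \<le> X"
    by (intro b m c)+
  then show ?thesis unfolding edge_term_def Let_def by linarith
qed

definition masks :: "nat set \<Rightarrow> nat set" where
  "masks act = {I. \<forall>b. bit I b \<longrightarrow> b \<in> act}"

definition link :: "'a set set \<Rightarrow> (nat \<Rightarrow> 'a) \<Rightarrow> nat \<Rightarrow> nat \<Rightarrow> int" where
  "link A vt a b = of_bool (linked A (vt a) (vt b))"

text \<open>\<open>vt\<close> maps slots to vertices. Only masks of occupied slots are constrained,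
  so releasing a slot leaves the table as it is. \<open>K\<close> may exceed the occupied slots,
  since absent bits contribute no rows or columns.\<close>

definition forest_table ::
  "nat \<Rightarrow> 'a set set \<Rightarrow> nat set \<Rightarrow> (nat \<Rightarrow> 'a) \<Rightarrow> (nat \<Rightarrow> nat \<Rightarrow> int) \<Rightarrow> bool" where
  "forest_table K E act vt T \<longleftrightarrow>
     (\<forall>I\<in>masks act. \<forall>J\<in>masks act. T I J = (\<Sum>A\<in>forests E. bit_minor K (link A vt) I J))"

lemma forest_table_mono: "forest_table K E act vt T \<Longrightarrow> act' \<subseteq> act \<Longrightarrow> forest_table K E act' vt T"
  unfolding forest_table_def masks_def by blast

lemma zero_masks [simp]: "0 \<in> masks act"
  by (simp add: masks_def)

lemma forest_table_empty:
  assumes "T 0 0 = 1"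
  shows "forest_table K {} {} vt T"
proof -
  have "masks {} = {0}" by (auto simp: masks_def bit_eq_iff)
  then show ?thesis using assms
    by (simp add: forest_table_def forests_empty bit_minor_def bits_below_def)
qed

lemma forest_table_count:
  assumes "forest_table K E act vt T"
  shows "T 0 0 = int (num_forests E)"
  using assms by (simp add: forest_table_def bit_minor_def bits_below_def num_forests_def forests_def)

text \<open>In the linked case rows \<open>i\<close> and \<open>j\<close> of the link matrix agree.
  Otherwise the three alternatives of \<open>linked_insert\<close> exclude each other, so the 0/1
  entries simply add up.\<close>

lemma border_link:
  "border (link A vt) i j xs ys =
     (if linked A (vt i) (vt j) then 0 else minor (link (insert {vt i, vt j} A) vt) xs ys)"
proof (cases "linked A (vt i) (vt j)")
  case True
  then have "link A vt i = link A vt j"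
    unfolding link_def by (intro ext arg_cong[of _ _ of_bool]) (meson linked_commute linked_trans)
  then show ?thesis using True by (simp add: border_eq_0)
next
  case False
  let ?f = "link A vt"
  have "link (insert {vt i, vt j} A) vt =
      (\<lambda>x y. ?f x y + ?f x i * ?f j y + ?f x j * ?f i y)"
  proof (intro ext)
    fix x y
    have "\<not> (linked A (vt x) (vt i) \<and> linked A (vt x) (vt j))"
      "\<not> (linked A (vt i) (vt y) \<and> linked A (vt j) (vt y))"
      using False by (meson linked_commute linked_trans)+
    moreover have "\<not> (linked A (vt x) (vt y) \<and> linked A (vt x) (vt i) \<and> linked A (vt j) (vt y))"
      "\<not> (linked A (vt x) (vt y) \<and> linked A (vt x) (vt j) \<and> linked A (vt i) (vt y))"
      using False by (meson linked_commute linked_trans)+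
    ultimately show "link (insert {vt i, vt j} A) vt x y =
        ?f x y + ?f x i * ?f j y + ?f x j * ?f i y"
      unfolding link_def linked_insert by auto
  qed
  moreover have "?f i i = 1" "?f j j = 1" "?f i j = 0" "?f j i = 0"
    using False linked_commute[of A "vt i" "vt j"] by (simp_all add: link_def)
  ultimately show ?thesis using False minor_merge[of ?f i j] by simp
qed

lemma forest_table_insert_edge:
  assumes tab: "forest_table K E act vt T" and "finite E"
    and act: "act \<subseteq> {..<K}" and ij: "i \<in> act" "j \<in> act" "vt i \<noteq> vt j" and new: "{vt i, vt j} \<notin> E"
    and T': "\<And>I J. I \<in> masks act \<Longrightarrow> J \<in> masks act \<Longrightarrow> T' I J = T I J + edge_term K i j T I J"
  shows "forest_table K (insert {vt i, vt j} E) act vt T'"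
  unfolding forest_table_def
proof (intro ballI)
  fix I J assume IJ: "I \<in> masks act" "J \<in> masks act"
  let ?U = "\<lambda>I J. \<Sum>A\<in>forests E. bit_minor K (link A vt) I J"
  have K: "i < K" "j < K" "i \<noteq> j" using ij act by auto
  have "edge_term K i j T I J = edge_term K i j ?U I J"
  proof (rule edge_term_cong)
    fix I' J' :: nat
    assume "\<forall>b. bit I' b \<longrightarrow> bit I b \<or> b = i \<or> b = j"
      "\<forall>b. bit J' b \<longrightarrow> bit J b \<or> b = i \<or> b = j"
    then have "I' \<in> masks act" "J' \<in> masks act" using IJ ij by (auto simp: masks_def)
    then show "T I' J' = ?U I' J'" using tab by (simp add: forest_table_def)
  qed (use K in auto)
  also have "\<dots> = (\<Sum>A\<in>forests E. border (link A vt) i j (bits_below K I) (bits_below K J))"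
    by (simp add: edge_term_sum border_eq_edge_term K)
  finally show "T' I J = (\<Sum>A\<in>forests (insert {vt i, vt j} E). bit_minor K (link A vt) I J)"
    using tab IJ unfolding sum_forests_insert[OF assms(2) ij(3) new] forest_table_def border_link bit_minor_def
    by (simp add: T' sum.distrib)
qed

lemma slot_sign_diff_exp: "bit I i \<Longrightarrow> slot_sign K i (I - 2 ^ i) = slot_sign K i I"
  unfolding slot_sign_def bits_from_def
  by (intro arg_cong[of _ _ "\<lambda>xs. (-1) ^ length xs"] filter_cong) (auto simp: bit_diff_exp)

lemma slot_sign_square [simp]: "slot_sign K i I * slot_sign K i I = 1"
  by (simp add: slot_sign_def flip: power_add)

lemma bit_minor_isolated:
  assumes "i < K" "f i i = 1" and bits: "bit I i" "bit J i"
    and "\<And>y. bit J y \<Longrightarrow> y \<noteq> i \<Longrightarrow> f i y = 0"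
  shows "bit_minor K f I J =
    slot_sign K i I * slot_sign K i J * bit_minor K f (I - 2 ^ i) (J - 2 ^ i)"
proof -
  let ?I = "I - 2 ^ i" and ?J = "J - 2 ^ i"
  have "bit_minor K f ?I ?J = minor f (bits_below K ?I @ [i]) (bits_below K ?J @ [i])"
    unfolding bit_minor_def
    by (rule minor_isolated[symmetric]) (use assms in \<open>auto simp: bits_below_def bit_diff_exp\<close>)
  also have "\<dots> = slot_sign K i I * slot_sign K i J * bit_minor K f I J"
    using assms by (simp add: bit_minor_snoc bit_diff_exp slot_coeff_def slot_sign_diff_exp)
  \<comment> \<open>The signs are involutions, so they can be carried to the other side.\<close>
  finally have "slot_sign K i I * slot_sign K i J * bit_minor K f ?I ?J =
      (slot_sign K i I * slot_sign K i I) * (slot_sign K i J * slot_sign K i J) * bit_minor K f I J"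
    by (simp add: mult_ac)
  then show ?thesis by simp
qed

text \<open>No edge of \<open>E\<close> meets \<open>v\<close>, so for every forest row and column
  \<open>i\<close> of the link matrix are unit vectors on the occupied slots. A minor containing
  only one of them vanishes; a minor containing both loses them at the price of two sorting
  signs.\<close>

lemma forest_table_insert_vertex:
  assumes tab: "forest_table K E act vt T"
    and act: "act \<subseteq> {..<K}" and i: "i < K" "i \<notin> act"
    and v: "v \<notin> vt ` act" "\<And>e. e \<in> E \<Longrightarrow> v \<notin> e"
    and T': "\<And>I J. I \<in> masks (insert i act) \<Longrightarrow> J \<in> masks (insert i act) \<Longrightarrow> T' I J =
      (if bit I i = bit J i then
         if bit I i then slot_sign K i I * slot_sign K i J * T (I - 2 ^ i) (J - 2 ^ i) else T I J
       else 0)"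
  shows "forest_table K E (insert i act) (vt(i := v)) T'"
  unfolding forest_table_def
proof (intro ballI)
  fix I J assume IJ: "I \<in> masks (insert i act)" "J \<in> masks (insert i act)"
  let ?vt = "vt(i := v)"
  have unlinked: "\<not> linked A v (vt y)" "\<not> linked A (vt y) v" if "A \<in> forests E" "y \<in> act" for A y
  proof -
    have "\<And>e. e \<in> A \<Longrightarrow> v \<notin> e" using that v(2) by (auto simp: forests_def)
    moreover have "v \<noteq> vt y" using v(1) that by auto
    ultimately show "\<not> linked A v (vt y)" using linked_isolated by metis
    then show "\<not> linked A (vt y) v" by (simp add: linked_commute)
  qed
  have cong: "bit_minor K (link A ?vt) I' J' = bit_minor K (link A vt) I' J'"
    if "\<not> bit I' i" "\<not> bit J' i" for A I' J'
    unfolding bit_minor_def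
    by (rule minor_cong) (use that in \<open>auto simp: bits_below_def link_def\<close>)
  show "T' I J = (\<Sum>A\<in>forests E. bit_minor K (link A ?vt) I J)"
  proof (cases "bit I i = bit J i")
    case False
    have "bit_minor K (link A ?vt) I J = 0" if A: "A \<in> forests E" for A
    proof (cases "bit I i")
      case True
      then show ?thesis unfolding bit_minor_def using False i IJ unlinked[OF A]
        by (intro minor_zero_row[of i]) (auto simp: bits_below_def masks_def link_def)
    next
      case nbit: False
      then show ?thesis unfolding bit_minor_def using False i IJ unlinked[OF A]
        by (intro minor_zero_col[of i]) (auto simp: bits_below_def masks_def link_def)
    qed
    then show ?thesis using False IJ by (simp add: T')
  next
    case same: True
    show ?thesis
    proof (cases "bit I i")
      case False
      then have "I \<in> masks act" "J \<in> masks act" using same IJ by (auto simp: masks_def)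
      then show ?thesis using same False IJ tab by (simp add: T' cong forest_table_def)
    next
      case True
      then have bits: "bit I i" "bit J i" using same by auto
      then have m: "I - 2 ^ i \<in> masks act" "J - 2 ^ i \<in> masks act"
        using IJ by (auto simp: masks_def bit_diff_exp)
      have "bit_minor K (link A ?vt) I J = slot_sign K i I * slot_sign K i J *
          bit_minor K (link A vt) (I - 2 ^ i) (J - 2 ^ i)" if "A \<in> forests E" for A
        using bits IJ unlinked[OF that] i
        by (subst bit_minor_isolated) (auto simp: link_def masks_def cong bit_diff_exp)
      then show ?thesis using bits IJ tab m by (simp add: T' forest_table_def sum_distrib_left)
    qed
  qed
qed


section \<open>Verification of programs with time bounds\<close>

lemma int_len_pos: "int_len x \<ge> 1"
  by (simp add: int_len_def)

lemma int_len_le_iff: "W \<ge> 1 \<Longrightarrow> int_len x \<le> W \<longleftrightarrow> \<bar>x\<bar> < 2 ^ W"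
proof -
  assume W: "W \<ge> 1"
  have "floorlog 2 (nat \<bar>x\<bar>) \<le> W \<longleftrightarrow> nat \<bar>x\<bar> < 2 ^ W"
    by (simp add: floorlog_le_iff)
  also have "\<dots> \<longleftrightarrow> \<bar>x\<bar> < 2 ^ W" by (simp add: nat_less_iff)
  finally show ?thesis using W by (simp add: int_len_def)
qed

lemma less_exp_int_len: "\<bar>x\<bar> < 2 ^ int_len x"
  using int_len_le_iff[of "int_len x" x] int_len_pos[of x] by simp

lemma int_len_0: "int_len 0 = 1" and int_len_1: "int_len 1 = 1" and int_len_2: "int_len 2 = 2"
  using int_len_le_iff[of 1 0] int_len_le_iff[of 1 1] int_len_le_iff[of 1 2] int_len_le_iff[of 2 2]
    int_len_pos[of 0] int_len_pos[of 1] int_len_pos[of 2] by simp_all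

lemma abs_div_le: "\<bar>x div y\<bar> \<le> \<bar>x\<bar>" for x y :: int
proof -
  have pos: "\<bar>x div y\<bar> \<le> \<bar>x\<bar>" if "y > 0" for x y :: int
  proof -
    define q where "q = x div y"
    have "q * y + x mod y = x" "0 \<le> x mod y" "x mod y < y" using that by (simp_all add: q_def)
    then have q: "q * y \<le> x" "x < (q + 1) * y" by (simp_all add: algebra_simps)
    have "q \<le> \<bar>x\<bar>"
    proof (rule ccontr)
      assume "\<not> q \<le> \<bar>x\<bar>"
      then have "q * 1 \<le> q * y" using that by (intro mult_left_mono) auto
      then show False using q \<open>\<not> q \<le> \<bar>x\<bar>\<close> by simp
    qed
    moreover have "- \<bar>x\<bar> \<le> q"
    proof (rule ccontr)
      assume *: "\<not> - \<bar>x\<bar> \<le> q"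
      then have "(q + 1) * y \<le> (q + 1) * 1" using that by (intro mult_left_mono_neg) auto
      then show False using q * by simp
    qed
    ultimately show ?thesis by (simp add: q_def)
  qed
  show ?thesis
  proof (cases "y < 0")
    case True
    then show ?thesis using pos[of "- y" "- x"] by simp
  next
    case False
    then show ?thesis using pos[of y x] by (cases "y = 0") auto
  qed
qed

text \<open>Products dictate the sum of the lengths; using it for all operations keeps
  \<open>len_factor\<close> independent of the operator. Sums fit because both powers are at least 2
  (even 0 has length 1), quotients because they do not exceed the dividend in modulus.\<close>

lemma int_len_apply_op: "int_len (apply_op f x y) \<le> int_len x + int_len y"
proof -
  let ?m = "int_len x" and ?n = "int_len y"
  have x: "\<bar>x\<bar> < 2 ^ ?m" "\<bar>y\<bar> < 2 ^ ?n" by (rule less_exp_int_len)+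
  have "(2::int) ^ ?m * 2 ^ ?n \<ge> 2 ^ ?m + 2 ^ ?n"
  proof -
    have "(2::int) ^ ?m \<ge> 2" "(2::int) ^ ?n \<ge> 2"
      using int_len_pos[of x] int_len_pos[of y] by (simp_all add: self_le_power)
    then have "((2::int) ^ ?m - 1) * (2 ^ ?n - 1) \<ge> 1" by (simp add: mult_pos_pos int_one_le_iff_zero_less)
    then show ?thesis by (simp add: algebra_simps)
  qed
  then have sum: "\<bar>x\<bar> + \<bar>y\<bar> < 2 ^ (?m + ?n)" using x by (simp add: power_add)
  have "\<bar>apply_op f x y\<bar> < 2 ^ (?m + ?n)"
  proof (cases f)
    case Mult
    then show ?thesis using x by (simp add: power_add abs_mult mult_strict_mono)
  next
    case Div
    have "\<bar>x div y\<bar> \<le> \<bar>x\<bar>" by (rule abs_div_le)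
    then show ?thesis using Div sum by simp
  qed (use sum in auto)
  then show ?thesis by (subst int_len_le_iff) (use int_len_pos[of x] in auto)
qed

section \<open>Expressions compiled onto a stack of registers\<close>

datatype aexp = Const int | Var nat | Op arith_op aexp aexp | Mem aexp

fun aval :: "aexp \<Rightarrow> (nat \<Rightarrow> int) \<Rightarrow> (nat \<Rightarrow> int) \<Rightarrow> int" where
  "aval (Const c) s M = c"
| "aval (Var x) s M = s x"
| "aval (Op f a b) s M = apply_op f (aval a s M) (aval b s M)"
| "aval (Mem a) s M = M (nat (aval a s M))"

fun safe :: "aexp \<Rightarrow> (nat \<Rightarrow> int) \<Rightarrow> (nat \<Rightarrow> int) \<Rightarrow> bool" where
  "safe (Const c) s M \<longleftrightarrow> True"
| "safe (Var x) s M \<longleftrightarrow> x < 50"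
| "safe (Op f a b) s M \<longleftrightarrow> safe a s M \<and> safe b s M"
| "safe (Mem a) s M \<longleftrightarrow> safe a s M \<and> aval a s M \<ge> 0"

text \<open>Register \<open>k\<close> is the top of an evaluation stack that grows upwards. In the
  absence of a move instruction a variable is fetched by adding it to 0.\<close>

fun compile :: "aexp \<Rightarrow> nat \<Rightarrow> program" where
  "compile (Const c) k = SetConst k c"
| "compile (Var x) k = Seq (SetConst k 0) (Arith Add k k x)"
| "compile (Op f a b) k = Seq (compile a k) (Seq (compile b (Suc k)) (Arith f k k (Suc k)))"
| "compile (Mem a) k = Seq (compile a k) (Load k k)"

text \<open>Lengths are counted in multiples of the bound \<open>W\<close> on registers and memory
  cells. A loaded value has length at most \<open>W\<close> however long its address is, hence the 1
  for \<open>Mem\<close>.\<close>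

fun len_factor :: "aexp \<Rightarrow> nat" where
  "len_factor (Const c) = int_len c"
| "len_factor (Var x) = 1"
| "len_factor (Op f a b) = len_factor a + len_factor b"
| "len_factor (Mem a) = 1"

fun cost_factor :: "aexp \<Rightarrow> nat" where
  "cost_factor (Const c) = 1 + int_len c"
| "cost_factor (Var x) = 5"
| "cost_factor (Op f a b) =
     cost_factor a + cost_factor b + 1 + len_factor a + len_factor b"
| "cost_factor (Mem a) = cost_factor a + 2 + len_factor a"

definition bounded :: "nat \<Rightarrow> (nat \<Rightarrow> int) \<Rightarrow> (nat \<Rightarrow> int) \<Rightarrow> bool" where
  "bounded W s M \<longleftrightarrow> W \<ge> 1 \<and> (\<forall>x<50. \<bar>s x\<bar> < 2 ^ W) \<and> (\<forall>a. \<bar>M a\<bar> < 2 ^ W)"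

lemma bounded_int_len:
  assumes "bounded W s M"
  shows "x < 50 \<Longrightarrow> int_len (s x) \<le> W" "int_len (M a) \<le> W"
  using assms by (simp_all add: bounded_def int_len_le_iff)

lemma len_factor:
  assumes "bounded W s M" "safe e s M"
  shows "int_len (aval e s M) \<le> len_factor e * W"
  using assms(2)
proof (induction e)
  case (Const c)
  have "W \<ge> 1" using assms(1) by (simp add: bounded_def)
  then show ?case by simp
next
  case (Op f a b)
  then show ?case using int_len_apply_op[of f "aval a s M" "aval b s M"]
    by (simp add: algebra_simps)
qed (use bounded_int_len[OF assms(1)] in auto)

text \<open>Preservation of all registers below \<open>k\<close> is what keeps the first operand of
  \<open>Op\<close> intact while the second is evaluated at \<open>Suc k\<close>.\<close>

lemma exec_compile:
  assumes "bounded W s M" "safe e s M" "k \<ge> 50" "\<forall>x<50. R x = s x"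
  shows "\<exists>t R'. exec (compile e k) (R, M) t (R', M) \<and> t \<le> cost_factor e * W \<and>
    R' k = aval e s M \<and> (\<forall>x<k. R' x = R x)"
  using assms(2-)
proof (induction e arbitrary: k R)
  case (Const c)
  have "W \<ge> 1" using assms(1) by (simp add: bounded_def)
  then have "(1 + int_len c) * 1 \<le> (1 + int_len c) * W" by (intro mult_le_mono2)
  moreover have "exec (compile (Const c) k) (R, M) (1 + int_len c) (R(k := c), M)"
    by (simp only: compile.simps exec.SetConst)
  moreover have "(R(k := c)) k = aval (Const c) s M" "\<forall>x<k. (R(k := c)) x = R x" by auto
  ultimately show ?case unfolding cost_factor.simps mult_1_right by blast
next
  case (Var x)
  have W: "W \<ge> 1" using assms(1) by (simp add: bounded_def)
  let ?R = "R(k := 0)"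
  have x: "x \<noteq> k" "x < 50" using Var by auto
  have "exec (compile (Var x) k) (R, M) ((1 + int_len 0) + (1 + int_len (?R k) + int_len (?R x)))
      (?R(k := apply_op Add (?R k) (?R x)), M)"
    unfolding compile.simps by (rule exec.intros)+
  moreover have "(1 + int_len 0) + (1 + int_len (?R k) + int_len (?R x)) \<le> cost_factor (Var x) * W"
    using bounded_int_len(1)[OF assms(1) x(2)] x Var W by (simp add: int_len_0)
  moreover have "(?R(k := apply_op Add (?R k) (?R x))) k = aval (Var x) s M"
    "\<forall>y<k. (?R(k := apply_op Add (?R k) (?R x))) y = R y" using x Var by auto
  ultimately show ?case by blast
next
  case (Op f a b)
  from Op.IH(1)[of k R] Op.prems obtain t1 R1 where 1: "exec (compile a k) (R, M) t1 (R1, M)"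
    "t1 \<le> cost_factor a * W" "R1 k = aval a s M" "\<forall>x<k. R1 x = R x" by auto
  have "\<forall>x<50. R1 x = s x" using 1(4) Op.prems by auto
  with Op.IH(2)[of "Suc k" R1] Op.prems obtain t2 R2 where
    2: "exec (compile b (Suc k)) (R1, M) t2 (R2, M)"
    "t2 \<le> cost_factor b * W" "R2 (Suc k) = aval b s M" "\<forall>x<Suc k. R2 x = R1 x" by auto
  let ?R = "R2(k := apply_op f (R2 k) (R2 (Suc k)))"
  have "exec (compile (Op f a b) k) (R, M)
      (t1 + (t2 + (1 + int_len (R2 k) + int_len (R2 (Suc k))))) (?R, M)"
    unfolding compile.simps by (rule exec.intros 1 2)+
  moreover have "t1 + (t2 + (1 + int_len (R2 k) + int_len (R2 (Suc k))))
      \<le> cost_factor (Op f a b) * W"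
  proof -
    have "W \<ge> 1" using assms(1) by (simp add: bounded_def)
    then show ?thesis
      using 1(2,3) 2(2,3,4) len_factor[OF assms(1), of a] len_factor[OF assms(1), of b] Op.prems(1)
      by (simp add: algebra_simps)
  qed
  moreover have "?R k = aval (Op f a b) s M" "\<forall>x<k. ?R x = R x" using 1 2 by auto
  ultimately show ?case by blast
next
  case (Mem a)
  from Mem.IH[of k R] Mem.prems obtain t1 R1 where 1: "exec (compile a k) (R, M) t1 (R1, M)"
    "t1 \<le> cost_factor a * W" "R1 k = aval a s M" "\<forall>x<k. R1 x = R x" by auto
  let ?R = "R1(k := M (nat (R1 k)))"
  have "exec (compile (Mem a) k) (R, M)
      (t1 + (1 + int_len (R1 k) + int_len (M (nat (R1 k))))) (?R, M)"
    unfolding compile.simps by (rule exec.intros 1)+ (use 1 Mem.prems in auto)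
  moreover have "t1 + (1 + int_len (R1 k) + int_len (M (nat (R1 k)))) \<le> cost_factor (Mem a) * W"
  proof -
    have "W \<ge> 1" using assms(1) by (simp add: bounded_def)
    then show ?thesis
      using 1(2,3) len_factor[OF assms(1), of a] Mem.prems(1)
        bounded_int_len(2)[OF assms(1), of "nat (R1 k)"]
      by (simp add: algebra_simps)
  qed
  moreover have "?R k = aval (Mem a) s M" "\<forall>x<k. ?R x = R x" using 1 by auto
  ultimately show ?case by blast
qed

text \<open>Registers from 50 on are scratch space of compiled expressions and invisible to assertions. As
  long as \<open>W\<close> bounds the bit length of all other registers and of all memory cells, each statement costs
  at most one unit of \<open>10000 * W\<close>; \<open>N\<close> counts such units.\<close>

definition wp :: "nat \<Rightarrow> program \<Rightarrow> nat \<Rightarrow> ((nat \<Rightarrow> int) \<Rightarrow> (nat \<Rightarrow> int) \<Rightarrow> bool) \<Rightarrow>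
    (nat \<Rightarrow> int) \<Rightarrow> (nat \<Rightarrow> int) \<Rightarrow> bool" where
  "wp W p N Q s M \<longleftrightarrow> (\<forall>R. (\<forall>x<50. R x = s x) \<longrightarrow>
     (\<exists>t R' s' M'. exec p (R, M) t (R', M') \<and> t \<le> N * (10000 * W) \<and>
       (\<forall>x<50. R' x = s' x) \<and> Q s' M'))"

lemma wp_mono:
  assumes "wp W p N Q s M" "N \<le> N'" "\<And>s' M'. Q s' M' \<Longrightarrow> Q' s' M'"
  shows "wp W p N' Q' s M"
  unfolding wp_def
proof (intro allI impI)
  fix R assume "\<forall>x<50. R x = s x"
  with assms(1) obtain t R' s' M' where *: "exec p (R, M) t (R', M')" "t \<le> N * (10000 * W)"
    "\<forall>x<50. R' x = s' x" "Q s' M'" unfolding wp_def by blast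
  have "t \<le> N' * (10000 * W)" using *(2) assms(2) by (meson le_trans mult_le_mono1)
  with * assms(3) show "\<exists>t R' s' M'. exec p (R, M) t (R', M') \<and> t \<le> N' * (10000 * W) \<and>
       (\<forall>x<50. R' x = s' x) \<and> Q' s' M'" by blast
qed

lemma wp_Seq:
  assumes "wp W p N1 (\<lambda>s' M'. wp W q N2 Q s' M') s M" "N1 + N2 \<le> N"
  shows "wp W (Seq p q) N Q s M"
  unfolding wp_def
proof (intro allI impI)
  fix R assume "\<forall>x<50. R x = s x"
  with assms(1) obtain t1 R1 s1 M1 where 1: "exec p (R, M) t1 (R1, M1)" "t1 \<le> N1 * (10000 * W)"
    "\<forall>x<50. R1 x = s1 x" "wp W q N2 Q s1 M1" unfolding wp_def[of W p] by blast
  from 1(3,4) obtain t2 R2 s2 M2 where 2: "exec q (R1, M1) t2 (R2, M2)" "t2 \<le> N2 * (10000 * W)"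
    "\<forall>x<50. R2 x = s2 x" "Q s2 M2" unfolding wp_def by blast
  have "t1 + t2 \<le> (N1 + N2) * (10000 * W)" using 1(2) 2(2) by (simp add: add_mult_distrib)
  also have "\<dots> \<le> N * (10000 * W)" using assms(2) by simp
  finally show "\<exists>t R' s' M'. exec (Seq p q) (R, M) t (R', M') \<and> t \<le> N * (10000 * W) \<and>
       (\<forall>x<50. R' x = s' x) \<and> Q s' M'" using 1 2 exec.Seq by blast
qed

definition Assign :: "nat \<Rightarrow> aexp \<Rightarrow> program" where
  "Assign x e = Seq (compile e 50) (Seq (SetConst x 0) (Arith Add x x 50))"

definition Write :: "aexp \<Rightarrow> aexp \<Rightarrow> program" where
  "Write a b = Seq (compile a 50) (Seq (compile b 51) (Store 50 51))"

definition Cond :: "aexp \<Rightarrow> program \<Rightarrow> program \<Rightarrow> program" where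
  "Cond e p q = Seq (compile e 50) (IfPos 50 p q)"

text \<open>Register 50 holds the number of rounds left. It is recomputed after every round because
  \<open>p\<close> may use it as scratch space.\<close>

definition For :: "nat \<Rightarrow> nat \<Rightarrow> program \<Rightarrow> program" where
  "For x y p = Seq (Assign x (Const 0)) (Seq (compile (Op Sub (Var y) (Var x)) 50)
     (WhilePos 50 (Seq p (Seq (Assign x (Op Add (Var x) (Const 1)))
       (compile (Op Sub (Var y) (Var x)) 50)))))"

text \<open>The expression may use up 9000 of the 10000 multiples of \<open>W\<close> in a unit; the
  remainder pays for the instructions around it.\<close>

lemma wp_Assign:
  assumes "bounded W s M" "safe e s M" "x < 50" "cost_factor e + len_factor e \<le> 9000"
    and "Q (s(x := aval e s M)) M"
  shows "wp W (Assign x e) 1 Q s M"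
  unfolding wp_def
proof (intro allI impI)
  fix R assume R: "\<forall>x<50. R x = s x"
  from exec_compile[OF assms(1,2) _ R, of 50] obtain t R1 where
    1: "exec (compile e 50) (R, M) t (R1, M)" "t \<le> cost_factor e * W"
    "R1 50 = aval e s M" "\<forall>x<50. R1 x = R x" by auto
  let ?R = "R1(x := 0)"
  have W: "W \<ge> 1" using assms(1) by (simp add: bounded_def)
  have "exec (Assign x e) (R, M) (t + ((1 + int_len 0) + (1 + int_len (?R x) + int_len (?R 50))))
    (?R(x := apply_op Add (?R x) (?R 50)), M)"
    unfolding Assign_def by (rule exec.intros 1)+
  moreover have "t + ((1 + int_len 0) + (1 + int_len (?R x) + int_len (?R 50))) \<le> 1 * (10000 * W)"
  proof -
    have "(cost_factor e + len_factor e) * W \<le> 9000 * W" using assms(4) by (rule mult_le_mono1)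
    then show ?thesis
      using 1(2,3) len_factor[OF assms(1,2)] W assms(3) by (simp add: int_len_0 algebra_simps)
  qed
  moreover have "\<forall>y<50. (?R(x := apply_op Add (?R x) (?R 50))) y = (s(x := aval e s M)) y"
    using 1 R assms(3) by simp
  ultimately show "\<exists>t R' s' M'. exec (Assign x e) (R, M) t (R', M') \<and> t \<le> 1 * (10000 * W) \<and>
       (\<forall>x<50. R' x = s' x) \<and> Q s' M'" using assms(5) by blast
qed

lemma wp_Write:
  assumes "bounded W s M" "safe a s M" "safe b s M" "aval a s M \<ge> 0"
    "cost_factor a + cost_factor b + len_factor a + len_factor b \<le> 9000"
    and "Q s (M(nat (aval a s M) := aval b s M))"
  shows "wp W (Write a b) 1 Q s M"
  unfolding wp_def
proof (intro allI impI)
  fix R assume R: "\<forall>x<50. R x = s x"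
  from exec_compile[OF assms(1,2) _ R, of 50] obtain t R1 where
    1: "exec (compile a 50) (R, M) t (R1, M)" "t \<le> cost_factor a * W"
    "R1 50 = aval a s M" "\<forall>x<50. R1 x = R x" by auto
  have R1: "\<forall>x<50. R1 x = s x" using 1(4) R by auto
  from exec_compile[OF assms(1,3) _ R1, of 51] obtain u R2 where
    2: "exec (compile b 51) (R1, M) u (R2, M)" "u \<le> cost_factor b * W"
    "R2 51 = aval b s M" "\<forall>x<51. R2 x = R1 x" by auto
  have W: "W \<ge> 1" using assms(1) by (simp add: bounded_def)
  have "exec (Write a b) (R, M) (t + (u + (1 + int_len (R2 50) + int_len (R2 51))))
    (R2, M(nat (R2 50) := R2 51))"
    unfolding Write_def by (rule exec.intros 1 2)+ (use 1 2 assms(4) in auto)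
  moreover have "t + (u + (1 + int_len (R2 50) + int_len (R2 51))) \<le> 1 * (10000 * W)"
  proof -
    have "(cost_factor a + cost_factor b + len_factor a + len_factor b) * W \<le> 9000 * W"
      using assms(5) by (rule mult_le_mono1)
    then show ?thesis
      using 1(2,3) 2(2-4) len_factor[OF assms(1,2)] len_factor[OF assms(1,3)] W
      by (simp add: algebra_simps)
  qed
  moreover have eq: "R2 50 = aval a s M" "\<forall>x<50. R2 x = s x" using 1 2 R1 by auto
  moreover have "Q s (M(nat (R2 50) := R2 51))" using assms(6) 2(3) eq(1) by simp
  ultimately show "\<exists>t R' s' M'. exec (Write a b) (R, M) t (R', M') \<and> t \<le> 1 * (10000 * W) \<and>
       (\<forall>x<50. R' x = s' x) \<and> Q s' M'" by blast
qed

lemma wp_Cond: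
  assumes "bounded W s M" "safe e s M" "cost_factor e + len_factor e \<le> 9000"
    and "aval e s M > 0 \<Longrightarrow> wp W p N Q s M"
    and "aval e s M \<le> 0 \<Longrightarrow> wp W q N Q s M"
  shows "wp W (Cond e p q) (Suc N) Q s M"
  unfolding wp_def
proof (intro allI impI)
  fix R assume R: "\<forall>x<50. R x = s x"
  from exec_compile[OF assms(1,2) _ R, of 50] obtain t R1 where
    1: "exec (compile e 50) (R, M) t (R1, M)" "t \<le> cost_factor e * W"
    "R1 50 = aval e s M" "\<forall>x<50. R1 x = R x" by auto
  have R1: "\<forall>x<50. R1 x = s x" using 1(4) R by auto
  have W: "W \<ge> 1" using assms(1) by (simp add: bounded_def)
  have le: "t + (1 + int_len (R1 50)) \<le> 10000 * W"
  proof -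
    have "(cost_factor e + len_factor e) * W \<le> 9000 * W" using assms(3) by (rule mult_le_mono1)
    then show ?thesis using 1(2,3) len_factor[OF assms(1,2)] W by (simp add: algebra_simps)
  qed
  let ?r = "if aval e s M > 0 then p else q"
  have "wp W ?r N Q s M" using assms(4,5) by simp
  with R1 obtain u R2 s2 M2 where 2: "exec ?r (R1, M) u (R2, M2)" "u \<le> N * (10000 * W)"
    "\<forall>x<50. R2 x = s2 x" "Q s2 M2" unfolding wp_def by blast
  have "exec (IfPos 50 p q) (R1, M) (1 + int_len (R1 50) + u) (R2, M2)"
  proof (cases "aval e s M > 0")
    case True
    then show ?thesis using 1(3) 2(1) by (intro exec.IfTrue) simp_all
  next
    case False
    then show ?thesis using 1(3) 2(1) by (intro exec.IfFalse) simp_all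
  qed
  then have "exec (Cond e p q) (R, M) (t + (1 + int_len (R1 50) + u)) (R2, M2)"
    unfolding Cond_def by (intro exec.Seq[OF 1(1)])
  moreover have "t + (1 + int_len (R1 50) + u) \<le> Suc N * (10000 * W)" using le 2(2) by simp
  ultimately show "\<exists>t R' s' M'. exec (Cond e p q) (R, M) t (R', M') \<and> t \<le> Suc N * (10000 * W) \<and>
       (\<forall>x<50. R' x = s' x) \<and> Q s' M'" using 2 by blast
qed

lemma wp_Skip:
  assumes "W \<ge> 1" "Q s M"
  shows "wp W Skip 1 Q s M"
  unfolding wp_def
proof (intro allI impI)
  fix R assume "\<forall>x<50. R x = s x"
  moreover have "1 \<le> 1 * (10000 * W)" using assms(1) by simp
  ultimately show "\<exists>t R' s' M'. exec Skip (R, M) t (R', M') \<and> t \<le> 1 * (10000 * W) \<and>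
       (\<forall>x<50. R' x = s' x) \<and> Q s' M'" using assms(2) exec.Skip by (intro exI conjI)
qed

text \<open>The 3 units per round are the loop test, the increment and the new difference; the final
  3 are the initialization, the first difference and the failing test. The body has to leave
  \<open>x\<close> at \<open>i\<close>, and the invariant is demanded for the state after the
  increment.\<close>

lemma wp_For:
  assumes xy: "x \<noteq> y" "x < 50" "y < 50" and s0: "bounded W s M" "s y = int m" "Inv 0 (s(x := 0)) M"
    and step: "\<And>i s M. i < m \<Longrightarrow> Inv i s M \<Longrightarrow> s x = int i \<Longrightarrow> s y = int m \<Longrightarrow> bounded W s M \<Longrightarrow>
      wp W p N (\<lambda>s' M'. bounded W s' M' \<and> s' x = int i \<and> s' y = int m \<and>
        Inv (Suc i) (s'(x := int (Suc i))) M') s M"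
    and bnd: "int m < 2 ^ W"
    and post: "\<And>s M. Inv m s M \<Longrightarrow> s x = int m \<Longrightarrow> s y = int m \<Longrightarrow> bounded W s M \<Longrightarrow> Q s M"
  shows "wp W (For x y p) (m * (N + 3) + 3) Q s M"
proof -
  have W: "W \<ge> 1" using s0(1) by (simp add: bounded_def)
  let ?U = "10000 * W" and ?G = "Op Sub (Var y) (Var x)"
  let ?inc = "Op Add (Var x) (Const 1)"
  let ?B = "Seq p (Seq (Assign x ?inc) (compile ?G 50))"
  have upd: "bounded W (s(x := int i)) M" if "bounded W s M" "i \<le> m" for i s M
    using that bnd by (auto simp: bounded_def)
  have cmp: "\<exists>t R'. exec (compile ?G 50) (R, M) t (R', M) \<and> t \<le> ?U \<and>
      R' 50 = s y - s x \<and> (\<forall>x<50. R' x = s x)" if "bounded W s M" "\<forall>x<50. R x = s x" for R s M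
  proof -
    have "safe ?G s M" using xy by simp
    from exec_compile[OF that(1) this order_refl that(2)] obtain t R' where
      *: "exec (compile ?G 50) (R, M) t (R', M)" "t \<le> cost_factor ?G * W"
      "R' 50 = aval ?G s M" "\<forall>x<50. R' x = R x" by blast
    have "t \<le> ?U" "R' 50 = s y - s x" "\<forall>x<50. R' x = s x" using *(2-4) that(2) by simp_all
    with *(1) show ?thesis by blast
  qed
  have loop: "\<exists>t R' s' M'. exec (WhilePos 50 ?B) (R, M) t (R', M') \<and> t \<le> (k * (N + 3) + 1) * ?U \<and>
      (\<forall>x<50. R' x = s' x) \<and> Q s' M'"
    if "i + k = m" "Inv i s M" "s x = int i" "s y = int m" "bounded W s M" "\<forall>x<50. R x = s x"
      "R 50 = s y - s x" for i k s M R
    using that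
  proof (induction k arbitrary: i s M R)
    case 0
    have "exec (WhilePos 50 ?B) (R, M) (1 + int_len (R 50)) (R, M)"
      by (rule exec.WhileFalse) (use 0 in auto)
    moreover have "1 + int_len (R 50) \<le> (0 * (N + 3) + 1) * ?U"
      using 0 W by (simp add: int_len_0)
    moreover have "Q s M" using 0 by (intro post) auto
    ultimately show ?case using 0(6) by blast
  next
    case (Suc k)
    have pos: "R 50 > 0" using Suc.prems by simp
    have "wp W (Seq p (Assign x ?inc)) (N + 1) (\<lambda>s' M'. Inv (Suc i) s' M' \<and> s' x = int (Suc i) \<and>
        s' y = int m \<and> bounded W s' M') s M"
    proof (rule wp_Seq[of _ _ N _ 1])
      show "wp W p N (\<lambda>s' M'. wp W (Assign x ?inc) 1 (\<lambda>s' M'. Inv (Suc i) s' M' \<and>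
          s' x = int (Suc i) \<and> s' y = int m \<and> bounded W s' M') s' M') s M"
      proof (rule wp_mono[OF step order_refl])
        show "i < m" using Suc.prems by simp
        fix s' M' assume *: "bounded W s' M' \<and> s' x = int i \<and> s' y = int m \<and>
            Inv (Suc i) (s'(x := int (Suc i))) M'"
        then have eq: "s'(x := aval ?inc s' M') = s'(x := int (Suc i))" by (simp add: add.commute)
        show "wp W (Assign x ?inc) 1 (\<lambda>s' M'. Inv (Suc i) s' M' \<and>
          s' x = int (Suc i) \<and> s' y = int m \<and> bounded W s' M') s' M'"
          by (rule wp_Assign, unfold eq)
            (use * xy upd[of s' M' "Suc i"] Suc.prems in \<open>auto simp: int_len_1\<close>)
      qed (use Suc.prems in auto)
    qed simp
    with Suc.prems(6) obtain t1 R1 s1 M1 where 1: "exec (Seq p (Assign x ?inc)) (R, M) t1 (R1, M1)"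
      "t1 \<le> (N + 1) * ?U" "\<forall>x<50. R1 x = s1 x" and I1: "Inv (Suc i) s1 M1" "s1 x = int (Suc i)"
      "s1 y = int m" "bounded W s1 M1" unfolding wp_def by blast
    from cmp[OF I1(4) 1(3)] obtain t2 R2 where 2: "exec (compile ?G 50) (R1, M1) t2 (R2, M1)"
      "t2 \<le> ?U" "R2 50 = s1 y - s1 x" "\<forall>x<50. R2 x = s1 x" by blast
    from 1(1) obtain u1 u2 S where u: "t1 = u1 + u2" "exec p (R, M) u1 S"
      "exec (Assign x ?inc) S u2 (R1, M1)" by (rule SeqE)
    from exec.Seq[OF u(2) exec.Seq[OF u(3) 2(1)]]
    have body: "exec ?B (R, M) (t1 + t2) (R2, M1)" by (simp only: u(1) add.assoc)
    have "Suc i + k = m" using Suc.prems by simp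
    from Suc.IH[OF this I1 2(4,3)] obtain t3 R3 s3 M3 where
      3: "exec (WhilePos 50 ?B) (R2, M1) t3 (R3, M3)" "t3 \<le> (k * (N + 3) + 1) * ?U"
      "\<forall>x<50. R3 x = s3 x" "Q s3 M3" by blast
    have "\<bar>R 50\<bar> \<le> int m" using Suc.prems by simp
    with bnd have "\<bar>R 50\<bar> < 2 ^ W" by (rule order.strict_trans1[rotated])
    then have "1 + int_len (R 50) \<le> ?U" using W int_len_le_iff[OF W, of "R 50"] by linarith
    moreover have "(Suc k * (N + 3) + 1) * ?U = (k * (N + 3) + 1) * ?U + (N + 1) * ?U + ?U + ?U"
    proof -
      have "Suc k * (N + 3) + 1 = (k * (N + 3) + 1) + (N + 1) + 1 + 1" by simp
      then show ?thesis by (simp only: add_mult_distrib mult_1)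
    qed
    ultimately have "1 + int_len (R 50) + (t1 + t2) + t3 \<le> (Suc k * (N + 3) + 1) * ?U"
      using 1(2) 2(2) 3(2) by linarith
    moreover note exec.WhileTrue[OF pos body 3(1)]
    ultimately show ?case using 3(3,4) by (intro exI conjI)
  qed
  show ?thesis unfolding wp_def
  proof (intro allI impI)
    fix R assume R: "\<forall>x<50. R x = s x"
    have "wp W (Assign x (Const 0)) 1 (\<lambda>s' M'. s' = s(x := 0) \<and> M' = M) s M"
      by (rule wp_Assign[OF s0(1)]) (use xy in \<open>auto simp: int_len_0\<close>)
    from this[unfolded wp_def, rule_format, OF R[rule_format]] obtain t1 R1 s1 M1 where
      "exec (Assign x (Const 0)) (R, M) t1 (R1, M1)" "t1 \<le> 1 * ?U" "\<forall>z<50. R1 z = s1 z"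
      "s1 = s(x := 0)" "M1 = M" by blast
    then have 1: "exec (Assign x (Const 0)) (R, M) t1 (R1, M)" "t1 \<le> 1 * ?U"
      "\<forall>z<50. R1 z = (s(x := 0)) z" by simp_all
    have b: "bounded W (s(x := 0)) M" using upd[OF s0(1), of 0] by simp
    from cmp[OF b 1(3)] obtain t2 R2 where 2: "exec (compile ?G 50) (R1, M) t2 (R2, M)"
      "t2 \<le> ?U" "R2 50 = (s(x := 0)) y - (s(x := 0)) x" "\<forall>z<50. R2 z = (s(x := 0)) z" by blast
    have "0 + m = m" "(s(x := 0)) x = int 0" "(s(x := 0)) y = int m" using s0(2) xy by simp_all
    from loop[OF this(1) s0(3) this(2,3) b 2(4,3)] obtain t3 R3 s3 M3 where
      3: "exec (WhilePos 50 ?B) (R2, M) t3 (R3, M3)" "t3 \<le> (m * (N + 3) + 1) * ?U"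
      "\<forall>x<50. R3 x = s3 x" "Q s3 M3" by blast
    have "exec (For x y p) (R, M) (t1 + (t2 + t3)) (R3, M3)"
      unfolding For_def by (intro exec.Seq[OF 1(1)] exec.Seq[OF 2(1)] 3(1))
    moreover have "t1 + (t2 + t3) \<le> (m * (N + 3) + 3) * ?U"
    proof -
      have "m * (N + 3) + 3 = (m * (N + 3) + 1) + 1 + 1" by simp
      then have "(m * (N + 3) + 3) * ?U = (m * (N + 3) + 1) * ?U + 1 * ?U + 1 * ?U"
        by (simp only: add_mult_distrib)
      then show ?thesis using 1(2) 2(2) 3(2) by linarith
    qed
    ultimately show "\<exists>t R' s' M'. exec (For x y p) (R, M) t (R', M') \<and>
        t \<le> (m * (N + 3) + 3) * ?U \<and> (\<forall>x<50. R' x = s' x) \<and> Q s' M'"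
      using 3(3,4) by (intro exI conjI)
  qed
qed


section \<open>Table updates\<close>

abbreviation Plus (infixl "[+]" 65) where "a [+] b \<equiv> Op Add a b"
abbreviation Minus (infixl "[-]" 65) where "a [-] b \<equiv> Op Sub a b"
abbreviation Times (infixl "[*]" 70) where "a [*] b \<equiv> Op Mult a b"
abbreviation Over (infixl "[div]" 70) where "a [div] b \<equiv> Op Div a b"
abbreviation Then (infixr ";;" 60) where "p ;; q \<equiv> Seq p q"

text \<open>Parity has to be expressed by a division; since \<open>a\<close> occurs twice, its cost
  doubles.\<close>

definition odd_exp :: "aexp \<Rightarrow> aexp" where
  "odd_exp a = a [-] Const 2 [*] (a [div] Const 2)"

lemma odd_exp [simp]:
  "aval (odd_exp a) s M = aval a s M mod 2"
  "safe (odd_exp a) s M \<longleftrightarrow> safe a s M"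
  "cost_factor (odd_exp a) = 2 * cost_factor a + 4 * len_factor a + 19"
  "len_factor (odd_exp a) = 2 * len_factor a + 4"
  by (simp_all add: odd_exp_def minus_mult_div_eq_mod int_len_2)

lemma wp_Assign_Seq:
  assumes "bounded W s M" "safe e s M" "x < 50" "cost_factor e + len_factor e \<le> 9000"
    and "wp W q N Q (s(x := aval e s M)) M" "Suc N \<le> N'"
  shows "wp W (Seq (Assign x e) q) N' Q s M"
  by (rule wp_Seq[of _ _ 1 _ N], rule wp_Assign) (use assms in auto)

lemma bounded_upd:
  assumes "bounded W s M" "\<bar>a\<bar> < 2 ^ W"
  shows "bounded W (s(x := a)) M"
  using assms by (auto simp: bounded_def)

lemma bounded_upd_mem:
  assumes "bounded W s M" "\<bar>a\<bar> < 2 ^ W"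
  shows "bounded W s (M(x := a))"
  using assms by (auto simp: bounded_def)

lemma bounded_abs_le_1:
  assumes "bounded W s M" "\<bar>a\<bar> \<le> 1"
  shows "\<bar>a\<bar> < (2::int) ^ W"
proof -
  have "W > 0" using assms(1) by (simp add: bounded_def)
  then have "(1::int) < 2 ^ W" by simp
  then show ?thesis using assms(2) by linarith
qed

lemma of_bool_bit_int: "int I div 2 ^ i mod 2 = of_bool (bit I i)"
proof -
  have "int I div 2 ^ i mod 2 = int (I div 2 ^ i mod 2)" by (simp add: zdiv_int zmod_int)
  also have "I div 2 ^ i mod 2 = of_bool (bit I i)" by (simp add: bit_iff_odd mod2_eq_if)
  finally show ?thesis by simp
qed

text \<open>Registers: 0 result, 1 number of vertices, 2 number of bags, 3 base address of the array that maps a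
  vertex in slot \<open>i\<close> to \<open>2\<^sup>i\<close> and an inactive vertex to 0, 4 base address of the table, 5 row stride \<open>2\<^sup>n\<close> of
  the table, 6 number of rows in use, 7 bag, 8 and 9 vertices, 10 and 11 row and column of the table,
  12 and 13 slots (as powers of two), 14 to 17 signs, 18 to 20 auxiliary.\<close>

definition sign_prog :: "nat \<Rightarrow> nat \<Rightarrow> nat \<Rightarrow> program" where
  "sign_prog d x q =
     Assign 18 (Var x [div] Var q) ;; Assign d (Const 1) ;;
     For 19 1 (Assign 18 (Var 18 [div] Const 2) ;;
       Assign d (Var d [*] (Const 1 [-] Const 2 [*] odd_exp (Var 18))))"

lemma wp_sign_prog:
  assumes b: "bounded W s M" and s: "s x = int I" "s q = 2 ^ i" "s 1 = int n" and I: "I < 2 ^ n"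
    and regs: "x < 50" "q < 50" "d < 50" "x \<notin> {18, 19, d}" "q \<notin> {18, 19, d}" "d \<notin> {1, 18, 19}"
    and Q: "Q (s(18 := 0, d := slot_sign n i I, 19 := int n)) M"
  shows "wp W (sign_prog d x q) (5 * n + 5) Q s M"
proof -
  have W: "W \<ge> 1" "int n < 2 ^ W" using b s(3) by (auto simp: bounded_def dest: spec[of _ 1])
  have IW: "int I < 2 ^ W" using b s(1) regs by (auto simp: bounded_def dest: spec[of _ x])
  \<comment> \<open>\<open>sg k\<close> is the sign contributed by the \<open>k\<close> bits above
    bit \<open>i\<close>. Each round shifts register 18 to the right and multiplies \<open>d\<close>
    by 1 or -1.\<close>
  define sg :: "nat \<Rightarrow> int" where "sg k = (-1) ^ length (filter (bit I) [Suc i..<Suc i + k])" for k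
  have sg_Suc: "sg (Suc k) = sg k * (1 - 2 * of_bool (bit I (Suc (i + k))))" for k
    by (simp add: sg_def)
  have sg_abs: "\<bar>sg k\<bar> \<le> 1" for k by (simp add: sg_def power_abs)
  \<comment> \<open>The loop makes \<open>n\<close> rounds whatever \<open>i\<close> is; rounds past
    bit \<open>n - 1\<close> see zeros because \<open>I < 2 ^ n\<close>.\<close>
  have sg_n: "sg n = slot_sign n i I"
  proof -
    have "filter (bit I) [Suc i..<Suc i + n] = filter (bit I) [Suc i..<n]"
    proof (cases "Suc i \<le> n")
      case True
      then have "[Suc i..<Suc i + n] = [Suc i..<n] @ [n..<Suc i + n]"
        using upt_add_eq_append[of "Suc i" n "Suc i"] by (simp add: add.commute)
      moreover have "filter (bit I) [n..<Suc i + n] = []"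
        using I by (auto simp: filter_empty_conv less_exp_bit)
      ultimately show ?thesis by simp
    next
      case False
      then show ?thesis using I by (auto simp: filter_empty_conv less_exp_bit)
    qed
    then show ?thesis by (simp add: sg_def slot_sign_def bits_from_def)
  qed
  let ?s = "\<lambda>k. s(18 := int I div 2 ^ i div 2 ^ k, d := sg k, 19 := int k)"
  have small: "\<bar>int I div 2 ^ i div 2 ^ k\<bar> < 2 ^ W" for k
    using abs_div_le[of "int I div 2 ^ i" "2 ^ k"] abs_div_le[of "int I" "2 ^ i"] IW by linarith
  have bk: "bounded W (s(18 := int I div 2 ^ i div 2 ^ k, d := sg l, 19 := int m)) M" if "m \<le> n" for k l m
    using W that by (intro bounded_upd b small bounded_abs_le_1[OF b sg_abs]) simp
  show ?thesis unfolding sign_prog_def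
  proof (rule wp_Assign_Seq[of _ _ _ _ _ _ "5 * n + 4"], rule b)
    let ?s1 = "s(18 := int I div 2 ^ i)"
    have b1: "bounded W ?s1 M" using bounded_upd[OF b small[of 0]] by simp
    have "wp W (For 19 1 (Assign 18 (Var 18 [div] Const 2) ;;
       Assign d (Var d [*] (Const 1 [-] Const 2 [*] odd_exp (Var 18))))) (n * (2 + 3) + 3) Q
       (?s1(d := 1)) M"
    proof (rule wp_For[where Inv = "\<lambda>k s' M'. s' = ?s k \<and> M' = M"])
      show "bounded W (?s1(d := 1)) M" by (rule bounded_upd[OF b1]) (use W in simp)
      show "(?s1(d := 1))(19 := 0) = ?s 0 \<and> M = M" by (simp add: sg_def)
      fix k s' M' assume k: "k < n" and *: "s' = ?s k \<and> M' = M" and b': "bounded W s' M'"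
      have bit: "int I div (2 * (2 ^ i * 2 ^ k)) mod 2 = of_bool (bit I (Suc (i + k)))"
        using of_bool_bit_int[of I "Suc (i + k)"] by (simp add: power_add)
      show "wp W (Assign 18 (Var 18 [div] Const 2) ;;
          Assign d (Var d [*] (Const 1 [-] Const 2 [*] odd_exp (Var 18)))) 2
          (\<lambda>s' M'. bounded W s' M' \<and> s' 19 = int k \<and> s' 1 = int n \<and>
            s'(19 := int (Suc k)) = ?s (Suc k) \<and> M' = M) s' M'"
      proof (rule wp_Assign_Seq[OF b'])
        let ?s2 = "s'(18 := aval (Var 18 [div] Const 2) s' M')"
        have eq: "?s2 = s(18 := int I div 2 ^ i div 2 ^ Suc k, d := sg k, 19 := int k)"
        proof -
          have "int I div 2 ^ i div 2 ^ k div 2 = int I div 2 ^ i div 2 ^ Suc k"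
            by (simp only: power_Suc2 zdiv_zmult2_eq zero_le_numeral)
          then have "aval (Var 18 [div] Const 2) s' M' = int I div 2 ^ i div 2 ^ Suc k"
            using * regs by (simp del: power_Suc)
          then show ?thesis using * regs by (auto simp: fun_eq_iff simp del: power_Suc)
        qed
        have b2: "bounded W ?s2 M'" unfolding eq using * bk[of k] k by (simp del: power_Suc)
        show "wp W (Assign d (Var d [*] (Const 1 [-] Const 2 [*] odd_exp (Var 18)))) 1
          (\<lambda>s' M'. bounded W s' M' \<and> s' 19 = int k \<and> s' 1 = int n \<and>
            s'(19 := int (Suc k)) = ?s (Suc k) \<and> M' = M) ?s2 M'"
        proof (rule wp_Assign[OF b2])
          let ?e = "Var d [*] (Const 1 [-] Const 2 [*] odd_exp (Var 18))"
          have "aval ?e ?s2 M' = sg (Suc k)"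
            unfolding eq using regs bit by (simp add: sg_Suc zdiv_zmult2_eq[symmetric] mult.commute mult.left_commute)
          then have upd: "?s2(d := aval ?e ?s2 M') =
              s(18 := int I div 2 ^ i div 2 ^ Suc k, d := sg (Suc k), 19 := int k)"
            unfolding eq using regs by auto
          have b3: "bounded W (s(18 := int I div 2 ^ i div 2 ^ Suc k, d := sg (Suc k), 19 := int k)) M'"
            using * bk[of k] k by (simp del: power_Suc)
          show "bounded W (?s2(d := aval ?e ?s2 M')) M' \<and> (?s2(d := aval ?e ?s2 M')) 19 = int k \<and>
             (?s2(d := aval ?e ?s2 M')) 1 = int n \<and>
             (?s2(d := aval ?e ?s2 M'))(19 := int (Suc k)) = ?s (Suc k) \<and> M' = M"
            unfolding upd using * b3 regs s by (simp del: power_Suc)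
        qed (use regs in \<open>auto simp: int_len_1 int_len_2\<close>)
      qed (use regs in \<open>auto simp: int_len_1 int_len_2\<close>)
    next
      fix s' M' assume "s' = ?s n \<and> M' = M"
      moreover have "int I div 2 ^ i div 2 ^ n = 0"
      proof -
        have "I div 2 ^ i div 2 ^ n = 0" using I div_le_dividend[of I "2 ^ i"] by (intro div_less) (rule le_less_trans)
        then show ?thesis by (metis of_nat_0 of_nat_numeral of_nat_power zdiv_int)
      qed
      ultimately show "Q s' M'" using Q by (simp add: sg_n)
    qed (use regs s W in auto)
    then show "wp W (Assign d (Const 1) ;; For 19 1 (Assign 18 (Var 18 [div] Const 2) ;;
        Assign d (Var d [*] (Const 1 [-] Const 2 [*] odd_exp (Var 18))))) (5 * n + 4) Q
        (s(18 := aval (Var x [div] Var q) s M)) M"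
      using s regs b1 by (intro wp_Assign_Seq[of _ _ _ _ _ _ "n * (2 + 3) + 3"]) (auto simp: int_len_1)
  qed (use regs in auto)
qed

section \<open>Sweeping the table row by row\<close>

definition same_off :: "nat set \<Rightarrow> (nat \<Rightarrow> int) \<Rightarrow> (nat \<Rightarrow> int) \<Rightarrow> bool" where
  "same_off S s s' \<longleftrightarrow> (\<forall>x. x \<notin> S \<longrightarrow> s' x = s x)"

lemma same_offD: "same_off S s s' \<Longrightarrow> x \<notin> S \<Longrightarrow> s' x = s x"
  by (simp add: same_off_def)

lemma same_off_refl [simp]: "same_off S s s"
  by (simp add: same_off_def)

lemma same_off_upd [simp]: "x \<in> S \<Longrightarrow> same_off S s (s'(x := a)) \<longleftrightarrow> same_off S s s'"
  by (auto simp: same_off_def)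

text \<open>The stride \<open>2\<^sup>n\<close> wastes memory, which is not charged, but lets the number of slots grow in place.\<close>

definition cell :: "nat \<Rightarrow> nat \<Rightarrow> (nat \<Rightarrow> int) \<Rightarrow> nat \<Rightarrow> nat \<Rightarrow> int" where
  "cell n B M I J = M (B + I * 2 ^ n + J)"

definition cell_exp :: "aexp \<Rightarrow> aexp \<Rightarrow> aexp" where
  "cell_exp a b = Var 4 [+] a [*] Var 5 [+] b"

lemma cell_address_inj:
  assumes "J < m" "J' < m"
  shows "I * m + J = I' * m + J' \<longleftrightarrow> I = I' \<and> J = (J'::nat)"
proof
  assume eq: "I * m + J = I' * m + J'"
  have "I = (I * m + J) div m" "I' = (I' * m + J') div m" using assms by auto
  then show "I = I' \<and> J = J'" using eq by simp
qed simp

definition sweep :: "program \<Rightarrow> program \<Rightarrow> aexp \<Rightarrow> program" where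
  "sweep p q e = For 10 6 (p ;; For 11 6 (q ;; Write (cell_exp (Var 10) (Var 11)) e))"

text \<open>This describes a sweep that has reached entry \<open>(I, J)\<close>: lexicographically
  earlier entries are new, all others still have their values in \<open>M\<close>. The bound
  \<open>X\<close> covers every address from \<open>B\<close> on, including cells outside the
  sweep.\<close>

definition partial_update :: "nat \<Rightarrow> nat \<Rightarrow> nat \<Rightarrow> (nat \<Rightarrow> nat \<Rightarrow> int) \<Rightarrow> (nat \<Rightarrow> int) \<Rightarrow> int \<Rightarrow>
    nat \<Rightarrow> nat \<Rightarrow> (nat \<Rightarrow> int) \<Rightarrow> bool" where
  "partial_update n B m new M X I J M' \<longleftrightarrow>
     (\<forall>a<B. M' a = M a) \<and> (\<forall>a\<ge>B. \<bar>M' a\<bar> \<le> X) \<and>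
     (\<forall>I'. \<forall>J'<2 ^ n. cell n B M' I' J' =
       (if J' < m \<and> (I' < I \<or> I' = I \<and> J' < J) then new I' J' else cell n B M I' J'))"

text \<open>\<open>p\<close> does the work common to a row and leaves its results in registers
  described by \<open>Row\<close>; \<open>q\<close> does the work of one entry. Since
  \<open>q\<close> is judged under \<open>partial_update\<close>, each use has to justify what
  \<open>e\<close> reads while the table is half updated. The limit 8000 leaves room for the address
  of the write.\<close>

lemma wp_sweep:
  assumes b: "bounded W s M" and s: "s 4 = int B" "s 5 = 2 ^ n" "s 6 = int m" and m: "m \<le> 2 ^ n"
    and X: "\<And>a. a \<ge> B \<Longrightarrow> \<bar>M a\<bar> \<le> X" "X < 2 ^ W" and S: "S \<inter> {4, 5, 6} = {}" "10 \<in> S" "11 \<in> S"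
    and new: "\<And>I J. I < m \<Longrightarrow> J < m \<Longrightarrow> \<bar>new I J\<bar> \<le> X"
    and Row: "\<And>I s' x. Row I (s'(11 := x)) = Row I s'"
    and p: "\<And>I s' M'. I < m \<Longrightarrow> bounded W s' M' \<Longrightarrow> same_off S s s' \<Longrightarrow> s' 10 = int I \<Longrightarrow>
      wp W p N1 (\<lambda>s'' M''. M'' = M' \<and> bounded W s'' M'' \<and> same_off S s s'' \<and> s'' 10 = int I \<and>
        Row I s'') s' M'"
    and q: "\<And>I J s' M'. I < m \<Longrightarrow> J < m \<Longrightarrow> bounded W s' M' \<Longrightarrow> same_off S s s' \<Longrightarrow>
      s' 10 = int I \<Longrightarrow> s' 11 = int J \<Longrightarrow> Row I s' \<Longrightarrow> partial_update n B m new M X I J M' \<Longrightarrow>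
      wp W q N2 (\<lambda>s'' M''. M'' = M' \<and> bounded W s'' M'' \<and> same_off S s s'' \<and> s'' 10 = int I \<and>
        s'' 11 = int J \<and> Row I s'' \<and> safe e s'' M' \<and> aval e s'' M' = new I J) s' M'"
    and e: "cost_factor e + len_factor e \<le> 8000"
    and Q: "\<And>s' M'. bounded W s' M' \<Longrightarrow> same_off S s s' \<Longrightarrow> \<forall>a<B. M' a = M a \<Longrightarrow>
      \<forall>a\<ge>B. \<bar>M' a\<bar> \<le> X \<Longrightarrow> (\<And>I J. I < m \<Longrightarrow> J < m \<Longrightarrow> cell n B M' I J = new I J) \<Longrightarrow> Q s' M'"
  shows "wp W (sweep p q e) (m * (N1 + (m * (N2 + 4) + 3) + 3) + 3) Q s M"
proof -
  have mW: "int m < 2 ^ W" using b s(3) by (auto simp: bounded_def dest: spec[of _ 6])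
  have ss: "s' 4 = int B" "s' 5 = 2 ^ n" "s' 6 = int m" if "same_off S s s'" for s'
    using same_offD[OF that] s S(1) by auto
  \<comment> \<open>The end of a row is the start of the next, which turns the inner invariant into
    the outer one.\<close>
  have row_end: "partial_update n B m new M X I m M' \<longleftrightarrow> partial_update n B m new M X (Suc I) 0 M'"
    for I M'
    unfolding partial_update_def by (intro conj_cong all_cong1 imp_cong refl) (auto simp: less_Suc_eq)
  show ?thesis unfolding sweep_def
  proof (rule wp_For[where Inv = "\<lambda>I s' M'. same_off S s s' \<and> partial_update n B m new M X I 0 M'"])
    show "same_off S s (s(10 := 0)) \<and> partial_update n B m new M X 0 0 M"
      using S X by (simp add: partial_update_def)
    fix I s1 M1
    assume I: "I < m" and inv: "same_off S s s1 \<and> partial_update n B m new M X I 0 M1"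
      and s1: "s1 10 = int I" "bounded W s1 M1"
    show "wp W (p ;; For 11 6 (q ;; Write (cell_exp (Var 10) (Var 11)) e))
        (N1 + (m * (N2 + 4) + 3))
        (\<lambda>s' M'. bounded W s' M' \<and> s' 10 = int I \<and> s' 6 = int m \<and>
          (same_off S s (s'(10 := int (Suc I))) \<and> partial_update n B m new M X (Suc I) 0 M')) s1 M1"
    proof (rule wp_Seq[OF wp_mono[OF p order_refl] order_refl])
      fix s2 M2
      assume 2: "M2 = M1 \<and> bounded W s2 M2 \<and> same_off S s s2 \<and> s2 10 = int I \<and> Row I s2"
      have "wp W (For 11 6 (q ;; Write (cell_exp (Var 10) (Var 11)) e)) (m * ((N2 + 1) + 3) + 3)
        (\<lambda>s' M'. bounded W s' M' \<and> s' 10 = int I \<and> s' 6 = int m \<and>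
          (same_off S s (s'(10 := int (Suc I))) \<and> partial_update n B m new M X (Suc I) 0 M')) s2 M2"
      proof (rule wp_For[where Inv = "\<lambda>J s' M'. same_off S s s' \<and> s' 10 = int I \<and> Row I s' \<and>
            partial_update n B m new M X I J M'"])
        show "same_off S s (s2(11 := 0)) \<and> (s2(11 := 0)) 10 = int I \<and> Row I (s2(11 := 0)) \<and>
            partial_update n B m new M X I 0 M2"
          using 2 inv S by (simp add: Row)
        show "s2 6 = int m" using 2 ss by blast
      next
        fix J s3 M3
        assume J: "J < m" and 3: "same_off S s s3 \<and> s3 10 = int I \<and> Row I s3 \<and>
            partial_update n B m new M X I J M3" and s3: "s3 11 = int J" "bounded W s3 M3"
        show "wp W (q ;; Write (cell_exp (Var 10) (Var 11)) e) (N2 + 1)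
            (\<lambda>s' M'. bounded W s' M' \<and> s' 11 = int J \<and> s' 6 = int m \<and>
              (same_off S s (s'(11 := int (Suc J))) \<and> (s'(11 := int (Suc J))) 10 = int I \<and>
               Row I (s'(11 := int (Suc J))) \<and> partial_update n B m new M X I (Suc J) M')) s3 M3"
        proof (rule wp_Seq[OF wp_mono[OF q order_refl] order_refl])
          fix s4 M4
          assume 4: "M4 = M3 \<and> bounded W s4 M4 \<and> same_off S s s4 \<and> s4 10 = int I \<and>
            s4 11 = int J \<and> Row I s4 \<and> safe e s4 M3 \<and> aval e s4 M3 = new I J"
          have addr: "aval (cell_exp (Var 10) (Var 11)) s4 M4 = int (B + I * 2 ^ n + J)"
            using 4 ss[of s4] by (simp add: cell_exp_def)
          let ?a = "B + I * 2 ^ n + J"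
          have bnd: "\<bar>new I J\<bar> < 2 ^ W" using new[OF I J] X(2) by simp
          have upd: "partial_update n B m new M X I (Suc J) (M4(?a := new I J))"
            unfolding partial_update_def
          proof (intro conjI allI impI)
            fix a assume "a < B"
            then show "(M4(?a := new I J)) a = M a" using 3 4 by (simp add: partial_update_def)
          next
            fix a assume "B \<le> a"
            then show "\<bar>(M4(?a := new I J)) a\<bar> \<le> X"
              using 3 4 new[OF I J] by (simp add: partial_update_def)
          next
            fix I' J' :: nat assume J': "J' < 2 ^ n"
            have "cell n B (M4(?a := new I J)) I' J' =
                (if I' = I \<and> J' = J then new I J else cell n B M4 I' J')"
              using cell_address_inj[of J' "2 ^ n" J I' I] J' J m by (simp add: cell_def)
            then show "cell n B (M4(?a := new I J)) I' J' =
                (if J' < m \<and> (I' < I \<or> I' = I \<and> J' < Suc J) then new I' J' else cell n B M I' J')"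
              using 3 4 J J' by (auto simp: partial_update_def)
          qed
          show "wp W (Write (cell_exp (Var 10) (Var 11)) e) 1
            (\<lambda>s' M'. bounded W s' M' \<and> s' 11 = int J \<and> s' 6 = int m \<and>
              (same_off S s (s'(11 := int (Suc J))) \<and> (s'(11 := int (Suc J))) 10 = int I \<and>
               Row I (s'(11 := int (Suc J))) \<and> partial_update n B m new M X I (Suc J) M')) s4 M4"
          proof (rule wp_Write)
            have val: "aval e s4 M4 = new I J" using 4 by simp
            have "bounded W s4 (M4(?a := new I J))" by (rule bounded_upd_mem[OF _ bnd]) (use 4 in auto)
            then show "bounded W s4 (M4(nat (aval (cell_exp (Var 10) (Var 11)) s4 M4) := aval e s4 M4)) \<and>
               s4 11 = int J \<and> s4 6 = int m \<and>
              (same_off S s (s4(11 := int (Suc J))) \<and> (s4(11 := int (Suc J))) 10 = int I \<and>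
               Row I (s4(11 := int (Suc J))) \<and> partial_update n B m new M X I (Suc J)
                 (M4(nat (aval (cell_exp (Var 10) (Var 11)) s4 M4) := aval e s4 M4)))"
              unfolding addr nat_int val using 4 upd ss[of s4] S(3) by (simp add: Row)
          qed (use 4 e addr in \<open>auto simp: cell_exp_def\<close>)
        qed (use I J 3 s3 in auto)
      next
        fix s3 M3
        assume "same_off S s s3 \<and> s3 10 = int I \<and> Row I s3 \<and> partial_update n B m new M X I m M3"
          "s3 11 = int m" "s3 6 = int m" "bounded W s3 M3"
        then show "bounded W s3 M3 \<and> s3 10 = int I \<and> s3 6 = int m \<and>
          (same_off S s (s3(10 := int (Suc I))) \<and> partial_update n B m new M X (Suc I) 0 M3)"
          using S row_end by simp
      qed (use 2 mW in auto)
      then show "wp W (For 11 6 (q ;; Write (cell_exp (Var 10) (Var 11)) e)) (m * (N2 + 4) + 3)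
        (\<lambda>s' M'. bounded W s' M' \<and> s' 10 = int I \<and> s' 6 = int m \<and>
          (same_off S s (s'(10 := int (Suc I))) \<and> partial_update n B m new M X (Suc I) 0 M')) s2 M2"
        by (simp add: add.commute add.left_commute)
    qed (use I inv s1 in auto)
  next
    fix s1 M1
    assume "same_off S s s1 \<and> partial_update n B m new M X m 0 M1" "bounded W s1 M1"
    then show "Q s1 M1" using m by (intro Q) (auto simp: partial_update_def)
  qed (use b s mW in auto)
qed

lemma cell_exp:
  assumes "s 4 = int B" "s 5 = 2 ^ n" "aval x s M = int I" "aval y s M = int J"
  shows "aval (Mem (cell_exp x y)) s M = cell n B M I J"
    and "safe (Mem (cell_exp x y)) s M \<longleftrightarrow> safe x s M \<and> safe y s M"
proof -
  have "aval (cell_exp x y) s M = int (B + I * 2 ^ n + J)"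
    using assms by (simp add: cell_exp_def)
  then show "aval (Mem (cell_exp x y)) s M = cell n B M I J"
    and "safe (Mem (cell_exp x y)) s M \<longleftrightarrow> safe x s M \<and> safe y s M"
    by (simp_all only: aval.simps nat_int cell_def safe.simps) (simp add: cell_exp_def)
qed

lemma cost_cell_exp [simp]:
  "cost_factor (cell_exp x y) = cost_factor x + cost_factor y + 3 * len_factor x + len_factor y + 18"
  "len_factor (cell_exp x y) = len_factor x + len_factor y + 2"
  by (simp_all add: cell_exp_def)

definition coeff_exp :: "nat \<Rightarrow> nat \<Rightarrow> nat \<Rightarrow> aexp" where
  "coeff_exp d x q = (Const 1 [-] odd_exp (Var x [div] Var q)) [*] Var d"

lemma coeff_exp:
  assumes "s x = int I" "s q = 2 ^ i" "s d = slot_sign n i I"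
  shows "aval (coeff_exp d x q) s M = slot_coeff n i I"
  using assms by (simp add: coeff_exp_def slot_coeff_def of_bool_bit_int)

lemma cost_coeff_exp [simp]:
  "cost_factor (coeff_exp d x q) = 81" "len_factor (coeff_exp d x q) = 10"
  by (simp_all add: coeff_exp_def int_len_1)

lemma safe_coeff_exp [simp]: "safe (coeff_exp d x q) s M \<longleftrightarrow> x < 50 \<and> q < 50 \<and> d < 50"
  by (auto simp: coeff_exp_def)

lemma wp_two_signs:
  assumes b: "bounded W s M" and s: "s x = int I" "s q = 2 ^ i" "s q' = 2 ^ j" "s 1 = int n"
    and I: "I < 2 ^ n"
    and regs: "x < 14" "q < 14" "q' < 14" "14 \<le> d" "d < 18" "14 \<le> d'" "d' < 18" "d \<noteq> d'"
    and Q: "\<And>s'. bounded W s' M \<Longrightarrow> same_off {d, d', 18, 19} s s' \<Longrightarrow>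
      s' d = slot_sign n i I \<Longrightarrow> s' d' = slot_sign n j I \<Longrightarrow> Q s' M"
  shows "wp W (sign_prog d x q ;; sign_prog d' x q') (10 * n + 10) Q s M"
proof (rule wp_Seq)
  have nW: "int n < 2 ^ W" using b s(4) by (auto simp: bounded_def dest: spec[of _ 1])
  have sgn: "\<bar>slot_sign n i I\<bar> < 2 ^ W" for i
    by (rule bounded_abs_le_1[OF b]) (simp add: slot_sign_def power_abs)
  have 0: "\<bar>0::int\<bar> < 2 ^ W" by simp
  let ?s1 = "s(18 := 0, d := slot_sign n i I, 19 := int n)"
  let ?s2 = "?s1(18 := 0, d' := slot_sign n j I, 19 := int n)"
  have b1: "bounded W ?s1 M" by (intro bounded_upd b sgn 0) (use nW in simp)
  have b2: "bounded W ?s2 M" by (intro bounded_upd b1 sgn 0) (use nW in simp)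
  show "wp W (sign_prog d x q) (5 * n + 5) (wp W (sign_prog d' x q') (5 * n + 5) Q) s M"
  proof (rule wp_sign_prog[OF b s(1,2,4) I])
    show "wp W (sign_prog d' x q') (5 * n + 5) Q ?s1 M"
      by (rule wp_sign_prog[OF b1 _ _ _ I, where i = j])
        (use s regs Q[OF b2] in \<open>auto simp: same_off_def\<close>)
  qed (use regs in auto)
qed simp

text \<open>Apart from the entry to be updated, only rows of larger index are read, so a sweep in increasing order
  can work in place.\<close>

definition edge_exp :: aexp where
  "edge_exp =
    (let a = coeff_exp 14 10 12; b = coeff_exp 15 10 13; c = coeff_exp 16 11 12; d = coeff_exp 17 11 13;
       I = Var 10; J = Var 11; q = Var 12; q' = Var 13; T = (\<lambda>x y. Mem (cell_exp x y)) in
     T I J [+] (a [*] c [*] T (I [+] q) (J [+] q) [+] b [*] d [*] T (I [+] q') (J [+] q')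
       [-] a [*] d [*] T (I [+] q) (J [+] q') [-] b [*] c [*] T (I [+] q') (J [+] q)
       [-] a [*] b [*] c [*] d [*] T (I [+] q [+] q') (J [+] q [+] q')))"

lemma edge_exp:
  assumes "s 4 = int B" "s 5 = 2 ^ n" "s 10 = int I" "s 11 = int J" "s 12 = 2 ^ i" "s 13 = 2 ^ j"
    "s 14 = slot_sign n i I" "s 15 = slot_sign n j I" "s 16 = slot_sign n i J" "s 17 = slot_sign n j J"
  shows "aval edge_exp s M = cell n B M I J + edge_term n i j (cell n B M) I J" "safe edge_exp s M"
proof -
  note cell = cell_exp[of s B n, OF assms(1,2)]
  have T: "aval (Mem (cell_exp (Var 10) (Var 11))) s M = cell n B M I J"
    "aval (Mem (cell_exp (Var 10 [+] Var 12) (Var 11 [+] Var 12))) s M = cell n B M (I + 2 ^ i) (J + 2 ^ i)"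
    "aval (Mem (cell_exp (Var 10 [+] Var 13) (Var 11 [+] Var 13))) s M = cell n B M (I + 2 ^ j) (J + 2 ^ j)"
    "aval (Mem (cell_exp (Var 10 [+] Var 12) (Var 11 [+] Var 13))) s M = cell n B M (I + 2 ^ i) (J + 2 ^ j)"
    "aval (Mem (cell_exp (Var 10 [+] Var 13) (Var 11 [+] Var 12))) s M = cell n B M (I + 2 ^ j) (J + 2 ^ i)"
    "aval (Mem (cell_exp (Var 10 [+] Var 12 [+] Var 13) (Var 11 [+] Var 12 [+] Var 13))) s M =
      cell n B M (I + 2 ^ i + 2 ^ j) (J + 2 ^ i + 2 ^ j)"
    by (rule cell(1); simp add: assms)+
  have S: "safe (Mem (cell_exp (Var 10) (Var 11))) s M"
    "safe (Mem (cell_exp (Var 10 [+] Var 12) (Var 11 [+] Var 12))) s M"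
    "safe (Mem (cell_exp (Var 10 [+] Var 13) (Var 11 [+] Var 13))) s M"
    "safe (Mem (cell_exp (Var 10 [+] Var 12) (Var 11 [+] Var 13))) s M"
    "safe (Mem (cell_exp (Var 10 [+] Var 13) (Var 11 [+] Var 12))) s M"
    "safe (Mem (cell_exp (Var 10 [+] Var 12 [+] Var 13) (Var 11 [+] Var 12 [+] Var 13))) s M"
    using cell(2)[of "Var 10" M I "Var 11" J] cell(2)[of "Var 10 [+] Var 12" M "I + 2 ^ i" "Var 11 [+] Var 12" "J + 2 ^ i"]
      cell(2)[of "Var 10 [+] Var 13" M "I + 2 ^ j" "Var 11 [+] Var 13" "J + 2 ^ j"]
      cell(2)[of "Var 10 [+] Var 12" M "I + 2 ^ i" "Var 11 [+] Var 13" "J + 2 ^ j"]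
      cell(2)[of "Var 10 [+] Var 13" M "I + 2 ^ j" "Var 11 [+] Var 12" "J + 2 ^ i"]
      cell(2)[of "Var 10 [+] Var 12 [+] Var 13" M "I + 2 ^ i + 2 ^ j" "Var 11 [+] Var 12 [+] Var 13" "J + 2 ^ i + 2 ^ j"]
    by (simp_all add: assms)
  have C: "aval (coeff_exp 14 10 12) s M = slot_coeff n i I" "aval (coeff_exp 15 10 13) s M = slot_coeff n j I"
    "aval (coeff_exp 16 11 12) s M = slot_coeff n i J" "aval (coeff_exp 17 11 13) s M = slot_coeff n j J"
    by (rule coeff_exp; simp add: assms)+
  show "aval edge_exp s M = cell n B M I J + edge_term n i j (cell n B M) I J"
    unfolding edge_exp_def Let_def edge_term_def aval.simps(3) apply_op.simps T C ..
  show "safe edge_exp s M"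
    unfolding edge_exp_def Let_def safe.simps(3) using S by simp
qed

definition edge_prog :: program where
  "edge_prog = sweep (sign_prog 14 10 12 ;; sign_prog 15 10 13) (sign_prog 16 11 12 ;; sign_prog 17 11 13) edge_exp"

definition scratch :: "nat set" where
  "scratch = {10, 11, 14, 15, 16, 17, 18, 19}"

text \<open>Each \<open>10 * n + 10\<close> pays for two sign computations, once per row and once
  per entry. For \<open>m = 2 ^ K\<close> the inner body runs \<open>4 ^ K\<close> times.\<close>

definition sweep_cost :: "nat \<Rightarrow> nat \<Rightarrow> nat" where
  "sweep_cost n m = m * (10 * n + 10 + (m * (10 * n + 10 + 4) + 3) + 3) + 3"

lemma wp_edge_prog:
  assumes b: "bounded W s M" and s: "s 1 = int n" "s 4 = int B" "s 5 = 2 ^ n" "s 6 = 2 ^ K"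
      "s 12 = 2 ^ i" "s 13 = 2 ^ j"
    and K: "i < K" "j < K" "i \<noteq> j" "K \<le> n"
    and X: "\<And>a. a \<ge> B \<Longrightarrow> \<bar>M a\<bar> \<le> X" "6 * X < 2 ^ W"
    and Q: "\<And>s' M'. bounded W s' M' \<Longrightarrow> same_off scratch s s' \<Longrightarrow> \<forall>a<B. M' a = M a \<Longrightarrow>
      \<forall>a\<ge>B. \<bar>M' a\<bar> \<le> 6 * X \<Longrightarrow>
      (\<And>I J. I < 2 ^ K \<Longrightarrow> J < 2 ^ K \<Longrightarrow>
        cell n B M' I J = cell n B M I J + edge_term n i j (cell n B M) I J) \<Longrightarrow> Q s' M'"
  shows "wp W edge_prog (sweep_cost n (2 ^ K)) Q s M"
proof -
  let ?new = "\<lambda>I J. cell n B M I J + edge_term n i j (cell n B M) I J"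
  have X0: "X \<ge> 0" using X(1)[of B] by simp
  have pow: "(2::nat) ^ K \<le> 2 ^ n" using K(4) by simp
  have cellX: "\<bar>cell n B M I J\<bar> \<le> X" for I J
    using X(1)[of "B + I * 2 ^ n + J"] by (simp add: cell_def)
  have newX: "\<bar>?new I J\<bar> \<le> 6 * X" for I J
    using cellX[of I J] abs_edge_term_le[of "cell n B M" X n i j I J, OF cellX] by linarith
  have ss: "s' 1 = int n" "s' 4 = int B" "s' 5 = 2 ^ n" "s' 6 = 2 ^ K" "s' 12 = 2 ^ i" "s' 13 = 2 ^ j"
    if "same_off scratch s s'" for s'
    using same_offD[OF that] s by (simp_all add: scratch_def)
  have so: "same_off scratch s s''" if "same_off scratch s s'" "same_off D s' s''" "D \<subseteq> scratch" for s' s'' D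
    using that unfolding same_off_def by (metis subsetD)
  show ?thesis unfolding edge_prog_def sweep_cost_def
  proof (rule wp_sweep[where B = B and n = n and X = "6 * X" and S = scratch and new = ?new
        and Row = "\<lambda>I s'. s' 14 = slot_sign n i I \<and> s' 15 = slot_sign n j I"])
    show "s 6 = int (2 ^ K)" using s by simp
    show "\<bar>M a\<bar> \<le> 6 * X" if "a \<ge> B" for a using X(1)[OF that] X0 by linarith
  next
    fix I s' M'
    assume I: "I < 2 ^ K" and s': "bounded W s' M'" "same_off scratch s s'" "s' 10 = int I"
    have I': "I < 2 ^ n" using I pow by linarith
    show "wp W (sign_prog 14 10 12 ;; sign_prog 15 10 13) (10 * n + 10)
        (\<lambda>s'' M''. M'' = M' \<and> bounded W s'' M'' \<and> same_off scratch s s'' \<and> s'' 10 = int I \<and>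
          s'' 14 = slot_sign n i I \<and> s'' 15 = slot_sign n j I) s' M'"
    proof (rule wp_two_signs[OF s'(1) s'(3) ss(5)[OF s'(2)] ss(6)[OF s'(2)] ss(1)[OF s'(2)] I'])
      fix t assume t: "bounded W t M'" "same_off {14, 15, 18, 19} s' t"
        "t 14 = slot_sign n i I" "t 15 = slot_sign n j I"
      have "same_off scratch s t" by (rule so[OF s'(2) t(2)]) (simp add: scratch_def)
      then show "M' = M' \<and> bounded W t M' \<and> same_off scratch s t \<and> t 10 = int I \<and>
          t 14 = slot_sign n i I \<and> t 15 = slot_sign n j I"
        using t s' same_offD[OF t(2), of 10] by simp
    qed simp_all
  next
    fix I J s' M'
    assume IJ: "I < 2 ^ K" "J < 2 ^ K" and s': "bounded W s' M'" "same_off scratch s s'" "s' 10 = int I"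
      "s' 11 = int J" "s' 14 = slot_sign n i I \<and> s' 15 = slot_sign n j I"
      and part: "partial_update n B (2 ^ K) ?new M (6 * X) I J M'"
    have J': "J < 2 ^ n" using IJ pow by linarith
    show "wp W (sign_prog 16 11 12 ;; sign_prog 17 11 13) (10 * n + 10)
        (\<lambda>s'' M''. M'' = M' \<and> bounded W s'' M'' \<and> same_off scratch s s'' \<and> s'' 10 = int I \<and>
          s'' 11 = int J \<and> (s'' 14 = slot_sign n i I \<and> s'' 15 = slot_sign n j I) \<and>
          safe edge_exp s'' M' \<and> aval edge_exp s'' M' = ?new I J) s' M'"
    proof (rule wp_two_signs[OF s'(1) s'(4) ss(5)[OF s'(2)] ss(6)[OF s'(2)] ss(1)[OF s'(2)] J'])
      fix t assume t: "bounded W t M'" "same_off {16, 17, 18, 19} s' t"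
        "t 16 = slot_sign n i J" "t 17 = slot_sign n j J"
      have st: "same_off scratch s t" by (rule so[OF s'(2) t(2)]) (simp add: scratch_def)
      have regs: "t 10 = int I" "t 11 = int J" "t 14 = slot_sign n i I" "t 15 = slot_sign n j I"
        using same_offD[OF t(2)] s' by simp_all
      note e = edge_exp[OF ss(2)[OF st] ss(3)[OF st] regs(1,2) ss(5)[OF st] ss(6)[OF st] regs(3,4) t(3,4)]
      have "cell n B M' I J = cell n B M I J"
        using part J' by (simp add: partial_update_def)
      moreover have "edge_term n i j (cell n B M') I J = edge_term n i j (cell n B M) I J"
      proof (rule edge_term_cong[OF K(3)])
        fix I' J' :: nat
        assume *: "I < I'" "J < J'" "\<forall>b. bit J' b \<longrightarrow> bit J b \<or> b = i \<or> b = j"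
        have "J' < 2 ^ K" using *(3) IJ(2) K unfolding less_exp_bit by blast
        then have "J' < 2 ^ n" using pow by linarith
        then show "cell n B M' I' J' = cell n B M I' J'"
          using part *(1) by (simp add: partial_update_def)
      qed
      ultimately show "M' = M' \<and> bounded W t M' \<and> same_off scratch s t \<and> t 10 = int I \<and>
          t 11 = int J \<and> (t 14 = slot_sign n i I \<and> t 15 = slot_sign n j I) \<and>
          safe edge_exp t M' \<and> aval edge_exp t M' = ?new I J"
        using e t(1) st regs by simp
    qed simp_all
  next
    show "cost_factor edge_exp + len_factor edge_exp \<le> 8000"
      by (simp add: edge_exp_def Let_def)
  next
    fix s' M'
    assume "bounded W s' M'" "same_off scratch s s'" "\<forall>a<B. M' a = M a" "\<forall>a\<ge>B. \<bar>M' a\<bar> \<le> 6 * X"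
      "\<And>I J. I < 2 ^ K \<Longrightarrow> J < 2 ^ K \<Longrightarrow> cell n B M' I J = ?new I J"
    then show "Q s' M'" by (rule Q)
  qed (use b s pow X(2) newX in \<open>simp_all add: scratch_def\<close>)
qed

text \<open>The case distinction is encoded by 0/1 factors: \<open>(1 - x) * (1 - y)\<close> selects
  both bits clear, \<open>x * y\<close> both bits set, and mixed bits give 0. Subtracting
  \<open>x * 2 ^ i\<close> clears bit \<open>i\<close> exactly where it is set.\<close>

definition vertex_exp :: aexp where
  "vertex_exp =
    (let x = odd_exp (Var 10 [div] Var 12); y = odd_exp (Var 11 [div] Var 12) in
     ((Const 1 [-] x) [*] (Const 1 [-] y) [+] x [*] y [*] (Var 14 [*] Var 16)) [*]
     Mem (cell_exp (Var 10 [-] x [*] Var 12) (Var 11 [-] y [*] Var 12)))"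

definition vertex_prog :: program where
  "vertex_prog = sweep (sign_prog 14 10 12 ;; sign_prog 15 10 12)
     (sign_prog 16 11 12 ;; sign_prog 17 11 12) vertex_exp"

lemma vertex_exp:
  assumes "s 4 = int B" "s 5 = 2 ^ n" "s 10 = int I" "s 11 = int J" "s 12 = 2 ^ i"
    "s 14 = slot_sign n i I" "s 16 = slot_sign n i J"
  shows "aval vertex_exp s M = (if bit I i = bit J i then
      if bit I i then slot_sign n i I * slot_sign n i J * cell n B M (I - 2 ^ i) (J - 2 ^ i)
      else cell n B M I J else 0)" "safe vertex_exp s M"
proof -
  let ?x = "odd_exp (Var 10 [div] Var 12)" and ?y = "odd_exp (Var 11 [div] Var 12)"
  have xy: "aval ?x s M = of_bool (bit I i)" "aval ?y s M = of_bool (bit J i)"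
    using assms by (simp_all add: of_bool_bit_int)
  have diff: "int I' - of_bool (bit I' i) * 2 ^ i = int (I' - of_bool (bit I' i) * 2 ^ i)" for I' :: nat
    using bit_diff_exp(2)[of I' i] by (auto simp: of_nat_diff)
  have ad: "aval (Var 10 [-] ?x [*] Var 12) s M = int (I - of_bool (bit I i) * 2 ^ i)"
    "aval (Var 11 [-] ?y [*] Var 12) s M = int (J - of_bool (bit J i) * 2 ^ i)"
    unfolding diff[symmetric] by (simp_all add: assms of_bool_bit_int)
  note c = cell_exp[of s B n, OF assms(1,2) ad]
  show "aval vertex_exp s M = (if bit I i = bit J i then
      if bit I i then slot_sign n i I * slot_sign n i J * cell n B M (I - 2 ^ i) (J - 2 ^ i)
      else cell n B M I J else 0)"
    unfolding vertex_exp_def Let_def aval.simps(1,2,3) apply_op.simps c(1) xy using assms by auto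
  show "safe vertex_exp s M"
    unfolding vertex_exp_def Let_def safe.simps(1-3) using c(2) by simp
qed

lemma wp_vertex_prog:
  assumes b: "bounded W s M" and s: "s 1 = int n" "s 4 = int B" "s 5 = 2 ^ n" "s 6 = 2 ^ K"
      "s 12 = 2 ^ i"
    and K: "i < K" "K \<le> n"
    and X: "\<And>a. a \<ge> B \<Longrightarrow> \<bar>M a\<bar> \<le> X" "X < 2 ^ W"
    and Q: "\<And>s' M'. bounded W s' M' \<Longrightarrow> same_off scratch s s' \<Longrightarrow> \<forall>a<B. M' a = M a \<Longrightarrow>
      \<forall>a\<ge>B. \<bar>M' a\<bar> \<le> X \<Longrightarrow>
      (\<And>I J. I < 2 ^ K \<Longrightarrow> J < 2 ^ K \<Longrightarrow> cell n B M' I J = (if bit I i = bit J i then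
        if bit I i then slot_sign n i I * slot_sign n i J * cell n B M (I - 2 ^ i) (J - 2 ^ i)
        else cell n B M I J else 0)) \<Longrightarrow> Q s' M'"
  shows "wp W vertex_prog (sweep_cost n (2 ^ K)) Q s M"
proof -
  let ?new = "\<lambda>I J. if bit I i = bit J i then
        if bit I i then slot_sign n i I * slot_sign n i J * cell n B M (I - 2 ^ i) (J - 2 ^ i)
        else cell n B M I J else 0"
  have X0: "X \<ge> 0" using X(1)[of B] by simp
  have pow: "(2::nat) ^ K \<le> 2 ^ n" using K(2) by simp
  have cellX: "\<bar>cell n B M I J\<bar> \<le> X" for I J
    using X(1)[of "B + I * 2 ^ n + J"] by (simp add: cell_def)
  have newX: "\<bar>?new I J\<bar> \<le> X" for I J
    using cellX X0 by (auto simp: abs_mult slot_sign_def power_abs)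
  have ss: "s' 1 = int n" "s' 4 = int B" "s' 5 = 2 ^ n" "s' 6 = 2 ^ K" "s' 12 = 2 ^ i"
    if "same_off scratch s s'" for s'
    using same_offD[OF that] s by (simp_all add: scratch_def)
  have so: "same_off scratch s s''" if "same_off scratch s s'" "same_off D s' s''" "D \<subseteq> scratch" for s' s'' D
    using that unfolding same_off_def by (metis subsetD)
  show ?thesis unfolding vertex_prog_def sweep_cost_def
  proof (rule wp_sweep[where B = B and n = n and X = X and S = scratch and new = ?new
        and Row = "\<lambda>I s'. s' 14 = slot_sign n i I"])
    show "s 6 = int (2 ^ K)" using s by simp
  next
    fix I s' M'
    assume I: "I < 2 ^ K" and s': "bounded W s' M'" "same_off scratch s s'" "s' 10 = int I"
    have I': "I < 2 ^ n" using I pow by linarith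
    show "wp W (sign_prog 14 10 12 ;; sign_prog 15 10 12) (10 * n + 10)
        (\<lambda>s'' M''. M'' = M' \<and> bounded W s'' M'' \<and> same_off scratch s s'' \<and> s'' 10 = int I \<and>
          s'' 14 = slot_sign n i I) s' M'"
    proof (rule wp_two_signs[OF s'(1) s'(3) ss(5)[OF s'(2)] ss(5)[OF s'(2)] ss(1)[OF s'(2)] I'])
      fix t assume t: "bounded W t M'" "same_off {14, 15, 18, 19} s' t" "t 14 = slot_sign n i I"
      have "same_off scratch s t" by (rule so[OF s'(2) t(2)]) (simp add: scratch_def)
      then show "M' = M' \<and> bounded W t M' \<and> same_off scratch s t \<and> t 10 = int I \<and>
          t 14 = slot_sign n i I"
        using t s' same_offD[OF t(2), of 10] by simp
    qed simp_all
  next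
    fix I J s' M'
    assume IJ: "I < 2 ^ K" "J < 2 ^ K" and s': "bounded W s' M'" "same_off scratch s s'" "s' 10 = int I"
      "s' 11 = int J" "s' 14 = slot_sign n i I"
      and part: "partial_update n B (2 ^ K) ?new M X I J M'"
    have J': "J < 2 ^ n" using IJ pow by linarith
    show "wp W (sign_prog 16 11 12 ;; sign_prog 17 11 12) (10 * n + 10)
        (\<lambda>s'' M''. M'' = M' \<and> bounded W s'' M'' \<and> same_off scratch s s'' \<and> s'' 10 = int I \<and>
          s'' 11 = int J \<and> s'' 14 = slot_sign n i I \<and>
          safe vertex_exp s'' M' \<and> aval vertex_exp s'' M' = ?new I J) s' M'"
    proof (rule wp_two_signs[OF s'(1) s'(4) ss(5)[OF s'(2)] ss(5)[OF s'(2)] ss(1)[OF s'(2)] J'])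
      fix t assume t: "bounded W t M'" "same_off {16, 17, 18, 19} s' t" "t 16 = slot_sign n i J"
      have st: "same_off scratch s t" by (rule so[OF s'(2) t(2)]) (simp add: scratch_def)
      have regs: "t 10 = int I" "t 11 = int J" "t 14 = slot_sign n i I"
        using same_offD[OF t(2)] s' by simp_all
      note e = vertex_exp[OF ss(2)[OF st] ss(3)[OF st] regs(1,2) ss(5)[OF st] regs(3) t(3)]
      have "cell n B M' I J = cell n B M I J"
        using part J' by (simp add: partial_update_def)
      \<comment> \<open>This entry has already been swept, but its masks lack bit \<open>i\<close>,
        and there the update leaves the value unchanged. Hence reading it in place is safe.\<close>
      moreover have "cell n B M' (I - 2 ^ i) (J - 2 ^ i) = cell n B M (I - 2 ^ i) (J - 2 ^ i)"
        if "bit I i" "bit J i"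
        using part J' that bit_diff_exp(1)[of I i i] bit_diff_exp(1)[of J i i]
        by (simp add: partial_update_def less_imp_diff_less)
      ultimately have "aval vertex_exp t M' = ?new I J" unfolding e(1) by (cases "bit I i"; cases "bit J i"; simp)
      then show "M' = M' \<and> bounded W t M' \<and> same_off scratch s t \<and> t 10 = int I \<and>
          t 11 = int J \<and> t 14 = slot_sign n i I \<and>
          safe vertex_exp t M' \<and> aval vertex_exp t M' = ?new I J"
        using e(2) t(1) st regs by simp
    qed simp_all
  next
    show "cost_factor vertex_exp + len_factor vertex_exp \<le> 8000"
      by (simp add: vertex_exp_def Let_def int_len_1)
  next
    fix s' M'
    assume "bounded W s' M'" "same_off scratch s s'" "\<forall>a<B. M' a = M a" "\<forall>a\<ge>B. \<bar>M' a\<bar> \<le> X"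
      "\<And>I J. I < 2 ^ K \<Longrightarrow> J < 2 ^ K \<Longrightarrow> cell n B M' I J = ?new I J"
    then show "Q s' M'" by (rule Q)
  qed (use b s pow X newX in \<open>simp_all add: scratch_def\<close>)
qed


section \<open>Processing a vertex and a bag\<close>

lemma same_off_trans:
  "same_off S s s' \<Longrightarrow> same_off T s' s'' \<Longrightarrow> S \<subseteq> U \<Longrightarrow> T \<subseteq> U \<Longrightarrow> same_off U s s''"
  unfolding same_off_def by (metis subsetD)

lemma sweep_cost_mono: "m \<le> m' \<Longrightarrow> sweep_cost n m \<le> sweep_cost n m'"
  unfolding sweep_cost_def by (intro add_mono mult_le_mono) auto

lemma same_off_mono: "same_off S s s' \<Longrightarrow> S \<subseteq> T \<Longrightarrow> same_off T s s'"
  unfolding same_off_def by blast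

text \<open>Taking the least free slot keeps the number of slots at most the largest bag size. All slots below
  \<open>k\<close> stay occupied throughout the search, and each of the \<open>n\<close> passes either advances or has found a
  free slot.\<close>

definition slot_prog :: program where
  "slot_prog = Assign 12 (Const 1) ;; For 20 1 (For 9 1
     (Cond (Const 1 [-] (Mem (Var 3 [+] Var 9) [-] Var 12) [*] (Mem (Var 3 [+] Var 9) [-] Var 12))
       (Assign 12 (Var 12 [+] Var 12)) Skip))"

lemma wp_slot_prog:
  assumes b: "bounded W s M" and s: "s 1 = int n" "s 3 = int L" and nW: "n < W"
    and loc: "\<And>v. v < n \<Longrightarrow> M (L + v) = (if v \<in> act then 2 ^ slot v else 0)"
    and act: "act \<subseteq> {..<n}" "card act < n"
    and Q: "\<And>s' k. bounded W s' M \<Longrightarrow> same_off {9, 12, 20} s s' \<Longrightarrow> s' 12 = 2 ^ k \<Longrightarrow>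
      {..<k} \<subseteq> slot ` act \<Longrightarrow> k \<notin> slot ` act \<Longrightarrow> Q s' M"
  shows "wp W slot_prog (n * (n * 5 + 6) + 4) Q s M"
proof -
  have fin: "finite act" using act(1) by (rule finite_subset) simp
  \<comment> \<open>The \<open>k\<close> slots below \<open>k\<close> are all taken by active
    vertices, of which there are fewer than \<open>n\<close>.\<close>
  have klt: "k < n" if "{..<k} \<subseteq> slot ` act" for k
  proof -
    have "card {..<k} \<le> card (slot ` act)" using fin by (intro card_mono that) simp
    then show ?thesis using card_image_le[OF fin, of slot] act(2) by simp
  qed
  have kW: "\<bar>2 ^ k\<bar> < (2::int) ^ W" if "k \<le> n" for k using that nW by simp
  have iW: "int n < 2 ^ W" using b s(1) by (auto simp: bounded_def dest: spec[of _ 1])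
  have W: "W \<ge> 1" using b by (simp add: bounded_def)
  let ?S = "{9, 12, 20}"
  have ss: "s' 1 = int n" "s' 3 = int L" if "same_off ?S s s'" for s'
    using same_offD[OF that] s by simp_all
  \<comment> \<open>Equality as a positivity test: for integers,
    \<open>1 - (a - b) * (a - b)\<close> is positive exactly if \<open>a = b\<close>. The value 0 of
    an inactive vertex never equals a power of two.\<close>
  let ?e = "Const 1 [-] (Mem (Var 3 [+] Var 9) [-] Var 12) [*] (Mem (Var 3 [+] Var 9) [-] Var 12)"
  let ?body = "Cond ?e (Assign 12 (Var 12 [+] Var 12)) Skip"
  let ?I = "\<lambda>p s' M'. M' = M \<and> same_off ?S s s' \<and> (\<exists>k. s' 12 = 2 ^ k \<and> {..<k} \<subseteq> slot ` act \<and>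
      (p \<le> k \<or> k \<notin> slot ` act))"
  \<comment> \<open>Within pass \<open>p\<close>, either the candidate \<open>k\<close> already
    exceeds \<open>p\<close>, or no vertex examined so far occupies slot \<open>k\<close>. At the
    end of the pass the second alternative says that \<open>k\<close> is free.\<close>
  let ?J = "\<lambda>p u s' M'. M' = M \<and> same_off ?S s s' \<and> s' 20 = int p \<and>
      (\<exists>k. s' 12 = 2 ^ k \<and> {..<k} \<subseteq> slot ` act \<and> (p \<le> k \<or> k \<notin> slot ` act) \<and>
        (Suc p \<le> k \<or> (\<forall>u'<u. u' \<in> act \<longrightarrow> slot u' \<noteq> k)))"
  have b1: "bounded W (s(12 := 1)) M" by (rule bounded_upd[OF b]) (use W in simp)
  have "wp W (For 20 1 (For 9 1 ?body)) (n * ((n * (2 + 3) + 3) + 3) + 3) Q (s(12 := 1)) M"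
  proof (rule wp_For[where Inv = ?I])
    show "?I 0 ((s(12 := 1))(20 := 0)) M" by (auto intro!: exI[of _ 0])
    fix p s1 M1
    assume p: "p < n" and I1: "?I p s1 M1" and s1: "s1 20 = int p" "s1 1 = int n" "bounded W s1 M1"
    show "wp W (For 9 1 ?body) (n * (2 + 3) + 3) (\<lambda>s' M'. bounded W s' M' \<and> s' 20 = int p \<and> s' 1 = int n \<and>
        ?I (Suc p) (s'(20 := int (Suc p))) M') s1 M1"
    proof (rule wp_For[where Inv = "?J p"])
      show "?J p 0 (s1(9 := 0)) M1" using I1 s1 by auto
      fix u s2 M2
      assume u: "u < n" and J: "?J p u s2 M2" and s2: "s2 9 = int u" "s2 1 = int n" "bounded W s2 M2"
      from J obtain k where k: "s2 12 = 2 ^ k" "{..<k} \<subseteq> slot ` act" "p \<le> k \<or> k \<notin> slot ` act"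
        "Suc p \<le> k \<or> (\<forall>u'<u. u' \<in> act \<longrightarrow> slot u' \<noteq> k)" and J': "M2 = M" "same_off ?S s s2" "s2 20 = int p" by blast
      have val: "aval (Mem (Var 3 [+] Var 9)) s2 M2 = (if u \<in> act then 2 ^ slot u else 0)"
        using s2 ss[OF J'(2)] loc[OF u] J'(1) by (simp add: nat_int_add)
      have pos: "aval ?e s2 M2 > 0 \<longleftrightarrow> u \<in> act \<and> slot u = k"
      proof -
        have sq: "1 - (a - b) * (a - b) > 0 \<longleftrightarrow> a = b" for a b :: int
        proof -
          have "a \<noteq> b \<Longrightarrow> (a - b) * (a - b) \<ge> 1"
            by (metis int_one_le_iff_zero_less linorder_neqE_linordered_idom mult_neg_neg mult_pos_pos right_minus_eq)
          then show ?thesis by (cases "a = b") auto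
        qed
        have "(0::int) \<noteq> 2 ^ k" by simp
        then show ?thesis unfolding aval.simps(3) apply_op.simps val using k(1) sq by simp
      qed
      let ?P = "\<lambda>s' M'. bounded W s' M' \<and> s' 9 = int u \<and> s' 1 = int n \<and> ?J p (Suc u) (s'(9 := int (Suc u))) M'"
      show "wp W ?body 2 ?P s2 M2"
      proof (rule wp_Cond[of _ _ _ _ _ 1, unfolded One_nat_def[symmetric] Suc_1])
        assume "aval ?e s2 M2 > 0"
        then have uk: "u \<in> act" "slot u = k" using pos by auto
        have sub: "{..<Suc k} \<subseteq> slot ` act" using k(2) uk by (auto simp: less_Suc_eq)
        have kn: "Suc k < n" by (rule klt[OF sub])
        show "wp W (Assign 12 (Var 12 [+] Var 12)) 1 ?P s2 M2"
        proof (rule wp_Assign[OF s2(3)])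
          have eq: "s2(12 := aval (Var 12 [+] Var 12) s2 M2) = s2(12 := 2 ^ Suc k)" using k(1) by simp
          have "Suc p \<le> Suc k" using k(3) uk by auto
          then have "?J p (Suc u) ((s2(12 := 2 ^ Suc k))(9 := int (Suc u))) M2"
            using J' sub by (auto intro!: exI[of _ "Suc k"])
          then show "?P (s2(12 := aval (Var 12 [+] Var 12) s2 M2)) M2"
            unfolding eq using bounded_upd[OF s2(3) kW[of "Suc k"]] kn s2 by simp
        qed simp_all
      next
        assume "aval ?e s2 M2 \<le> 0"
        then have uk: "\<not> (u \<in> act \<and> slot u = k)" using pos by auto
        have "?J p (Suc u) (s2(9 := int (Suc u))) M2"
          using J' k uk by (auto intro!: exI[of _ k] simp: less_Suc_eq)
        then show "wp W Skip 1 ?P s2 M2" using s2 W by (intro wp_Skip) simp_all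
      qed (use s2 ss[OF J'(2)] in \<open>simp_all add: int_len_1\<close>)
    next
      fix s2 M2
      assume J: "?J p n s2 M2" "s2 1 = int n" "bounded W s2 M2"
      then obtain k where k: "s2 12 = 2 ^ k" "{..<k} \<subseteq> slot ` act"
        "Suc p \<le> k \<or> (\<forall>u'<n. u' \<in> act \<longrightarrow> slot u' \<noteq> k)" by blast
      have "Suc p \<le> k \<or> k \<notin> slot ` act" using k(3) act(1) by auto
      then have "?I (Suc p) (s2(20 := int (Suc p))) M2" using J(1) k by auto
      then show "bounded W s2 M2 \<and> s2 20 = int p \<and> s2 1 = int n \<and> ?I (Suc p) (s2(20 := int (Suc p))) M2"
        using J by blast
    qed (use s1 iW in auto)
  next
    fix s1 M1
    assume I: "?I n s1 M1" "bounded W s1 M1"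
    then obtain k where k: "s1 12 = 2 ^ k" "{..<k} \<subseteq> slot ` act" "n \<le> k \<or> k \<notin> slot ` act" by blast
    moreover have "k \<notin> slot ` act" using k klt[OF k(2)] by auto
    ultimately show "Q s1 M1" using I Q by blast
  qed (use b1 s iW in auto)
  then show ?thesis unfolding slot_prog_def
    by (intro wp_Assign_Seq[OF b]) (auto simp: int_len_1 algebra_simps)
qed

text \<open>The first condition holds iff the free slot is not below the slots in use; then the
  number of rows doubles. The new vertex is registered before its edges are scanned, but does not
  meet itself, since the adjacency matrix has zero diagonal.\<close>

definition insert_prog :: program where
  "insert_prog = slot_prog ;;
     Cond (Var 12 [-] Var 6 [+] Const 1) (Assign 6 (Var 6 [+] Var 6)) Skip ;;
     vertex_prog ;; Write (Var 3 [+] Var 8) (Var 12) ;;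
     For 9 1 (Cond (Mem (Var 3 [+] Var 9) [*] Mem (Const 2 [+] Var 8 [*] Var 1 [+] Var 9))
       (Assign 13 (Mem (Var 3 [+] Var 9)) ;; edge_prog) Skip)"

definition insert_cost :: "nat \<Rightarrow> nat \<Rightarrow> nat" where
  "insert_cost n m = n * (n * 5 + 6) + 4 + (2 + (sweep_cost n m + (1 +
     (n * (Suc (Suc (sweep_cost n m)) + 3) + 3))))"

section \<open>Memory layout and invariant of the dynamic program\<close>

locale forest_memory =
  fixes n L B :: nat and inp :: "nat \<Rightarrow> int" and E :: "nat set set"
  assumes B: "B = L + n" and L: "2 + n * n \<le> L"
    and adj: "\<And>u v. u < n \<Longrightarrow> v < n \<Longrightarrow> inp (2 + u * n + v) = of_bool ({u, v} \<in> E)"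
    and simple: "\<And>u v. {u, v} \<in> E \<Longrightarrow> u \<noteq> v" and finite_E: "finite E"
begin

text \<open>The input stays below \<open>L\<close>, the \<open>n\<close> cells from \<open>L\<close>
  on locate the active vertices, and the table begins behind them at \<open>B\<close>.\<close>

definition low_memory :: "nat set \<Rightarrow> (nat \<Rightarrow> nat) \<Rightarrow> (nat \<Rightarrow> int) \<Rightarrow> bool" where
  "low_memory act slot M \<longleftrightarrow> (\<forall>a<L. M a = inp a) \<and>
     (\<forall>v<n. M (L + v) = (if v \<in> act then 2 ^ slot v else 0))"

text \<open>\<open>F\<close> is the set of edges handled so far. The bound \<open>X\<close> includes
  stale cells, because a sweep runs over all masks below \<open>2 ^ K\<close>. Minors are taken with
  \<open>n\<close> instead of \<open>K\<close>, so they do not depend on the number of slots in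
  use.\<close>

definition memory_state :: "nat \<Rightarrow> nat set \<Rightarrow> (nat \<Rightarrow> nat) \<Rightarrow> nat set set \<Rightarrow> int \<Rightarrow> (nat \<Rightarrow> int) \<Rightarrow> bool" where
  "memory_state K act slot F X M \<longleftrightarrow> low_memory act slot M \<and> act \<subseteq> {..<n} \<and> inj_on slot act \<and>
     slot ` act \<subseteq> {..<K} \<and> K \<le> n \<and> F \<subseteq> E \<and> (\<forall>a\<ge>B. \<bar>M a\<bar> \<le> X) \<and>
     (\<exists>vt. (\<forall>v\<in>act. vt (slot v) = v) \<and> forest_table n F (slot ` act) vt (cell n B M))"

lemma low_memory_cong: "low_memory act slot M \<Longrightarrow> \<forall>a<B. M' a = M a \<Longrightarrow> low_memory act slot M'"
  by (simp add: low_memory_def B)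

lemma masks_less: "act \<subseteq> {..<K} \<Longrightarrow> I \<in> masks act \<Longrightarrow> I < 2 ^ K"
  unfolding less_exp_bit masks_def by auto

lemma memory_state_mono: "memory_state K act slot F X M \<Longrightarrow> X \<le> X' \<Longrightarrow> memory_state K act slot F X' M"
  unfolding memory_state_def by (meson order_trans)

lemma memory_state_vertex:
  assumes st: "memory_state K act slot F X M" and v: "v < n" "v \<notin> act" "\<And>e. e \<in> F \<Longrightarrow> v \<notin> e"
    and k: "k < K'" "k \<notin> slot ` act" and K': "K \<le> K'" "K' \<le> n"
    and M': "\<forall>a<B. M' a = M a" "\<forall>a\<ge>B. \<bar>M' a\<bar> \<le> X"
      "\<And>I J. I < 2 ^ K' \<Longrightarrow> J < 2 ^ K' \<Longrightarrow> cell n B M' I J = (if bit I k = bit J k then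
        if bit I k then slot_sign n k I * slot_sign n k J * cell n B M (I - 2 ^ k) (J - 2 ^ k)
        else cell n B M I J else 0)"
  shows "memory_state K' (insert v act) (slot(v := k)) F X (M'(L + v := 2 ^ k))"
proof -
  let ?M = "M'(L + v := 2 ^ k)" and ?slot = "slot(v := k)"
  have cell_eq: "cell n B ?M I J = cell n B M' I J" for I J
    using v(1) by (simp add: cell_def B)
  from st obtain vt where vt: "\<forall>v\<in>act. vt (slot v) = v" "forest_table n F (slot ` act) vt (cell n B M)"
    and low: "low_memory act slot M" and act: "act \<subseteq> {..<n}" "inj_on slot act" "slot ` act \<subseteq> {..<K}"
    and F: "F \<subseteq> E" unfolding memory_state_def by blast
  have img: "?slot ` insert v act = insert k (slot ` act)" using v(2) by auto
  have le: "slot ` act \<subseteq> {..<n}" using act(3) K' by auto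
  have sub: "insert k (slot ` act) \<subseteq> {..<K'}" using act(3) k K' by auto
  have "forest_table n F (insert k (slot ` act)) (vt(k := v)) (cell n B ?M)"
  proof (rule forest_table_insert_vertex[OF vt(2) le])
    fix I J assume "I \<in> masks (insert k (slot ` act))" "J \<in> masks (insert k (slot ` act))"
    then show "cell n B ?M I J = (if bit I k = bit J k then
        if bit I k then slot_sign n k I * slot_sign n k J * cell n B M (I - 2 ^ k) (J - 2 ^ k)
        else cell n B M I J else 0)"
      unfolding cell_eq by (intro M'(3) masks_less[OF sub])
  qed (use k K' v vt(1) in auto)
  moreover have "\<forall>u\<in>insert v act. (vt(k := v)) (?slot u) = u"
    using vt(1) k(2) v(2) by auto
  moreover have "low_memory (insert v act) ?slot ?M"
    using low M'(1) v by (auto simp: low_memory_def B)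
  moreover have "\<forall>a\<ge>B. \<bar>?M a\<bar> \<le> X" using M'(2) v(1) by (simp add: B)
  moreover have "inj_on ?slot (insert v act)"
    using act(2) k(2) v(2) by (auto simp: inj_on_def)
  moreover have "insert v act \<subseteq> {..<n}" using act(1) v(1) by simp
  ultimately show ?thesis
    unfolding memory_state_def img using sub K'(2) F by blast
qed

lemma memory_state_edge:
  assumes st: "memory_state K act slot F X M" and uv: "u \<in> act" "v \<in> act" "{v, u} \<in> E" "{v, u} \<notin> F"
    and M': "\<forall>a<B. M' a = M a" "\<forall>a\<ge>B. \<bar>M' a\<bar> \<le> X'"
      "\<And>I J. I < 2 ^ K \<Longrightarrow> J < 2 ^ K \<Longrightarrow> cell n B M' I J =
        cell n B M I J + edge_term n (slot v) (slot u) (cell n B M) I J"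
  shows "memory_state K act slot (insert {v, u} F) X' M'"
proof -
  from st obtain vt where vt: "\<forall>v\<in>act. vt (slot v) = v" "forest_table n F (slot ` act) vt (cell n B M)"
    and low: "low_memory act slot M" and act: "slot ` act \<subseteq> {..<K}" "K \<le> n"
    and F: "F \<subseteq> E" unfolding memory_state_def by blast
  have eq: "vt (slot v) = v" "vt (slot u) = u" using vt(1) uv by auto
  have "forest_table n (insert {vt (slot v), vt (slot u)} F) (slot ` act) vt (cell n B M')"
  proof (rule forest_table_insert_edge[OF vt(2)])
    show "finite F" using F finite_E by (rule finite_subset)
    show "slot ` act \<subseteq> {..<n}" using act by auto
    show "vt (slot v) \<noteq> vt (slot u)" using simple uv(3) by (simp add: eq)
    show "{vt (slot v), vt (slot u)} \<notin> F" using uv(4) by (simp add: eq)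
    fix I J assume "I \<in> masks (slot ` act)" "J \<in> masks (slot ` act)"
    then show "cell n B M' I J = cell n B M I J + edge_term n (slot v) (slot u) (cell n B M) I J"
      by (intro M'(3) masks_less[OF act(1)])
  qed (use uv in auto)
  then show ?thesis
    using st vt(1) M'(2) uv(3) low_memory_cong[OF low M'(1)]
    unfolding memory_state_def eq by blast
qed

text \<open>At most \<open>n\<close> edges are inserted with a vertex, each multiplying the bound by
  6, whence \<open>6 ^ n\<close>. With \<open>card act < C\<close> the least free slot is below
  \<open>C\<close>, so the number of slots in use stays at most \<open>C\<close>.\<close>

lemma wp_insert_prog:
  assumes b: "bounded W s M" and s: "s 1 = int n" "s 3 = int L" "s 4 = int B" "s 5 = 2 ^ n" "s 6 = 2 ^ K"
      "s 8 = int v" and nW: "n < W"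
    and st: "memory_state K act slot F X M" and v: "v < n" "v \<notin> act" "\<And>e. e \<in> F \<Longrightarrow> v \<notin> e"
    and C: "K \<le> C" "C \<le> n" "card act < C" and X: "6 ^ n * X < 2 ^ W"
    and Q: "\<And>s' M' K' slot'. bounded W s' M' \<Longrightarrow> same_off ({6, 9, 12, 13, 20} \<union> scratch) s s' \<Longrightarrow>
      s' 6 = 2 ^ K' \<Longrightarrow> K' \<le> C \<Longrightarrow>
      memory_state K' (insert v act) slot' (F \<union> {{v, u} | u. u \<in> act \<and> {v, u} \<in> E}) (6 ^ n * X) M' \<Longrightarrow>
      Q s' M'"
  shows "wp W insert_prog (insert_cost n (2 ^ C)) Q s M"
proof -
  from st have low: "low_memory act slot M" and act: "act \<subseteq> {..<n}" "inj_on slot act"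
      "slot ` act \<subseteq> {..<K}" and MX: "\<And>a. a \<ge> B \<Longrightarrow> \<bar>M a\<bar> \<le> X"
    unfolding memory_state_def by blast+
  have fin: "finite act" using act(1) by (rule finite_subset) simp
  have X0: "X \<ge> 0" using MX[of B] by simp
  have XW: "6 ^ u * X < 2 ^ W" if "u \<le> n" for u
  proof -
    have "6 ^ u * X \<le> 6 ^ n * X" using that X0 by (intro mult_right_mono power_increasing) auto
    then show ?thesis using X by linarith
  qed
  have iW: "int n < 2 ^ W" using b s(1) by (auto simp: bounded_def dest: spec[of _ 1])
  let ?S = "{6, 9, 12, 13, 20} \<union> scratch"
  have ss: "s' 1 = int n" "s' 3 = int L" "s' 4 = int B" "s' 5 = 2 ^ n" "s' 8 = int v"
    if "same_off ?S s s'" for s'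
    using same_offD[OF that] s by (simp_all add: scratch_def)
  show ?thesis unfolding insert_prog_def insert_cost_def
  proof (rule wp_Seq[OF _ order_refl], rule wp_slot_prog[OF b s(1,2) nW _ act(1)])
    show "M (L + v) = (if v \<in> act then 2 ^ slot v else 0)" if "v < n" for v
      using low that by (simp add: low_memory_def)
    show "card act < n" using C by simp
    fix s1 k
    assume b1: "bounded W s1 M" and so1: "same_off {9, 12, 20} s s1" and s1: "s1 12 = 2 ^ k"
      and k: "{..<k} \<subseteq> slot ` act" "k \<notin> slot ` act"
    have so1': "same_off ?S s s1" by (rule same_off_mono[OF so1]) auto
    have s16: "s1 6 = 2 ^ K" using same_offD[OF so1] s by simp
    have "card {..<k} \<le> card (slot ` act)" using fin by (intro card_mono k(1)) simp
    then have kC: "k < C" using card_image_le[OF fin, of slot] C(3) by simp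
    \<comment> \<open>All slots below \<open>k\<close> are occupied and all occupied slots lie below
      \<open>K\<close>, so the slots in use grow by at most one.\<close>
    have kK: "k \<le> K"
    proof (rule ccontr)
      assume "\<not> k \<le> K"
      then have "K \<in> {..<k}" by simp
      then have "K \<in> {..<K}" using k(1) act(3) by blast
      then show False by simp
    qed
    define K' where "K' = (if k = K then Suc K else K)"
    have K': "k < K'" "K \<le> K'" "K' \<le> C" "K' \<le> n" using kK kC C by (auto simp: K'_def)
    let ?loop = "For 9 1 (Cond (Mem (Var 3 [+] Var 9) [*] Mem (Const 2 [+] Var 8 [*] Var 1 [+] Var 9))
       (Assign 13 (Mem (Var 3 [+] Var 9)) ;; edge_prog) Skip)"
    let ?rest = "vertex_prog ;; Write (Var 3 [+] Var 8) (Var 12) ;; ?loop"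
    let ?lc = "n * (Suc (Suc (sweep_cost n (2 ^ C))) + 3) + 3"
    have loop: "wp W ?loop ?lc Q s2 M2"
      if b2: "bounded W s2 M2" and so2: "same_off ?S s s2" and s2: "s2 6 = 2 ^ K'" "s2 12 = 2 ^ k"
        and st2: "memory_state K' (insert v act) (slot(v := k)) F X M2" for s2 M2
    proof -
      let ?act = "insert v act" and ?slot = "slot(v := k)"
      let ?F = "\<lambda>u. F \<union> {{v, u'} | u'. u' < u \<and> u' \<in> act \<and> {v, u'} \<in> E}"
      let ?Inv = "\<lambda>u s' M'. same_off ?S s s' \<and> s' 6 = 2 ^ K' \<and> s' 12 = 2 ^ k \<and>
        memory_state K' ?act ?slot (?F u) (6 ^ u * X) M'"
      show ?thesis
      proof (rule wp_For[where Inv = ?Inv])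
        show "s2 1 = int n" using ss[OF so2] by simp
        show "?Inv 0 (s2(9 := 0)) M2" using so2 s2 st2 by simp
      next
        fix u s3 M3
        assume u: "u < n" and I3: "?Inv u s3 M3" and s3: "s3 9 = int u" "s3 1 = int n" "bounded W s3 M3"
        from I3 have so3: "same_off ?S s s3" and s3': "s3 6 = 2 ^ K'" "s3 12 = 2 ^ k"
          and st3: "memory_state K' ?act ?slot (?F u) (6 ^ u * X) M3" by auto
        note r3 = ss[OF so3]
        from st3 have low3: "low_memory ?act ?slot M3" and M3X: "\<And>a. a \<ge> B \<Longrightarrow> \<bar>M3 a\<bar> \<le> 6 ^ u * X"
          and inj3: "inj_on ?slot ?act" and sl3: "?slot ` ?act \<subseteq> {..<K'}"
          unfolding memory_state_def by blast+
        let ?l = "Mem (Var 3 [+] Var 9)" and ?a = "Mem (Const 2 [+] Var 8 [*] Var 1 [+] Var 9)"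
        have l: "aval ?l s3 M3 = (if u \<in> ?act then 2 ^ ?slot u else 0)"
          using low3 r3 s3 u by (simp add: low_memory_def nat_int_add)
        have a: "aval ?a s3 M3 = of_bool ({v, u} \<in> E)"
        proof -
          have "2 + v * n + u < L"
          proof -
            have "Suc v * n \<le> n * n" using v(1) by (intro mult_le_mono1) simp
            then show ?thesis using L u by simp
          qed
          then have "M3 (2 + v * n + u) = of_bool ({v, u} \<in> E)"
            using low3 adj[OF v(1) u] by (simp add: low_memory_def)
          moreover have "aval (Const 2 [+] Var 8 [*] Var 1 [+] Var 9) s3 M3 = int (2 + v * n + u)"
            using r3 s3 by simp
          ultimately show ?thesis by (simp only: aval.simps nat_int)
        qed
        have pos: "aval (?l [*] ?a) s3 M3 > 0 \<longleftrightarrow> u \<in> act \<and> {v, u} \<in> E"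
        proof -
          have "{v, u} \<in> E \<Longrightarrow> u \<noteq> v" using simple[of v u] by auto
          then show ?thesis unfolding aval.simps(3) apply_op.simps l a by auto
        qed
        let ?P = "\<lambda>s' M'. bounded W s' M' \<and> s' 9 = int u \<and> s' 1 = int n \<and> ?Inv (Suc u) (s'(9 := int (Suc u))) M'"
        show "wp W (Cond (?l [*] ?a) (Assign 13 ?l ;; edge_prog) Skip)
            (Suc (Suc (sweep_cost n (2 ^ C)))) ?P s3 M3"
        proof (rule wp_Cond[OF s3(3)])
          assume "aval (?l [*] ?a) s3 M3 > 0"
          then have uv: "u \<in> act" "{v, u} \<in> E" using pos by auto
          then have uv': "u \<noteq> v" "u \<in> ?act" "?slot u \<noteq> k" "?slot u < K'"
            using simple[of v u] k(2) sl3 by auto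
          have FS: "?F (Suc u) = insert {v, u} (?F u)" using uv by (auto simp: less_Suc_eq)
          \<comment> \<open>No edge of \<open>F\<close> contains \<open>v\<close>, and the edges at
            \<open>v\<close> added so far lead to vertices below \<open>u\<close>.\<close>
          have new: "{v, u} \<notin> ?F u" using v(3) by (auto simp: doubleton_eq_iff)
          let ?s = "s3(13 := 2 ^ ?slot u)"
          have b4: "bounded W ?s M3" by (rule bounded_upd[OF s3(3)]) (use uv'(4) K'(4) nW in simp)
          have edge: "wp W edge_prog (sweep_cost n (2 ^ K')) ?P ?s M3"
          proof (rule wp_edge_prog[where B = B and i = k and j = "?slot u" and X = "6 ^ u * X", OF b4])
            show "6 * (6 ^ u * X) < 2 ^ W" using XW[of "Suc u"] u by simp
            fix s5 M5
            assume b5: "bounded W s5 M5" and so5: "same_off scratch ?s s5" and low5: "\<forall>a<B. M5 a = M3 a"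
              and M5: "\<forall>a\<ge>B. \<bar>M5 a\<bar> \<le> 6 * (6 ^ u * X)"
              and cells: "\<And>I J. I < 2 ^ K' \<Longrightarrow> J < 2 ^ K' \<Longrightarrow> cell n B M5 I J =
                cell n B M3 I J + edge_term n k (?slot u) (cell n B M3) I J"
            have so3': "same_off ?S s ?s" using so3 by simp
            have so5': "same_off ?S s s5" by (rule same_off_trans[OF so3' so5]) auto
            have "memory_state K' ?act ?slot (insert {v, u} (?F u)) (6 * (6 ^ u * X)) M5"
              by (rule memory_state_edge[OF st3 uv'(2) _ uv(2) new low5 M5]) (use cells in auto)
            then have "memory_state K' ?act ?slot (?F (Suc u)) (6 ^ Suc u * X) M5"
              unfolding FS by (simp add: mult.assoc)
            moreover have "s5 9 = int u" "s5 1 = int n" "s5 6 = 2 ^ K'" "s5 12 = 2 ^ k"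
              using same_offD[OF so5] s3 s3' by (simp_all add: scratch_def)
            ultimately show "?P s5 M5" using b5 so5' by simp
          qed (use r3 s3' K' uv' M3X in auto)
          show "wp W (Assign 13 ?l ;; edge_prog) (Suc (sweep_cost n (2 ^ C))) ?P s3 M3"
          proof (intro wp_Assign_Seq[OF s3(3)])
            have val: "aval ?l s3 M3 = 2 ^ ?slot u" using l uv' by simp
            show "wp W edge_prog (sweep_cost n (2 ^ K')) ?P (s3(13 := aval ?l s3 M3)) M3"
              unfolding val by (rule edge)
            have "sweep_cost n (2 ^ K') \<le> sweep_cost n (2 ^ C)"
              by (rule sweep_cost_mono) (use K'(3) in simp)
            then show "Suc (sweep_cost n (2 ^ K')) \<le> Suc (sweep_cost n (2 ^ C))" by simp
          qed (use r3 s3 in simp_all)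
        next
          assume "aval (?l [*] ?a) s3 M3 \<le> 0"
          then have "\<not> (u \<in> act \<and> {v, u} \<in> E)" using pos by auto
          then have FS: "?F (Suc u) = ?F u" by (auto simp: less_Suc_eq)
          have "6 ^ u * X \<le> 6 ^ Suc u * X" using X0 by (intro mult_right_mono power_increasing) auto
          from memory_state_mono[OF st3 this]
          have "?P s3 M3" unfolding FS using so3 s3 s3' by simp
          moreover have "W \<ge> 1" using b by (simp add: bounded_def)
          ultimately have "wp W Skip 1 ?P s3 M3" by (intro wp_Skip)
          then show "wp W Skip (Suc (sweep_cost n (2 ^ C))) ?P s3 M3" by (rule wp_mono) auto
        qed (use r3 s3 in \<open>simp_all add: int_len_2\<close>)
      next
        fix s3 M3
        assume I3: "?Inv n s3 M3" and b3: "bounded W s3 M3"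
        have "?F n = F \<union> {{v, u} | u. u \<in> act \<and> {v, u} \<in> E}" using act(1) by auto
        then show "Q s3 M3" using I3 b3 K'(3) by (intro Q[of s3 M3 K' ?slot]) auto
      qed (use b2 iW in auto)
    qed
    have rest: "wp W ?rest (sweep_cost n (2 ^ C) + (1 + ?lc)) Q s2 M"
      if b2: "bounded W s2 M" and so2: "same_off ?S s s2" and s2: "s2 6 = 2 ^ K'" "s2 12 = 2 ^ k" for s2
    proof (rule wp_Seq[OF _ order_refl], rule wp_mono[OF _ sweep_cost_mono])
      show "wp W vertex_prog (sweep_cost n (2 ^ K'))
        (wp W (Write (Var 3 [+] Var 8) (Var 12) ;; ?loop) (1 + ?lc) Q) s2 M"
      proof (rule wp_vertex_prog[where B = B and i = k and X = X, OF b2])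
        show "X < 2 ^ W" using XW[of 0] by simp
        fix s3 M3
        assume b3: "bounded W s3 M3" and so3: "same_off scratch s2 s3" and low3: "\<forall>a<B. M3 a = M a"
          and M3: "\<forall>a\<ge>B. \<bar>M3 a\<bar> \<le> X"
          and cells: "\<And>I J. I < 2 ^ K' \<Longrightarrow> J < 2 ^ K' \<Longrightarrow> cell n B M3 I J = (if bit I k = bit J k then
            if bit I k then slot_sign n k I * slot_sign n k J * cell n B M (I - 2 ^ k) (J - 2 ^ k)
            else cell n B M I J else 0)"
        have so3': "same_off ?S s s3" by (rule same_off_trans[OF so2 so3]) auto
        note r3 = ss[OF so3']
        have s3: "s3 6 = 2 ^ K'" "s3 12 = 2 ^ k"
          using same_offD[OF so3] s2 by (simp_all add: scratch_def)
        have kW: "\<bar>2 ^ k\<bar> < (2::int) ^ W" using kC C(2) nW by simp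
        show "wp W (Write (Var 3 [+] Var 8) (Var 12) ;; ?loop) (1 + ?lc) Q s3 M3"
        proof (rule wp_Seq[OF wp_Write[OF b3] order_refl])
          have addr: "nat (aval (Var 3 [+] Var 8) s3 M3) = L + v" using r3 by (simp add: nat_int_add)
          have val: "aval (Var 12) s3 M3 = 2 ^ k" using s3 by simp
          show "wp W ?loop ?lc Q s3 (M3(nat (aval (Var 3 [+] Var 8) s3 M3) := aval (Var 12) s3 M3))"
            unfolding addr val
            by (intro loop bounded_upd_mem[OF b3 kW] so3' s3
                memory_state_vertex[OF st v K'(1) k(2) K'(2,4) low3 M3 cells])
        qed (use r3 in simp_all)
      qed (use ss[OF so2] s2 K' MX in auto)
    qed (use K'(3) in auto)
    let ?c = "Var 12 [-] Var 6 [+] Const 1"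
    have c: "aval ?c s1 M > 0 \<longleftrightarrow> k = K"
    proof -
      have "aval ?c s1 M = 2 ^ k - 2 ^ K + 1" using s1 s16 by simp
      moreover have "(2::int) ^ k < 2 ^ K \<longleftrightarrow> k \<noteq> K" using kK by (simp add: less_le)
      ultimately show ?thesis using kK by (cases "k = K") auto
    qed
    have W: "W \<ge> 1" using b by (simp add: bounded_def)
    show "wp W (Cond ?c (Assign 6 (Var 6 [+] Var 6)) Skip ;; ?rest)
       (2 + (sweep_cost n (2 ^ C) + (1 + ?lc))) Q s1 M"
    proof (rule wp_Seq[OF _ order_refl], rule wp_Cond[of _ _ _ _ _ 1, unfolded One_nat_def[symmetric] Suc_1, OF b1])
      assume "aval ?c s1 M > 0"
      then have kK: "k = K" using c by simp
      have eq: "s1(6 := aval (Var 6 [+] Var 6) s1 M) = s1(6 := 2 ^ K')"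
        using s16 kK by (simp add: K'_def)
      show "wp W (Assign 6 (Var 6 [+] Var 6)) 1 (wp W ?rest (sweep_cost n (2 ^ C) + (1 + ?lc)) Q) s1 M"
      proof (rule wp_Assign[OF b1])
        show "wp W ?rest (sweep_cost n (2 ^ C) + (1 + ?lc)) Q (s1(6 := aval (Var 6 [+] Var 6) s1 M)) M"
          unfolding eq
        proof (rule rest)
          show "bounded W (s1(6 := 2 ^ K')) M" by (rule bounded_upd[OF b1]) (use K'(4) nW in simp)
        qed (use so1' s1 in auto)
      qed simp_all
    next
      assume "aval ?c s1 M \<le> 0"
      then have "K' = K" using c by (auto simp: K'_def)
      then show "wp W Skip 1 (wp W ?rest (sweep_cost n (2 ^ C) + (1 + ?lc)) Q) s1 M"
        using s1 s16 b1 so1' by (intro wp_Skip[OF W] rest) auto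
    qed (simp_all add: int_len_1)
  qed
qed

end

definition bag_exp :: aexp where
  "bag_exp = Mem (Const 2 [+] Var 1 [*] Var 1 [+] Var 7 [*] Var 1 [+] Var 8)"

definition loc_exp :: aexp where
  "loc_exp = Mem (Var 3 [+] Var 8)"

text \<open>Forgetting a vertex only releases its slot: entries with that slot become stale, and \<open>vertex_prog\<close>
  overwrites them when the slot is used again.\<close>

definition bag_prog :: program where
  "bag_prog = For 8 1 (Write (Var 3 [+] Var 8) (loc_exp [*] bag_exp)) ;;
     For 8 1 (Cond (bag_exp [-] loc_exp) insert_prog Skip)"

definition bag_cost :: "nat \<Rightarrow> nat \<Rightarrow> nat" where
  "bag_cost n m = n * (1 + 3) + 3 + (n * (Suc (insert_cost n m) + 3) + 3)"

definition forest_prog :: program where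
  "forest_prog =
     Assign 1 (Mem (Const 0)) ;; Assign 2 (Mem (Const 1)) ;;
     Assign 3 (Const 2 [+] Var 1 [*] Var 1 [+] Var 2 [*] Var 1) ;; Assign 4 (Var 3 [+] Var 1) ;;
     Assign 5 (Const 1) ;; For 8 1 (Assign 5 (Var 5 [+] Var 5)) ;;
     Assign 6 (Const 1) ;; Write (Var 4) (Const 1) ;;
     For 7 2 bag_prog ;; Assign 0 (Mem (Var 4))"

definition forest_cost :: "nat \<Rightarrow> nat \<Rightarrow> nat \<Rightarrow> nat" where
  "forest_cost n r m = n * 4 + r * (bag_cost n m + 3) + 14"

context forest_memory
begin

lemma memory_state_remove:
  assumes "memory_state K act slot F X M" "v < n"
  shows "memory_state K (act - {v}) slot F X (M(L + v := 0))"
proof -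
  from assms(1) obtain vt where vt: "\<forall>v\<in>act. vt (slot v) = v" "forest_table n F (slot ` act) vt (cell n B M)"
    unfolding memory_state_def by blast
  have "cell n B (M(L + v := 0)) = cell n B M"
    using assms(2) by (intro ext) (simp add: cell_def B)
  then have "forest_table n F (slot ` (act - {v})) vt (cell n B (M(L + v := 0)))"
    using forest_table_mono[OF vt(2), of "slot ` (act - {v})"] by auto
  moreover have "low_memory (act - {v}) slot (M(L + v := 0))"
    using assms by (auto simp: memory_state_def low_memory_def)
  moreover have "\<forall>a\<ge>B. \<bar>(M(L + v := 0)) a\<bar> \<le> X"
    using assms by (simp add: memory_state_def) (simp add: B)
  moreover have "inj_on slot (act - {v})" "act - {v} \<subseteq> {..<n}" "slot ` (act - {v}) \<subseteq> {..<K}"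
    "K \<le> n" "F \<subseteq> E"
    using assms by (auto simp: memory_state_def inj_on_def)
  moreover have "\<forall>u\<in>act - {v}. vt (slot u) = u" using vt(1) by simp
  ultimately show ?thesis unfolding memory_state_def by blast
qed

end

section \<open>Path decompositions read from left to right\<close>

locale forest_decomposition = forest_memory +
  fixes r C W :: nat and P :: "nat set list"
  assumes L_eq: "L = 2 + n * n + r * n"
    and bag: "\<And>t v. t < r \<Longrightarrow> v < n \<Longrightarrow> inp (2 + n * n + t * n + v) = of_bool (v \<in> P ! t)"
    and edge2: "\<And>e. e \<in> E \<Longrightarrow> card e = 2"
    and pd: "path_decomposition {..<n} E P" and r: "r = length P"
    and C: "\<And>t. t < r \<Longrightarrow> card (P ! t) \<le> C" "C \<le> n"
    and W: "n < W" "r < W" "6 ^ (r * n * n) < (2::int) ^ W"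
begin

definition seen :: "nat \<Rightarrow> nat set" where
  "seen t = (\<Union>s<t. P ! s)"

definition prev :: "nat \<Rightarrow> nat set" where
  "prev t = (if t = 0 then {} else P ! (t - 1))"

definition edges_in :: "nat set \<Rightarrow> nat set set" where
  "edges_in S = {e \<in> E. e \<subseteq> S}"

lemma bag_subset: "t < r \<Longrightarrow> P ! t \<subseteq> {..<n}"
  using pd nth_mem[of t P] by (auto simp: path_decomposition_def r)

lemma bag_interval: "i \<le> j \<Longrightarrow> j \<le> k \<Longrightarrow> k < r \<Longrightarrow> v \<in> P ! i \<Longrightarrow> v \<in> P ! k \<Longrightarrow> v \<in> P ! j"
  using pd unfolding path_decomposition_def r by blast

text \<open>By the interval property a vertex of bag \<open>t\<close> that was met earlier also lies
  in the bag just before. So a forgotten vertex never returns, and what stays active is everything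
  in the bag that has ever been seen.\<close>

lemma prev_inter: "t < r \<Longrightarrow> prev t \<inter> P ! t = P ! t \<inter> seen t"
proof (cases t)
  case (Suc t')
  assume "t < r"
  then have "v \<in> P ! t'" if "s < t" "v \<in> P ! s" "v \<in> P ! t" for s v
    using bag_interval[of s t' t v] that Suc by simp
  then show ?thesis using Suc by (auto simp: prev_def seen_def)
qed (simp add: prev_def seen_def)

text \<open>An edge \<open>{v, u}\<close> with \<open>u\<close> seen lies in some bag
  \<open>s\<close>, and \<open>t \<le> s\<close> because \<open>v\<close> is new. As
  \<open>u\<close> lies in a bag before \<open>t\<close> and in bag \<open>s\<close>, it lies in bag
  \<open>t\<close>. So scanning the active vertices catches all edges from \<open>v\<close> to
  earlier vertices.\<close>

lemma edges_in_insert: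
  assumes t: "t < r" and v: "v \<in> P ! t" "v \<notin> S" and S: "seen t \<subseteq> S" "S \<subseteq> seen t \<union> P ! t"
  shows "edges_in (insert v S) = edges_in S \<union> {{v, u} | u. u \<in> P ! t \<inter> S \<and> {v, u} \<in> E}"
proof (intro equalityI subsetI)
  fix e assume e: "e \<in> edges_in (insert v S)"
  show "e \<in> edges_in S \<union> {{v, u} | u. u \<in> P ! t \<inter> S \<and> {v, u} \<in> E}"
  proof (cases "v \<in> e")
    case False
    then show ?thesis using e by (auto simp: edges_in_def)
  next
    case True
    have "card e = 2" using e edge2 by (simp add: edges_in_def)
    with True obtain u where u: "e = {v, u}" "u \<noteq> v"
      by (auto simp: card_2_iff)
    have uS: "u \<in> S" using e u by (auto simp: edges_in_def)
    have "u \<in> P ! t"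
    proof (cases "u \<in> seen t")
      case False
      then show ?thesis using uS S by auto
    next
      case True
      then obtain s' where s': "s' < t" "u \<in> P ! s'" by (auto simp: seen_def)
      have "e \<in> E" using e by (simp add: edges_in_def)
      then obtain s where s: "s < r" "{v, u} \<subseteq> P ! s"
        using pd unfolding path_decomposition_def r u by (metis in_set_conv_nth)
      have "t \<le> s"
      proof (rule ccontr)
        assume "\<not> t \<le> s"
        then have "v \<in> seen t" using s by (auto simp: seen_def)
        then show False using S v by auto
      qed
      then show ?thesis using bag_interval[of s' t s u] s s' by simp
    qed
    then show ?thesis using e u uS by (auto simp: edges_in_def)
  qed
next
  fix e assume "e \<in> edges_in S \<union> {{v, u} | u. u \<in> P ! t \<inter> S \<and> {v, u} \<in> E}"
  then show "e \<in> edges_in (insert v S)" by (auto simp: edges_in_def)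
qed

lemma edges_in_seen: "edges_in (seen r) = E"
proof -
  have "P ! s \<subseteq> seen r" if "s < r" for s using that by (auto simp: seen_def)
  then have "X \<subseteq> seen r" if "X \<in> set P" for X
    using that by (metis in_set_conv_nth r)
  moreover have "\<exists>X\<in>set P. e \<subseteq> X" if "e \<in> E" for e
    using pd that by (simp add: path_decomposition_def)
  ultimately show ?thesis unfolding edges_in_def by blast
qed

lemma bag_address: "t < r \<Longrightarrow> v < n \<Longrightarrow> 2 + n * n + t * n + v < L"
proof -
  assume "t < r" "v < n"
  then have "Suc t * n \<le> r * n" by (intro mult_le_mono1) simp
  then show "2 + n * n + t * n + v < L" using \<open>v < n\<close> by (simp add: L_eq)
qed

lemma aval_bag_exp:
  assumes "low_memory act slot M" "s 1 = int n" "s 7 = int t" "s 8 = int v" "t < r" "v < n"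
  shows "aval bag_exp s M = of_bool (v \<in> P ! t)"
proof -
  have "aval bag_exp s M = M (nat (int (2 + n * n + t * n + v)))"
    using assms by (simp add: bag_exp_def add.assoc)
  also have "\<dots> = inp (2 + n * n + t * n + v)"
    unfolding nat_int using assms(1) bag_address[OF assms(5,6)] by (simp add: low_memory_def)
  finally show ?thesis using bag assms by simp
qed

lemma aval_loc_exp:
  assumes "low_memory act slot M" "s 3 = int L" "s 8 = int v" "v < n"
  shows "aval loc_exp s M = (if v \<in> act then 2 ^ slot v else 0)"
  using assms by (simp add: loc_exp_def low_memory_def nat_int_add)

lemma cost_bag_exp [simp]: "cost_factor bag_exp = 63" "len_factor bag_exp = 1"
  "cost_factor loc_exp = 17" "len_factor loc_exp = 1"
  by (simp_all add: bag_exp_def loc_exp_def int_len_2)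

lemma safe_bag_exp:
  "s 1 = int n \<Longrightarrow> s 7 = int t \<Longrightarrow> s 8 = int v \<Longrightarrow> safe bag_exp s M"
  "s 3 = int L \<Longrightarrow> s 8 = int v \<Longrightarrow> safe loc_exp s M"
  by (simp_all add: bag_exp_def loc_exp_def)

definition changed :: "nat set" where
  "changed = {6, 8, 9, 12, 13, 20} \<union> scratch"

lemma int_less_W: "int n < 2 ^ W" "int r < 2 ^ W"
proof -
  have "int a < 2 ^ W" if "a < W" for a
    using of_nat_less_two_power[of W, where 'a = int] that by linarith
  then show "int n < 2 ^ W" "int r < 2 ^ W" using W by auto
qed

lemma wp_bag_prog:
  assumes b: "bounded W s M" and s: "s 1 = int n" "s 3 = int L" "s 4 = int B" "s 5 = 2 ^ n" "s 6 = 2 ^ K"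
      "s 7 = int t" and t: "t < r" and KC: "K \<le> C"
    and st: "memory_state K (prev t) slot (edges_in (seen t)) (6 ^ (t * n * n)) M"
    and Q: "\<And>s' M' K' slot'. bounded W s' M' \<Longrightarrow> same_off changed s s' \<Longrightarrow>
      s' 6 = 2 ^ K' \<Longrightarrow> K' \<le> C \<Longrightarrow>
      memory_state K' (prev (Suc t)) slot' (edges_in (seen (Suc t))) (6 ^ (Suc t * n * n)) M' \<Longrightarrow> Q s' M'"
  shows "wp W bag_prog (bag_cost n (2 ^ C)) Q s M"
proof -
  have W1: "W \<ge> 1" using W(1) by simp
  have ss: "s' 1 = int n" "s' 3 = int L" "s' 4 = int B" "s' 5 = 2 ^ n" "s' 7 = int t"
    if "same_off changed s s'" for s'
    using same_offD[OF that] s by (simp_all add: changed_def scratch_def)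
  let ?F = "edges_in (seen t)" and ?X = "6 ^ (t * n * n)"
  let ?act = "\<lambda>v. prev t - {u. u < v \<and> u \<notin> P ! t}"
  let ?Inv = "\<lambda>v s' M'. same_off {8} s s' \<and> memory_state K (?act v) slot ?F ?X M'"
  let ?loop = "For 8 1 (Cond (bag_exp [-] loc_exp) insert_prog Skip)"
  let ?lc = "n * (Suc (insert_cost n (2 ^ C)) + 3) + 3"
  let ?S = "\<lambda>v. seen t \<union> (P ! t \<inter> {..<v})"
  \<comment> \<open>Every pair of a bag and a candidate vertex processed so far accounts for at most
    \<open>n\<close> edges, hence the exponent \<open>(t * n + v) * n\<close>.\<close>
  let ?J = "\<lambda>v s' M'. same_off changed s s' \<and> (\<exists>K slot. s' 6 = 2 ^ K \<and> K \<le> C \<and>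
      memory_state K (P ! t \<inter> ?S v) slot (edges_in (?S v)) (6 ^ ((t * n + v) * n)) M')"
  have loop: "wp W ?loop ?lc Q s1 M1" if b1: "bounded W s1 M1" and J: "?J 0 (s1(8 := 0)) M1" for s1 M1
  proof (rule wp_For[where Inv = ?J])
    have "same_off changed s s1" using J by (simp add: changed_def)
    then show "s1 1 = int n" by (rule ss)
    show "?J 0 (s1(8 := 0)) M1" by (rule J)
  next
    fix v s2 M2
    assume v: "v < n" and J2: "?J v s2 M2" and s2: "s2 8 = int v" "s2 1 = int n" "bounded W s2 M2"
    from J2 obtain K slot where so2: "same_off changed s s2" and K: "s2 6 = 2 ^ K" "K \<le> C"
      and st2: "memory_state K (P ! t \<inter> ?S v) slot (edges_in (?S v)) (6 ^ ((t * n + v) * n)) M2" by blast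
    note r2 = ss[OF so2]
    have low: "low_memory (P ! t \<inter> ?S v) slot M2" using st2 by (simp add: memory_state_def)
    have vals: "aval bag_exp s2 M2 = of_bool (v \<in> P ! t)"
      "aval loc_exp s2 M2 = (if v \<in> P ! t \<inter> ?S v then 2 ^ slot v else 0)"
      using aval_bag_exp[OF low r2(1,5) s2(1) t v] aval_loc_exp[OF low r2(2) s2(1) v] by blast+
    \<comment> \<open>An active location is at least 1 and the bag bit at most 1, so the difference
      is positive only for an inactive vertex of the bag, that is, one not seen before.\<close>
    have pos: "aval (bag_exp [-] loc_exp) s2 M2 > 0 \<longleftrightarrow> v \<in> P ! t \<and> v \<notin> seen t"
    proof -
      have "(2::int) ^ slot v < 1 \<longleftrightarrow> False" by (simp add: not_less)
      then show ?thesis unfolding aval.simps(3) apply_op.simps vals by auto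
    qed
    let ?P = "\<lambda>s' M'. bounded W s' M' \<and> s' 8 = int v \<and> s' 1 = int n \<and> ?J (Suc v) (s'(8 := int (Suc v))) M'"
    show "wp W (Cond (bag_exp [-] loc_exp) insert_prog Skip) (Suc (insert_cost n (2 ^ C))) ?P s2 M2"
    proof (rule wp_Cond[OF s2(3)])
      assume "aval (bag_exp [-] loc_exp) s2 M2 > 0"
      then have vt: "v \<in> P ! t" "v \<notin> seen t" using pos by auto
      have S: "?S (Suc v) = insert v (?S v)" using vt by (auto simp: less_Suc_eq)
      have act: "P ! t \<inter> ?S (Suc v) = insert v (P ! t \<inter> ?S v)" using vt by (auto simp: less_Suc_eq)
      have F: "edges_in (?S (Suc v)) = edges_in (?S v) \<union> {{v, u} | u. u \<in> P ! t \<inter> ?S v \<and> {v, u} \<in> E}"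
        unfolding S by (rule edges_in_insert[OF t vt(1)]) (use vt in auto)
      have pow: "6 ^ n * 6 ^ ((t * n + v) * n) = (6::int) ^ ((t * n + Suc v) * n)"
        by (simp add: algebra_simps flip: power_add)
      have XW: "6 ^ n * 6 ^ ((t * n + v) * n) < (2::int) ^ W"
      proof -
        have "Suc t * n \<le> r * n" using t by (intro mult_le_mono1) simp
        then have "t * n + Suc v \<le> r * n" using v by simp
        then have "(t * n + Suc v) * n \<le> r * n * n" by (rule mult_le_mono1)
        then have "(6::int) ^ ((t * n + Suc v) * n) \<le> 6 ^ (r * n * n)" by (intro power_increasing) auto
        then show ?thesis using W(3) unfolding pow by linarith
      qed
      have cardC: "card (P ! t \<inter> ?S v) < C"
      proof -
        have "finite (P ! t)" using bag_subset[OF t] by (rule finite_subset) simp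
        moreover have "P ! t \<inter> ?S v \<subset> P ! t" using vt by auto
        ultimately have "card (P ! t \<inter> ?S v) < card (P ! t)" by (rule psubset_card_mono)
        then show ?thesis using C(1)[OF t] by simp
      qed
      show "wp W insert_prog (insert_cost n (2 ^ C)) ?P s2 M2"
      proof (rule wp_insert_prog[OF s2(3) s2(2) r2(2-4) K(1) s2(1) W(1) st2 v _ _ K(2) C(2) cardC XW])
        show "v \<notin> P ! t \<inter> ?S v" using vt by auto
        show "v \<notin> e" if "e \<in> edges_in (?S v)" for e using that vt by (auto simp: edges_in_def)
        fix s3 M3 K' slot'
        assume b3: "bounded W s3 M3" and so3: "same_off ({6, 9, 12, 13, 20} \<union> scratch) s2 s3"
          and K': "s3 6 = 2 ^ K'" "K' \<le> C"
          and st3: "memory_state K' (insert v (P ! t \<inter> ?S v)) slot'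
            (edges_in (?S v) \<union> {{v, u} | u. u \<in> P ! t \<inter> ?S v \<and> {v, u} \<in> E})
            (6 ^ n * 6 ^ ((t * n + v) * n)) M3"
        have so3': "same_off changed s s3"
          by (rule same_off_trans[OF so2 so3]) (auto simp: changed_def)
        have "s3 8 = int v" "s3 1 = int n" using same_offD[OF so3] s2 by (simp_all add: scratch_def)
        moreover have "same_off changed s (s3(8 := int (Suc v)))" using so3' by (simp add: changed_def)
        moreover have "(s3(8 := int (Suc v))) 6 = 2 ^ K'" using K' by simp
        ultimately show "?P s3 M3"
          using b3 K'(2) st3 unfolding act[symmetric] F[symmetric] pow by blast
      qed
    next
      assume "aval (bag_exp [-] loc_exp) s2 M2 \<le> 0"
      then have "\<not> (v \<in> P ! t \<and> v \<notin> seen t)" using pos by auto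
      then have S: "?S (Suc v) = ?S v" by (auto simp: less_Suc_eq)
      have "(6::int) ^ ((t * n + v) * n) \<le> 6 ^ ((t * n + Suc v) * n)"
        by (intro power_increasing mult_le_mono1) auto
      from memory_state_mono[OF st2 this]
      have "memory_state K (P ! t \<inter> ?S (Suc v)) slot (edges_in (?S (Suc v))) (6 ^ ((t * n + Suc v) * n)) M2"
        unfolding S .
      moreover have "same_off changed s (s2(8 := int (Suc v)))" using so2 by (simp add: changed_def)
      moreover have "(s2(8 := int (Suc v))) 6 = 2 ^ K" using K by simp
      ultimately have post: "?P s2 M2" using s2 K(2) by blast
      have "wp W Skip 1 ?P s2 M2" by (rule wp_Skip[OF W1]) (rule post)
      then show "wp W Skip (insert_cost n (2 ^ C)) ?P s2 M2"
        by (rule wp_mono) (simp_all add: insert_cost_def)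
    qed (use r2 s2 safe_bag_exp in \<open>simp_all\<close>)
  next
    fix s2 M2
    assume J: "?J n s2 M2" and b2: "bounded W s2 M2"
    have S: "?S n = seen (Suc t)" using bag_subset[OF t] by (auto simp: seen_def less_Suc_eq)
    have p: "P ! t \<inter> ?S n = prev (Suc t)" using bag_subset[OF t] by (auto simp: prev_def)
    have e: "(t * n + n) * n = Suc t * n * n" by (simp add: algebra_simps)
    from J obtain K slot where so2: "same_off changed s s2" and K: "s2 6 = 2 ^ K" "K \<le> C"
      and st2: "memory_state K (P ! t \<inter> ?S n) slot (edges_in (?S n)) (6 ^ ((t * n + n) * n)) M2" by blast
    show "Q s2 M2" by (rule Q[OF b2 so2 K st2[unfolded p e, unfolded S]])
  qed (use b1 int_less_W in auto)
  show ?thesis unfolding bag_prog_def bag_cost_def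
  proof (rule wp_Seq[OF _ order_refl], rule wp_For[where Inv = ?Inv, OF _ _ _ b s(1)])
    show "?Inv 0 (s(8 := 0)) M" using st by simp
  next
    fix v s1 M1
    assume v: "v < n" and I: "?Inv v s1 M1" and s1: "s1 8 = int v" "s1 1 = int n" "bounded W s1 M1"
    have so1: "same_off changed s s1"
      by (rule same_off_mono[of "{8}"]) (use I in \<open>auto simp: changed_def\<close>)
    note r1 = ss[OF so1]
    have low: "low_memory (?act v) slot M1" using I by (simp add: memory_state_def)
    let ?e = "loc_exp [*] bag_exp"
    have val: "aval ?e s1 M1 = (if v \<in> P ! t then M1 (L + v) else 0)"
    proof -
      have "aval bag_exp s1 M1 = of_bool (v \<in> P ! t)"
        by (rule aval_bag_exp[OF low]) (use r1 s1 t v in simp_all)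
      moreover have "aval loc_exp s1 M1 = M1 (L + v)"
        using r1 s1 by (simp add: loc_exp_def nat_int_add)
      ultimately show ?thesis by simp
    qed
    have valW: "\<bar>aval ?e s1 M1\<bar> < 2 ^ W"
      unfolding val using s1(3) by (simp add: bounded_def)
    have addr: "nat (aval (Var 3 [+] Var 8) s1 M1) = L + v" using r1 s1 by (simp add: nat_int_add)
    show "wp W (Write (Var 3 [+] Var 8) ?e) 1 (\<lambda>s' M'. bounded W s' M' \<and> s' 8 = int v \<and> s' 1 = int n \<and>
        ?Inv (Suc v) (s'(8 := int (Suc v))) M') s1 M1"
    proof (rule wp_Write[OF s1(3)])
      have "memory_state K (?act (Suc v)) slot ?F ?X (M1(L + v := aval ?e s1 M1))"
      proof (cases "v \<in> P ! t")
        case True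
        then have "?act (Suc v) = ?act v" by (auto simp: less_Suc_eq)
        then show ?thesis unfolding val using I True by simp
      next
        case False
        then have "?act (Suc v) = ?act v - {v}" by (auto simp: less_Suc_eq)
        then show ?thesis unfolding val using memory_state_remove[OF _ v] I False by simp
      qed
      then show "bounded W s1 (M1(nat (aval (Var 3 [+] Var 8) s1 M1) := aval ?e s1 M1)) \<and> s1 8 = int v \<and>
          s1 1 = int n \<and> ?Inv (Suc v) (s1(8 := int (Suc v))) (M1(nat (aval (Var 3 [+] Var 8) s1 M1) := aval ?e s1 M1))"
        unfolding addr using bounded_upd_mem[OF s1(3) valW] s1 I by simp
    qed (use r1 s1 safe_bag_exp in simp_all)
  next
    fix s1 M1
    assume I: "?Inv n s1 M1" and s1: "s1 8 = int n" "s1 1 = int n" "bounded W s1 M1"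
    show "wp W ?loop ?lc Q s1 M1"
    proof (rule loop[OF s1(3)])
      have "prev t \<subseteq> {..<n}" using st by (simp add: memory_state_def)
      then have p: "P ! t \<inter> ?S 0 = ?act n" using prev_inter[OF t] by auto
      have e: "?S 0 = seen t" "(t * n + 0) * n = t * n * n" by auto
      have st1: "memory_state K (P ! t \<inter> ?S 0) slot (edges_in (?S 0)) (6 ^ ((t * n + 0) * n)) M1"
        unfolding p unfolding e using I by blast
      have "same_off changed s (s1(8 := 0))"
        by (rule same_off_mono[of "{8}"]) (use I in \<open>auto simp: changed_def\<close>)
      moreover have "(s1(8 := 0)) 6 = 2 ^ K" using same_offD[of "{8}" s s1 6] I s(5) by simp
      ultimately show "?J 0 (s1(8 := 0)) M1" using st1 KC by blast
    qed
  qed (use int_less_W in auto)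
qed

text \<open>Initially the table is a single 1 at address \<open>B\<close>: the empty graph has one
  forest, and its empty minor is 1. The result is read off the same cell, whose masks are empty and
  hence meaningful for any set of occupied slots.\<close>

lemma wp_forest_prog:
  assumes s: "s = (\<lambda>_. 0)" and M: "\<And>a. a < L \<Longrightarrow> M a = inp a" "\<And>a. a \<ge> L \<Longrightarrow> M a = 0"
    and M01: "M 0 = int n" "M 1 = int r" and b: "bounded W s M" and LW: "int B < 2 ^ W"
    and n: "n \<ge> 1"
  shows "wp W forest_prog (forest_cost n r (2 ^ C)) (\<lambda>s' M'. s' 0 = int (num_forests E)) s M"
proof -
  let ?Q = "\<lambda>s' M'. s' 0 = int (num_forests E)"
  have W1: "\<bar>1\<bar> < (2::int) ^ W" by (rule bounded_abs_le_1[OF b]) simp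
  let ?s4 = "s(1 := int n, 2 := int r, 3 := int L, 4 := int B)"
  let ?init = "For 8 1 (Assign 5 (Var 5 [+] Var 5))"
  let ?main = "For 7 2 bag_prog ;; Assign 0 (Mem (Var 4))"
  let ?mc = "r * (bag_cost n (2 ^ C) + 3) + 3 + 1"
  have main: "wp W ?main ?mc ?Q s1 M1"
    if b1: "bounded W s1 M1" and s1: "s1 1 = int n" "s1 2 = int r" "s1 3 = int L" "s1 4 = int B"
      "s1 5 = 2 ^ n" "s1 6 = 2 ^ 0" and M1: "M1 = M(B := 1)" for s1 M1
  proof (rule wp_Seq[OF _ order_refl])
    let ?ch = "insert 7 changed"
    let ?Inv = "\<lambda>t s' M'. same_off ?ch s1 s' \<and> (\<exists>K slot. s' 6 = 2 ^ K \<and> K \<le> C \<and>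
      memory_state K (prev t) slot (edges_in (seen t)) (6 ^ (t * n * n)) M')"
    have ss: "s' 1 = int n" "s' 2 = int r" "s' 3 = int L" "s' 4 = int B" "s' 5 = 2 ^ n"
      if "same_off ?ch s1 s'" for s'
      using same_offD[OF that] s1 by (simp_all add: changed_def scratch_def)
    show "wp W (For 7 2 bag_prog) (r * (bag_cost n (2 ^ C) + 3) + 3) (wp W (Assign 0 (Mem (Var 4))) 1 ?Q) s1 M1"
    proof (rule wp_For[where Inv = ?Inv])
      have "forest_table n {} {} id (cell n B M1)"
        by (rule forest_table_empty) (simp add: cell_def M1)
      moreover have "edges_in {} = {}"
        using edge2 by (auto simp: edges_in_def subset_empty) (metis card.empty zero_neq_numeral)
      moreover have "low_memory {} id M1"
        using M n by (auto simp: low_memory_def M1 B)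
      moreover have "\<forall>a\<ge>B. \<bar>M1 a\<bar> \<le> 1" using M(2) by (auto simp: M1 B)
      ultimately have "memory_state 0 (prev 0) id (edges_in (seen 0)) (6 ^ (0 * n * n)) M1"
        by (auto simp: memory_state_def prev_def seen_def)
      then show "?Inv 0 (s1(7 := 0)) M1" using s1 by (intro conjI exI[of _ 0] exI[of _ id]) simp_all
    next
      fix t s2 M2
      assume t: "t < r" and I: "?Inv t s2 M2" and s2: "s2 7 = int t" "s2 2 = int r" "bounded W s2 M2"
      from I obtain K slot where so: "same_off ?ch s1 s2" and K: "s2 6 = 2 ^ K" "K \<le> C" and
        st: "memory_state K (prev t) slot (edges_in (seen t)) (6 ^ (t * n * n)) M2" by blast
      note r2 = ss[OF so]
      show "wp W bag_prog (bag_cost n (2 ^ C)) (\<lambda>s' M'. bounded W s' M' \<and> s' 7 = int t \<and> s' 2 = int r \<and>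
          ?Inv (Suc t) (s'(7 := int (Suc t))) M') s2 M2"
      proof (rule wp_bag_prog[OF s2(3) r2(1,3-5) K(1) s2(1) t K(2) st])
        fix s3 M3 K' slot'
        assume 3: "bounded W s3 M3" "same_off changed s2 s3" "s3 6 = 2 ^ K'" "K' \<le> C"
          "memory_state K' (prev (Suc t)) slot' (edges_in (seen (Suc t))) (6 ^ (Suc t * n * n)) M3"
        have "same_off ?ch s1 s3" by (rule same_off_trans[OF so 3(2)]) auto
        then have "same_off ?ch s1 (s3(7 := int (Suc t)))" by simp
        moreover have "s3 7 = int t" "s3 2 = int r"
          using same_offD[OF 3(2)] s2 by (simp_all add: changed_def scratch_def)
        moreover have "(s3(7 := int (Suc t))) 6 = 2 ^ K'" using 3 by simp
        ultimately show "bounded W s3 M3 \<and> s3 7 = int t \<and> s3 2 = int r \<and>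
          ?Inv (Suc t) (s3(7 := int (Suc t))) M3" using 3 by blast
      qed
    next
      fix s2 M2
      assume I: "?Inv r s2 M2" and s2: "bounded W s2 M2"
      from I obtain K slot where so: "same_off ?ch s1 s2" and
        st: "memory_state K (prev r) slot (edges_in (seen r)) (6 ^ (r * n * n)) M2" by blast
      from st obtain vt where "forest_table n E (slot ` prev r) vt (cell n B M2)"
        unfolding memory_state_def edges_in_seen by blast
      from forest_table_count[OF this] have "M2 B = int (num_forests E)" by (simp add: cell_def)
      then have "?Q (s2(0 := aval (Mem (Var 4)) s2 M2)) M2" using ss(4)[OF so] by simp
      then show "wp W (Assign 0 (Mem (Var 4))) 1 ?Q s2 M2"
        by (intro wp_Assign[OF s2]) (use ss(4)[OF so] in simp_all)
    qed (use b1 s1 int_less_W in auto)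
  qed
  have "int L \<le> int B" by (simp add: B)
  with LW have LB: "int L < 2 ^ W" by linarith
  have b4: "bounded W ?s4 M" by (intro bounded_upd b) (use int_less_W LB LW in simp_all)
  have pow: "\<bar>2 ^ i\<bar> < (2::int) ^ W" if "i \<le> n" for i using that W by simp
  have c6: "wp W (?init ;; Assign 6 (Const 1) ;; Write (Var 4) (Const 1) ;; ?main)
      (n * (1 + 3) + 3 + (2 + ?mc)) ?Q (?s4(5 := 1)) M"
  proof (rule wp_Seq[OF _ order_refl], rule wp_For[where Inv = "\<lambda>i s' M'. M' = M \<and> s' = ?s4(5 := 2 ^ i, 8 := int i)"])
    show "bounded W (?s4(5 := 1)) M" by (rule bounded_upd[OF b4 W1])
    fix i s' M'
    assume i: "i < n" and I: "M' = M \<and> s' = ?s4(5 := 2 ^ i, 8 := int i)" and b': "bounded W s' M'"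
    have b5: "bounded W (?s4(5 := 2 ^ Suc i, 8 := int i)) M"
      by (intro bounded_upd b4 pow) (use i int_less_W in auto)
    have eq: "s'(5 := aval (Var 5 [+] Var 5) s' M') = ?s4(5 := 2 ^ Suc i, 8 := int i)"
      using I by (auto simp: fun_eq_iff)
    show "wp W (Assign 5 (Var 5 [+] Var 5)) 1 (\<lambda>s' M'. bounded W s' M' \<and> s' 8 = int i \<and> s' 1 = int n \<and>
        M' = M \<and> s'(8 := int (Suc i)) = ?s4(5 := 2 ^ Suc i, 8 := int (Suc i))) s' M'"
      by (rule wp_Assign[OF b'], unfold eq) (use I b5 in \<open>simp_all del: power_Suc\<close>)
  next
    fix s' M'
    assume I: "M' = M \<and> s' = ?s4(5 := 2 ^ n, 8 := int n)" and b': "bounded W s' M'"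
    have b6: "bounded W (s'(6 := 1)) M'" by (rule bounded_upd[OF b' W1])
    have wr: "wp W (Write (Var 4) (Const 1) ;; ?main) (1 + ?mc) ?Q (s'(6 := 1)) M'"
    proof (rule wp_Seq[OF wp_Write[OF b6] order_refl])
      have addr: "nat (aval (Var 4) (s'(6 := 1)) M') = B" using I by simp
      have val: "aval (Const 1) (s'(6 := 1)) M' = 1" by simp
      show "wp W ?main ?mc ?Q (s'(6 := 1)) (M'(nat (aval (Var 4) (s'(6 := 1)) M') := aval (Const 1) (s'(6 := 1)) M'))"
        unfolding addr val by (rule main[OF bounded_upd_mem[OF b6 W1]]) (use I in simp_all)
    qed (use I in \<open>simp_all add: int_len_1\<close>)
    show "wp W (Assign 6 (Const 1) ;; Write (Var 4) (Const 1) ;; ?main) (2 + ?mc) ?Q s' M'"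
      by (rule wp_Assign_Seq[OF b', where N = "1 + ?mc"]) (use wr in \<open>simp_all add: int_len_1\<close>)
  qed (use s int_less_W in \<open>auto simp: fun_eq_iff\<close>)
  have c5: "wp W (Assign 5 (Const 1) ;; ?init ;; Assign 6 (Const 1) ;; Write (Var 4) (Const 1) ;; ?main)
      (n * 4 + ?mc + 6) ?Q ?s4 M"
    by (rule wp_Assign_Seq[OF b4, where N = "n * (1 + 3) + 3 + (2 + ?mc)"])
      (use c6 in \<open>simp_all add: int_len_1\<close>)
  have b3: "bounded W (s(1 := int n, 2 := int r, 3 := int L)) M"
    and b2: "bounded W (s(1 := int n, 2 := int r)) M" and b1: "bounded W (s(1 := int n)) M"
    by (intro bounded_upd b; use int_less_W LB in simp)+
  show ?thesis unfolding forest_prog_def forest_cost_def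
  proof (rule wp_Assign_Seq[OF b])
    show "wp W (Assign 2 (Mem (Const 1)) ;; Assign 3 (Const 2 [+] Var 1 [*] Var 1 [+] Var 2 [*] Var 1) ;;
        Assign 4 (Var 3 [+] Var 1) ;; Assign 5 (Const 1) ;; ?init ;; Assign 6 (Const 1) ;;
        Write (Var 4) (Const 1) ;; ?main) (n * 4 + ?mc + 9) ?Q (s(1 := aval (Mem (Const 0)) s M)) M"
    proof -
      have e1: "s(1 := aval (Mem (Const 0)) s M) = s(1 := int n)" using M01 by simp
      have e2: "(s(1 := int n))(2 := aval (Mem (Const 1)) (s(1 := int n)) M) = s(1 := int n, 2 := int r)"
        using M01 by simp
      let ?s2 = "s(1 := int n, 2 := int r)"
      have e3: "?s2(3 := aval (Const 2 [+] Var 1 [*] Var 1 [+] Var 2 [*] Var 1) ?s2 M) = ?s2(3 := int L)"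
        by (simp add: L_eq add.assoc)
      let ?s3 = "?s2(3 := int L)"
      have e4: "?s3(4 := aval (Var 3 [+] Var 1) ?s3 M) = ?s4" by (simp add: B)
      have c4: "wp W (Assign 4 (Var 3 [+] Var 1) ;; Assign 5 (Const 1) ;; ?init ;; Assign 6 (Const 1) ;;
        Write (Var 4) (Const 1) ;; ?main) (n * 4 + ?mc + 7) ?Q ?s3 M"
        by (rule wp_Assign_Seq[OF b3, where N = "n * 4 + ?mc + 6"], unfold e4) (use c5 in simp_all)
      have c3: "wp W (Assign 3 (Const 2 [+] Var 1 [*] Var 1 [+] Var 2 [*] Var 1) ;;
        Assign 4 (Var 3 [+] Var 1) ;; Assign 5 (Const 1) ;; ?init ;; Assign 6 (Const 1) ;;
        Write (Var 4) (Const 1) ;; ?main) (n * 4 + ?mc + 8) ?Q ?s2 M"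
        by (rule wp_Assign_Seq[OF b2, where N = "n * 4 + ?mc + 7"], unfold e3) (use c4 in \<open>simp_all add: int_len_2\<close>)
      show ?thesis unfolding e1
        by (rule wp_Assign_Seq[OF b1, where N = "n * 4 + ?mc + 8"], unfold e2)
          (use c3 in \<open>simp_all add: int_len_1\<close>)
    qed
  qed (simp_all add: int_len_0)
qed

end


section \<open>Input encoding and running time\<close>

lemma length_concat_rows: "length (concat (map (\<lambda>x. map (g x) [0..<n]) ys)) = length ys * n"
  by (induction ys) simp_all

lemma nth_concat_rows:
  "t < length ys \<Longrightarrow> v < n \<Longrightarrow> concat (map (\<lambda>x. map (g x) [0..<n]) ys) ! (t * n + v) = g (ys ! t) v"
proof (induction ys arbitrary: t)
  case (Cons y ys)
  show ?case
  proof (cases t)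
    case 0
    then show ?thesis using Cons.prems by (simp add: nth_append)
  next
    case (Suc t')
    then have "concat (map (\<lambda>x. map (g x) [0..<n]) (y # ys)) ! (t * n + v) =
        concat (map (\<lambda>x. map (g x) [0..<n]) ys) ! (t' * n + v)"
      by (simp add: nth_append)
    then show ?thesis using Cons.IH[of t'] Cons.prems Suc by simp
  qed
qed simp

lemma length_encode_input: "length (encode_input n E P) = 2 + n * n + length P * n"
  unfolding encode_input_def by (simp only: length_append length_concat_rows) simp

lemma nth_encode_input:
  shows "encode_input n E P ! 0 = int n" "encode_input n E P ! 1 = int (length P)"
    and "u < n \<Longrightarrow> v < n \<Longrightarrow> encode_input n E P ! (2 + u * n + v) = of_bool ({u, v} \<in> E)"
    and "t < length P \<Longrightarrow> v < n \<Longrightarrow>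
      encode_input n E P ! (2 + n * n + t * n + v) = of_bool (v \<in> P ! t)"
proof -
  let ?A = "concat (map (\<lambda>i. map (\<lambda>j. of_bool ({i, j} \<in> E)) [0..<n]) [0..<n]) :: int list"
  let ?B = "concat (map (\<lambda>X. map (\<lambda>v. of_bool (v \<in> X)) [0..<n]) P) :: int list"
  have enc: "encode_input n E P = [int n, int (length P)] @ ?A @ ?B" by (simp add: encode_input_def)
  have lenA: "length ?A = n * n" by (simp add: length_concat_rows)
  show "encode_input n E P ! 0 = int n" "encode_input n E P ! 1 = int (length P)"
    by (simp_all add: enc)
  have shift: "encode_input n E P ! (2 + k) = (?A @ ?B) ! k" for k by (simp add: enc)
  show "encode_input n E P ! (2 + u * n + v) = of_bool ({u, v} \<in> E)" if "u < n" "v < n"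
  proof -
    have "Suc u * n \<le> n * n" using that by (intro mult_le_mono1) simp
    then have "u * n + v < length ?A" using that by (simp add: lenA)
    then have "(?A @ ?B) ! (u * n + v) = ?A ! (u * n + v)" by (simp add: nth_append)
    also have "\<dots> = of_bool ({u, v} \<in> E)"
      using nth_concat_rows[of u "[0..<n]" v n "\<lambda>i j. of_bool ({i, j} \<in> E)"] that by simp
    finally show ?thesis using shift[of "u * n + v"] by (simp add: add.assoc)
  qed
  show "encode_input n E P ! (2 + n * n + t * n + v) = of_bool (v \<in> P ! t)" if "t < length P" "v < n"
  proof -
    have "(?A @ ?B) ! (n * n + (t * n + v)) = ?B ! (t * n + v)" by (simp add: nth_append lenA)
    also have "\<dots> = of_bool (v \<in> P ! t)"
      using nth_concat_rows[of t P v n "\<lambda>X v. of_bool (v \<in> X)"] that by simp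
    finally show ?thesis using shift[of "n * n + (t * n + v)"] by (simp add: add.assoc)
  qed
qed

text \<open>\<open>m * m\<close> is the number of table entries; \<open>s ^ 4\<close> collects one
  factor each from the bags, the vertices, their possible neighbours and the rounds of the sign
  loop. The constants are sums of coefficients: 53 = 10 + 16 + 10 + 14 + 3, 132 = 5 + 11 + 10 + 53 +
  53, 146 = 8 + 6 + 132, 167 = 4 + 146 + 3 + 14.\<close>

lemma forest_cost_le:
  assumes s: "n \<le> s" "r \<le> s" "1 \<le> s" and m: "1 \<le> m"
  shows "forest_cost n r m \<le> 167 * (m * m) * s ^ 4"
proof -
  let ?q = "m * m"
  have q1: "1 \<le> ?q" using m by simp
  have qs: "?q * s ^ i \<le> ?q * s ^ j" if "i \<le> j" for i j
    using that s(3) by (intro mult_le_mono2 power_increasing) auto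
  have one: "1 \<le> ?q * s ^ i" for i using q1 s(3) by (simp add: one_le_power)
  have le: "x \<le> ?q * s ^ j" if "x \<le> s ^ i" "i \<le> j" for x i j
  proof -
    have "s ^ i \<le> ?q * s ^ i" using mult_le_mono1[OF q1, of "s ^ i"] by simp
    then show ?thesis using that(1) qs[OF that(2)] by linarith
  qed
  have s1: "n \<le> s ^ 1" "r \<le> s ^ 1" using s by simp_all
  have sweep: "sweep_cost n m \<le> 53 * (?q * s)"
  proof -
    have "n * m \<le> ?q * s" "m \<le> ?q * s" "n * ?q \<le> ?q * s" "?q \<le> ?q * s"
      using mult_le_mono[OF s(1), of m ?q] mult_le_mono[OF s(1), of ?q ?q] mult_le_mono[OF s(3), of m ?q]
        mult_le_mono[OF s(3), of ?q ?q] mult_le_mono[OF m, of m m] by (simp_all add: mult.commute)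
    moreover have "sweep_cost n m = 10 * (n * m) + 16 * m + 10 * (n * ?q) + 14 * ?q + 3"
      by (simp add: sweep_cost_def algebra_simps)
    ultimately show ?thesis using one[of 1] unfolding power_one_right by linarith
  qed
  have mul: "n * (a * (?q * s ^ i)) \<le> a * (?q * s ^ Suc i)" "r * (a * (?q * s ^ i)) \<le> a * (?q * s ^ Suc i)" for a i
    using mult_le_mono1[OF s(1), of "a * (?q * s ^ i)"] mult_le_mono1[OF s(2), of "a * (?q * s ^ i)"]
    by (simp_all add: mult_ac)
  have Suc: "Suc 2 = 3" "Suc 3 = 4" by simp_all
  have n2: "n * n \<le> s ^ 2" using mult_le_mono[OF s(1) s(1)] by (simp add: power2_eq_square)
  have insert: "insert_cost n m \<le> 132 * (?q * s ^ 2)"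
  proof -
    have "n * sweep_cost n m \<le> 53 * (?q * s ^ 2)"
      by (rule order_trans[OF mult_le_mono2[OF sweep] mul(1)[of 53 1, unfolded power_one_right Suc_1]])
    moreover have "insert_cost n m = 5 * (n * n) + 11 * n + 10 + sweep_cost n m + n * sweep_cost n m"
      by (simp add: insert_cost_def algebra_simps)
    moreover have "sweep_cost n m \<le> 53 * (?q * s ^ 2)" using sweep qs[of 1 2, OF one_le_numeral]
      unfolding power_one_right by linarith
    moreover have "n * n \<le> ?q * s ^ 2" "n \<le> ?q * s ^ 2" "1 \<le> ?q * s ^ 2"
      by (rule le[OF n2], simp, rule le[OF s1(1)], simp, rule one)
    ultimately show ?thesis by linarith
  qed
  have bag: "bag_cost n m \<le> 146 * (?q * s ^ 3)"
  proof -
    have "n * insert_cost n m \<le> 132 * (?q * s ^ 3)"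
      by (rule order_trans[OF mult_le_mono2[OF insert] mul(1)[of 132 2, unfolded Suc]])
    moreover have "bag_cost n m = 8 * n + 6 + n * insert_cost n m"
      by (simp add: bag_cost_def algebra_simps)
    moreover have "n \<le> ?q * s ^ 3" "1 \<le> ?q * s ^ 3"
      by (rule le[OF s1(1)], simp, rule one)
    ultimately show ?thesis by linarith
  qed
  have "r * bag_cost n m \<le> 146 * (?q * s ^ 4)"
    by (rule order_trans[OF mult_le_mono2[OF bag] mul(2)[of 146 3, unfolded Suc]])
  moreover have "forest_cost n r m = 4 * n + r * bag_cost n m + 3 * r + 14"
    by (simp add: forest_cost_def algebra_simps)
  moreover have "n \<le> ?q * s ^ 4" "r \<le> ?q * s ^ 4" "1 \<le> ?q * s ^ 4"
    by (rule le[OF s1(1)], simp, rule le[OF s1(2)], simp, rule one)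
  ultimately have "forest_cost n r m \<le> 167 * (?q * s ^ 4)" by linarith
  then show ?thesis by simp
qed

text \<open>Vertex 0 lies in some bag, so the maximal bag size is positive and the subtraction in
  \<open>pd_width\<close> is exact.\<close>

lemma card_bag_le_pd_width:
  assumes "path_decomposition {..<n} E P" "n \<ge> 1"
  shows "X \<in> set P \<Longrightarrow> card X \<le> Suc (pd_width P)" "Suc (pd_width P) \<le> n"
proof -
  have un: "\<Union> (set P) = {..<n}" using assms(1) by (simp add: path_decomposition_def)
  then have fin: "finite X" "card X \<le> n" if "X \<in> set P" for X
    using that finite_subset[of X "{..<n}"] card_mono[of "{..<n}" X] by auto
  have "0 \<in> \<Union> (set P)" unfolding un using assms(2) by simp
  then obtain Y where Y: "Y \<in> set P" "0 \<in> Y" by blast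
  let ?m = "Max (card ` set P)"
  have le: "card X \<le> ?m" if "X \<in> set P" for X using that by simp
  have "card Y > 0" using Y fin by (auto simp: card_gt_0_iff)
  then have "?m > 0" using le[OF Y(1)] by simp
  then have eq: "Suc (pd_width P) = ?m" by (simp add: pd_width_def)
  show "X \<in> set P \<Longrightarrow> card X \<le> Suc (pd_width P)" unfolding eq by (rule le)
  show "Suc (pd_width P) \<le> n" unfolding eq using Y(1) fin(2) by (subst Max_le_iff) auto
qed

lemma outputs_within_forest_prog:
  assumes n: "n \<ge> 1" and G: "simple_graph {..<n} E" and P: "path_decomposition {..<n} E P"
  shows "outputs_within forest_prog (encode_input n E P) (int (num_forests E))
    (runtime_bound 66800000 (pd_width P) n (length P))"
proof -
  define r L B where "r = length P" and "L = 2 + n * n + r * n" and "B = L + n"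
  \<comment> \<open>As \<open>6 \<le> 2 ^ 3\<close>, the table entries fit into
    \<open>3 * (r * n * n)\<close> bits. \<open>B + r\<close> takes care of base addresses, counters
    and powers up to \<open>2 ^ n\<close>, and the 1 makes the inequalities strict. Addresses of
    table cells are longer and are accounted for by \<open>len_factor\<close>.\<close>
  define W where "W = 3 * (r * n * n) + B + r + 1"
  define C where "C = Suc (pd_width P)"
  let ?xs = "encode_input n E P"
  let ?M = "\<lambda>a. if a < length ?xs then ?xs ! a else 0"
  have len: "length ?xs = L" by (simp add: length_encode_input L_def r_def)
  note bags = card_bag_le_pd_width[OF P n]
  have small: "int a < 2 ^ W" if "a \<le> W" for a
  proof -
    have "int a < 2 ^ a" by (rule of_nat_less_two_power)
    also have "\<dots> \<le> 2 ^ W" using that by (intro power_increasing) auto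
    finally show ?thesis .
  qed
  have six: "(6::int) ^ (r * n * n) < 2 ^ W"
  proof -
    have "(6::int) ^ (r * n * n) \<le> 8 ^ (r * n * n)" by (rule power_mono) auto
    also have "\<dots> = 2 ^ (3 * (r * n * n))" by (simp add: power_mult)
    also have "\<dots> < 2 ^ W" by (rule power_strict_increasing) (auto simp: W_def)
    finally show ?thesis .
  qed
  interpret forest_decomposition n L B ?M E r C W P
  proof
    show "B = L + n" by (simp add: B_def)
    show "2 + n * n \<le> L" "L = 2 + n * n + r * n" by (simp_all add: L_def)
    show "?M (2 + u * n + v) = of_bool ({u, v} \<in> E)" if "u < n" "v < n" for u v
    proof -
      have "Suc u * n \<le> n * n" using that by (intro mult_le_mono1) simp
      then have "2 + u * n + v < L" using that by (simp add: L_def)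
      then show ?thesis using nth_encode_input(3)[OF that] by (simp add: len)
    qed
    show "u \<noteq> v" if "{u, v} \<in> E" for u v
      using G that by (auto simp: simple_graph_def)
    have "E \<subseteq> Pow {..<n}" using G by (auto simp: simple_graph_def)
    then show "finite E" by (rule finite_subset) simp
    show "?M (2 + n * n + t * n + v) = of_bool (v \<in> P ! t)" if "t < r" "v < n" for t v
    proof -
      have "Suc t * n \<le> r * n" using that by (intro mult_le_mono1) simp
      then have "2 + n * n + t * n + v < L" using that by (simp add: L_def)
      then show ?thesis using nth_encode_input(4)[of t P v n E] that by (simp add: len r_def)
    qed
    show "card e = 2" if "e \<in> E" for e using G that by (simp add: simple_graph_def)
    show "path_decomposition {..<n} E P" by (rule P)
    show "r = length P" by (simp add: r_def)
    show "card (P ! t) \<le> C" if "t < r" for t using that bags(1) by (simp add: C_def r_def)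
    show "C \<le> n" using bags(2) by (simp add: C_def)
    show "n < W" "r < W" by (simp_all add: W_def B_def L_def)
    show "(6::int) ^ (r * n * n) < 2 ^ W" by (rule six)
  qed
  have M01: "?M 0 = int n" "?M 1 = int r"
    using nth_encode_input(1,2)[of n E P] by (simp_all add: len L_def r_def)
  have memW: "\<bar>?M a\<bar> < 2 ^ W" for a
  proof (cases "a < L")
    case True
    have "?xs ! a \<in> set ?xs" using True by (simp add: len)
    then have "?xs ! a \<in> {int n, int r, 0, 1}"
      by (auto simp: encode_input_def r_def)
    moreover have "int n < 2 ^ W" "int r < 2 ^ W" "int 1 < 2 ^ W"
      by (intro small; simp add: W_def B_def)+
    ultimately show ?thesis using True by (auto simp: len)
  qed (simp add: len)
  have "bounded W (\<lambda>_. 0) ?M"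
    unfolding bounded_def using memW by (simp add: W_def)
  moreover have "int B < 2 ^ W" by (rule small) (simp add: W_def)
  ultimately have wp: "wp W forest_prog (forest_cost n r (2 ^ C)) (\<lambda>s' M'. s' 0 = int (num_forests E)) (\<lambda>_. 0) ?M"
    by (intro wp_forest_prog n M01) (simp_all add: len)
  have "\<forall>x<50. (\<lambda>_. 0::int) x = (\<lambda>_. 0) (x::nat)" by simp
  from wp[unfolded wp_def, THEN spec, THEN mp, OF this] obtain t R' s' M' where ex: "exec forest_prog ((\<lambda>_. 0), ?M) t (R', M')"
    "t \<le> forest_cost n r (2 ^ C) * (10000 * W)" "\<forall>x<50. R' x = s' x" "s' 0 = int (num_forests E)"
    by blast
  let ?s = "n + r"
  have "forest_cost n r (2 ^ C) \<le> 167 * (2 ^ C * 2 ^ C) * ?s ^ 4"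
    by (rule forest_cost_le) (use n in auto)
  \<comment> \<open>A bag may have one vertex more than the width, which costs a constant factor
    4.\<close>
  also have "(2::nat) ^ C * 2 ^ C = 4 * 4 ^ pd_width P"
    by (simp add: C_def flip: power_mult_distrib)
  finally have cost: "forest_cost n r (2 ^ C) \<le> 668 * 4 ^ pd_width P * ?s ^ 4" by simp
  have Ws: "W \<le> 10 * ?s ^ 3"
  proof -
    have s1: "1 \<le> ?s" using n by simp
    have p: "?s ^ i \<le> ?s ^ 3" if "i \<le> 3" for i using that s1 by (intro power_increasing) auto
    have "r * n * n \<le> ?s * ?s * ?s" by (intro mult_le_mono) auto
    then have 1: "r * n * n \<le> ?s ^ 3" by (simp add: power3_eq_cube)
    have "n * n \<le> ?s * ?s" "r * n \<le> ?s * ?s" by (intro mult_le_mono; simp)+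
    then have 2: "n * n \<le> ?s ^ 3" "r * n \<le> ?s ^ 3"
      using p[of 2] by (simp_all add: power2_eq_square)
    have "?s \<le> ?s ^ 3" "1 \<le> ?s ^ 3" using p[of 1] p[of 0] by simp_all
    then have 3: "n \<le> ?s ^ 3" "r \<le> ?s ^ 3" "1 \<le> ?s ^ 3" by linarith+
    have "W = 3 * (r * n * n) + n * n + r * n + n + r + 3" by (simp add: W_def B_def L_def)
    then show ?thesis using 1 2 3 by linarith
  qed
  have "t \<le> 668 * 4 ^ pd_width P * ?s ^ 4 * (10000 * (10 * ?s ^ 3))"
    using ex(2) mult_le_mono[OF cost, of "10000 * W" "10000 * (10 * ?s ^ 3)"] Ws by linarith
  \<comment> \<open>The constant is 668 * 10000 * 10: 668 = 4 * 167 from the number of units, 10000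
    from the size of a unit, 10 from the bound on \<open>W\<close>. The exponent is 4 + 3.\<close>
  also have "\<dots> = 66800000 * 4 ^ pd_width P * ?s ^ 7"
    by (simp add: power_add[of ?s 4 3, simplified])
  \<comment> \<open>\<open>runtime_bound\<close> has a single constant for factor and exponent, so
    the exponent 7 is raised to it; this is sound as \<open>n \<ge> 1\<close>.\<close>
  also have "\<dots> \<le> 66800000 * 4 ^ pd_width P * ?s ^ 66800000"
    using n by (intro mult_le_mono2 power_increasing) auto
  finally have "t \<le> runtime_bound 66800000 (pd_width P) n (length P)"
    by (simp only: runtime_bound_def r_def)
  moreover have "R' 0 = int (num_forests E)" using ex(3,4) by simp
  ultimately show ?thesis
    unfolding outputs_within_def init_state_def using ex(1) by (intro exI conjI)
qed

theorem theorem34: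
  "\<exists>(p :: program) (c :: nat). \<forall>(n :: nat) (E :: nat set set) (P :: nat set list).
     n \<ge> 1 \<and> simple_graph {..<n} E \<and> path_decomposition {..<n} E P \<and>
     pd_width P = pathwidth {..<n} E \<longrightarrow>
     outputs_within p (encode_input n E P) (int (num_forests E))
       (runtime_bound c (pathwidth {..<n} E) n (length P))"
proof (intro exI allI impI)
  fix n :: nat and E :: "nat set set" and P :: "nat set list"
  assume "n \<ge> 1 \<and> simple_graph {..<n} E \<and> path_decomposition {..<n} E P \<and>
    pd_width P = pathwidth {..<n} E"
  then have G: "n \<ge> 1" "simple_graph {..<n} E" "path_decomposition {..<n} E P"
    and eq: "pathwidth {..<n} E = pd_width P" by simp_all
  show "outputs_within forest_prog (encode_input n E P) (int (num_forests E))
      (runtime_bound 66800000 (pathwidth {..<n} E) n (length P))"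
    unfolding eq by (rule outputs_within_forest_prog[OF G])
qed

end
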